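(* Let $d\ge3$, let $X,Y\subset\mathbb{R}^d$ be convex subsets, $s\ge0$, $w\in\mathcal{W}_{d,s}$ and $\psi_0\in H^s$ with $\mathbf{1}_X\psi_0=\psi_0$. Let $\psi\in\mathcal{C}^0([0,T_{\max}),H^s)\cap\mathcal{C}^1([0,T_{\max}),H^{s-1})$ be the unique maximal solution of $i\partial_t\psi=(\langle\nabla\rangle+w*|\psi|^2)\psi$, $\psi|_{t=0}=\psi_0$ (for the potentials and data considered, this also coincides with the local solution in the class $\mathcal{C}^0\cap\mathcal{C}^1\cap L^a_{\mathrm{loc}}L^{b,2}$ obtained via Strichartz estimates). Then $$\forall t\in[0,T_{\max}),\qquad \|\mathbf{1}_Y\psi_t\|_{L^2}\le e^{t-\mathrm{dist}(X,Y)}\|\psi_0\|_{L^2}.$$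
   Context: $\langle\nabla\rangle:=\mathcal{F}^{-1}\sqrt{1+|\xi|^2}\mathcal{F}$ with $\mathcal{F}$ the unitary Fourier transform; $H^s=\{f:\langle\nabla\rangle^sf\in L^2\}$. The potential $w$ is real. $\mathcal{M}$ is the space of finite signed Radon measures with total variation norm; $L^{p,\infty}$ is weak $L^p$. $\mathcal{W}_{d,s}=L^{\frac d{2s},\infty}+L^\infty$ if $s<\frac d2$, $\bigcup_{q>1}(L^{q,\infty}+L^\infty)$ if $s=\frac d2$, $\mathcal{M}+L^\infty$ if $s>\frac d2$. A solution is a function in $\mathcal{C}^0([0,T_{\max}),H^s)\cap\mathcal{C}^1([0,T_{\max}),H^{s-1})$ satisfying the equation in $H^{s-1}$, with $T_{\max}\in(0,\infty]$ its maximal existence time (either $T_{\max}=\infty$ or $\|\psi_t\|_{H^s}\to\infty$ as $t\to T_{\max}$). $\mathrm{dist}(X,Y)$ is the Euclidean distance between the sets. *)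

theory Defs
  imports "HOL-Analysis.Analysis"
begin

text \<open>Functions on R^d (d = DIM('a)); all function spaces are taken modulo a.e. equality,
  integrals are over Lebesgue measure.\<close>

definition sq_int :: "('a::euclidean_space \<Rightarrow> complex) \<Rightarrow> bool" where
  "sq_int f \<longleftrightarrow> f \<in> borel_measurable borel \<and> integrable lborel (\<lambda>x. (cmod (f x))\<^sup>2)"

definition L2_sq :: "('a::euclidean_space \<Rightarrow> complex) \<Rightarrow> ennreal" where
  "L2_sq f = (\<integral>\<^sup>+x. ennreal ((cmod (f x))\<^sup>2) \<partial>lebesgue)"

definition L2_norm :: "('a::euclidean_space \<Rightarrow> complex) \<Rightarrow> real" where
  "L2_norm f = sqrt (enn2real (L2_sq f))"

definition fourier_L1 :: "('a::euclidean_space \<Rightarrow> complex) \<Rightarrow> 'a \<Rightarrow> complex" where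
  "fourier_L1 f \<xi> = complex_of_real ((2 * pi) powr (- real DIM('a) / 2)) *
     (\<integral>x. exp (- \<i> * complex_of_real (inner \<xi> x)) * f x \<partial>lborel)"

definition is_fourier_L2 :: "('a::euclidean_space \<Rightarrow> complex) \<Rightarrow> ('a \<Rightarrow> complex) \<Rightarrow> bool" where
  "is_fourier_L2 f g \<longleftrightarrow> sq_int f \<and> sq_int g \<and>
     ((\<lambda>R. L2_sq (\<lambda>\<xi>. fourier_L1 (\<lambda>x. indicator (ball 0 R) x * f x) \<xi> - g \<xi>)) \<longlongrightarrow> 0) at_top"

text \<open>Japanese bracket and weighted L2 on the Fourier side: g is the Fourier transform of an
  element of H^s iff the weighted norm below is finite.\<close>
definition jb :: "'a::euclidean_space \<Rightarrow> real" where
  "jb \<xi> = sqrt (1 + (norm \<xi>)\<^sup>2)"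

definition sob_sq :: "real \<Rightarrow> ('a::euclidean_space \<Rightarrow> complex) \<Rightarrow> ennreal" where
  "sob_sq s g = (\<integral>\<^sup>+\<xi>. ennreal (jb \<xi> powr (2 * s) * (cmod (g \<xi>))\<^sup>2) \<partial>lborel)"

definition sob_norm :: "real \<Rightarrow> ('a::euclidean_space \<Rightarrow> complex) \<Rightarrow> real" where
  "sob_norm s g = sqrt (enn2real (sob_sq s g))"

definition in_sob :: "real \<Rightarrow> ('a::euclidean_space \<Rightarrow> complex) \<Rightarrow> bool" where
  "in_sob s g \<longleftrightarrow> g \<in> borel_measurable borel \<and> sob_sq s g < \<infinity>"

text \<open>H^s for s >= 0 (a subspace of L2).\<close>
definition in_Hs :: "real \<Rightarrow> ('a::euclidean_space \<Rightarrow> complex) \<Rightarrow> bool" where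
  "in_Hs s f \<longleftrightarrow> (\<exists>g. is_fourier_L2 f g \<and> in_sob s g)"

definition weak_Lp :: "real \<Rightarrow> ('a::euclidean_space \<Rightarrow> real) \<Rightarrow> bool" where
  "weak_Lp p f \<longleftrightarrow> f \<in> borel_measurable borel \<and>
     (\<exists>C. \<forall>lam>0. emeasure lborel {x. \<bar>f x\<bar> > lam} \<le> ennreal (C / lam powr p))"

definition L_inf :: "('a::euclidean_space \<Rightarrow> real) \<Rightarrow> bool" where
  "L_inf f \<longleftrightarrow> f \<in> borel_measurable borel \<and> (\<exists>C. AE x in lborel. \<bar>f x\<bar> \<le> C)"

definition sum_space :: "(('a \<Rightarrow> real) \<Rightarrow> bool) \<Rightarrow> (('a \<Rightarrow> real) \<Rightarrow> bool) \<Rightarrow> ('a \<Rightarrow> real) \<Rightarrow> bool" where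
  "sum_space P Q f \<longleftrightarrow> (\<exists>f1 f2. P f1 \<and> Q f2 \<and> f = (\<lambda>x. f1 x + f2 x))"

definition finite_borel_measure :: "'a::euclidean_space measure \<Rightarrow> bool" where
  "finite_borel_measure m \<longleftrightarrow> sets m = sets borel \<and> finite_measure m"

text \<open>A real potential w = (mp - mm) + w, where mp, mm are finite Borel measures
  (Jordan decomposition of a finite signed Radon measure) and w is a real function.
  Membership in the class W_{d,s}: for s <= d/2 the measure part vanishes.\<close>
definition W_class :: "real \<Rightarrow> 'a::euclidean_space measure \<Rightarrow> 'a measure \<Rightarrow> ('a \<Rightarrow> real) \<Rightarrow> bool" where
  "W_class s mp mm w \<longleftrightarrow> finite_borel_measure mp \<and> finite_borel_measure mm \<and>
     (if s < real DIM('a) / 2 then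
        mp = null_measure borel \<and> mm = null_measure borel \<and>
        (if s = 0 then L_inf w
         else sum_space (weak_Lp (real DIM('a) / (2 * s))) L_inf w)
      else if s = real DIM('a) / 2 then
        mp = null_measure borel \<and> mm = null_measure borel \<and>
        (\<exists>q>1. sum_space (weak_Lp q) L_inf w)
      else L_inf w)"

definition pot_conv :: "'a::euclidean_space measure \<Rightarrow> 'a measure \<Rightarrow> ('a \<Rightarrow> real) \<Rightarrow> ('a \<Rightarrow> real) \<Rightarrow> 'a \<Rightarrow> real" where
  "pot_conv mp mm w \<rho> x = (\<integral>y. w (x - y) * \<rho> y \<partial>lborel)
      + (\<integral>y. \<rho> (x - y) \<partial>mp) - (\<integral>y. \<rho> (x - y) \<partial>mm)"

definition hartree_nl :: "'a::euclidean_space measure \<Rightarrow> 'a measure \<Rightarrow> ('a \<Rightarrow> real) \<Rightarrow> ('a \<Rightarrow> complex) \<Rightarrow> 'a \<Rightarrow> complex" where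
  "hartree_nl mp mm w \<psi> x =
     complex_of_real (pot_conv mp mm w (\<lambda>y. (cmod (\<psi> y))\<^sup>2) x) * \<psi> x"

text \<open>psi is a maximal solution on [0,T) (T in (0,infinity]) of
  i d/dt psi = (<nabla> + w * |psi|^2) psi, psi(0) = psi0, in the class
  C^0([0,T),H^s) cap C^1([0,T),H^{s-1}), the equation holding in H^{s-1}.
  Psi t is the Fourier transform of psi t, Phi t that of the time derivative,
  N t that of the nonlinearity.\<close>
definition hartree_maximal_solution ::
  "real \<Rightarrow> 'a::euclidean_space measure \<Rightarrow> 'a measure \<Rightarrow> ('a \<Rightarrow> real) \<Rightarrow> ('a \<Rightarrow> complex)
     \<Rightarrow> ereal \<Rightarrow> (real \<Rightarrow> 'a \<Rightarrow> complex) \<Rightarrow> bool" where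
  "hartree_maximal_solution s mp mm w \<psi>0 T \<psi> \<longleftrightarrow> 0 < T \<and>
    (let I = {t::real. 0 \<le> t \<and> ereal t < T} in
     \<exists>\<Psi> \<Phi> N.
      (\<forall>t\<in>I. is_fourier_L2 (\<psi> t) (\<Psi> t) \<and> in_sob s (\<Psi> t) \<and> in_sob (s - 1) (\<Phi> t)
         \<and> ((\<lambda>\<tau>. sob_sq s (\<lambda>\<xi>. \<Psi> \<tau> \<xi> - \<Psi> t \<xi>)) \<longlongrightarrow> 0) (at t within I)
         \<and> ((\<lambda>\<tau>. sob_sq (s - 1) (\<lambda>\<xi>. (\<Psi> \<tau> \<xi> - \<Psi> t \<xi>) / complex_of_real (\<tau> - t) - \<Phi> t \<xi>))
              \<longlongrightarrow> 0) (at t within I)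
         \<and> ((\<lambda>\<tau>. sob_sq (s - 1) (\<lambda>\<xi>. \<Phi> \<tau> \<xi> - \<Phi> t \<xi>)) \<longlongrightarrow> 0) (at t within I)
         \<and> is_fourier_L2 (hartree_nl mp mm w (\<psi> t)) (N t)
         \<and> (AE \<xi> in lborel. \<i> * \<Phi> t \<xi> = complex_of_real (jb \<xi>) * \<Psi> t \<xi> + N t \<xi>))
      \<and> (AE x in lborel. \<psi> 0 x = \<psi>0 x)
      \<and> (T = \<infinity> \<or> filterlim (\<lambda>t. sob_norm s (\<Psi> t)) at_top (at_left (real_of_ereal T))))"

end

theory Submission
  imports Defs "HOL-Probability.Characteristic_Functions"
begin

text \<open>For a vector \<open>v\<close> with \<open>|v| < 1\<close>, conjugating \<open>\<langle>\<nabla>\<rangle>\<close> with the weight \<open>exp (v \<bullet> x)\<close> gives the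
  Fourier multiplier \<open>sqrt (1 - |v|\<^sup>2 + |\<xi>|\<^sup>2 + 2 i v \<bullet> \<xi>)\<close>, whose imaginary part is at most \<open>|v|\<close> in
  absolute value. Hence the free evolution over a time \<open>h\<close> increases the norm with this weight by at most
  \<open>exp (h |v|)\<close>. By a K-functional argument the same holds for the bounded weight
  \<open>1 / (exp (- 2 v \<bullet> x) + d)\<close> of the squared modulus. The potential is real and multiplication by it
  commutes with the weight, so to first order in \<open>h\<close> it does not contribute, provided the nonlinearity is
  locally bounded in \<open>L\<^sup>2\<close>. Integrating the resulting Dini inequality and choosing \<open>v = \<kappa> e\<close>, where the
  unit vector \<open>e\<close> separates \<open>X\<close> from \<open>Y\<close> by half-spaces at distance \<open>dist (X, Y)\<close>, the claim follows
  in the limit \<open>d \<rightarrow> 0\<close>, \<open>\<kappa> \<rightarrow> 1\<close>.\<close>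

subsection \<open>The space of square integrable functions\<close>

text \<open>The obstacle is low regularity. The time derivative of the solution exists only in
  H^(s-1), so for small \<open>s\<close> the weighted mass cannot be differentiated by pairing it
  with the weighted solution. Each short time step is therefore compared with the free evolution.
  The error is O(h) in L^2, because the nonlinearity is locally bounded, but its leading term -i h V
  \<psi> is identified only on bounded sets of frequencies. This suffices, since the function it is
  paired with, the weighted solution at the initial time of the step, has a small high-frequency
  tail. The weight must be bounded because the solution is not known to lie in an exponentially
  weighted space; the interpolation is exact and loses no constant, as the sharp rate demands. The
  effect of the conjugation is verified on Gaussians, where it amounts to completing the square. The
  class of multipliers that behave in this way is closed under products, power series and bounded
  limits, which leads from exp(-z/N) to the square root of N (1 - exp(-z/N)) and, as N tends to
  infinity, to the evolution.\<close>

definition L2_inner :: "('a::euclidean_space \<Rightarrow> complex) \<Rightarrow> ('a \<Rightarrow> complex) \<Rightarrow> complex" where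
  "L2_inner f g = (\<integral>x. cnj (f x) * g x \<partial>lborel)"

lemma sq_int_measurable: "sq_int f \<Longrightarrow> f \<in> borel_measurable borel"
  by (simp add: sq_int_def)

lemma L2_sq_lborel:
  "L2_sq f = (\<integral>\<^sup>+x. ennreal ((cmod (f x))\<^sup>2) \<partial>lborel)"
  unfolding L2_sq_def by (rule nn_integral_completion)

lemma sq_int_iff: "sq_int f \<longleftrightarrow> f \<in> borel_measurable borel \<and> L2_sq f < \<infinity>"
  unfolding sq_int_def L2_sq_lborel integrable_iff_bounded by auto

lemma L2_sq_eq_integral: "sq_int f \<Longrightarrow> L2_sq f = ennreal (\<integral>x. (cmod (f x))\<^sup>2 \<partial>lborel)"
  unfolding L2_sq_lborel sq_int_def by (intro nn_integral_eq_integral) auto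

lemma L2_norm_nonneg [simp]: "L2_norm f \<ge> 0"
  by (simp add: L2_norm_def)

lemma L2_norm_eq: "sq_int f \<Longrightarrow> L2_norm f = sqrt (\<integral>x. (cmod (f x))\<^sup>2 \<partial>lborel)"
  by (simp add: L2_norm_def L2_sq_eq_integral)

lemma L2_norm_sq: "sq_int f \<Longrightarrow> (L2_norm f)\<^sup>2 = (\<integral>x. (cmod (f x))\<^sup>2 \<partial>lborel)"
  by (simp add: L2_norm_eq)

lemma L2_sq_eq_norm: "sq_int f \<Longrightarrow> L2_sq f = ennreal ((L2_norm f)\<^sup>2)"
  by (simp add: L2_sq_eq_integral L2_norm_sq)

lemma L2_sq_cong_AE:
  assumes "AE x in lborel. cmod (f x) = cmod (g x)"
  shows "L2_sq f = L2_sq g"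
  unfolding L2_sq_lborel by (rule nn_integral_cong_AE) (use assms in auto)

lemma L2_norm_cong_AE:
  assumes "AE x in lborel. cmod (f x) = cmod (g x)"
  shows "L2_norm f = L2_norm g"
  unfolding L2_norm_def using L2_sq_cong_AE[OF assms] by simp

lemma L2_norm_cong: "(\<And>x. cmod (f x) = cmod (g x)) \<Longrightarrow> L2_norm f = L2_norm g"
  by (rule L2_norm_cong_AE) simp

lemma sq_int_dominated:
  assumes "sq_int g" "f \<in> borel_measurable borel" "AE x in lborel. cmod (f x) \<le> C * cmod (g x)"
  shows "sq_int f"
proof -
  have "integrable lborel (\<lambda>x. C\<^sup>2 * (cmod (g x))\<^sup>2)"
    using assms(1) by (auto simp: sq_int_def)
  then have "integrable lborel (\<lambda>x. (cmod (f x))\<^sup>2)"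
  proof (rule Bochner_Integration.integrable_bound)
    show "(\<lambda>x. (cmod (f x))\<^sup>2) \<in> borel_measurable lborel" using assms(2) by simp
    show "AE x in lborel. norm ((cmod (f x))\<^sup>2) \<le> norm (C\<^sup>2 * (cmod (g x))\<^sup>2)"
      using assms(3)
    proof eventually_elim
      case (elim x)
      then have "(cmod (f x))\<^sup>2 \<le> (C * cmod (g x))\<^sup>2" by (intro power_mono) auto
      then show ?case by (simp add: power_mult_distrib)
    qed
  qed
  with assms(2) show ?thesis by (simp add: sq_int_def)
qed

lemma L2_norm_dominated:
  assumes "sq_int g" "f \<in> borel_measurable borel" "C \<ge> 0"
    "AE x in lborel. cmod (f x) \<le> C * cmod (g x)"
  shows "L2_norm f \<le> C * L2_norm g"
proof -
  have f: "sq_int f" using sq_int_dominated[OF assms(1,2,4)] .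
  have "(L2_norm f)\<^sup>2 \<le> (\<integral>x. C\<^sup>2 * (cmod (g x))\<^sup>2 \<partial>lborel)"
    unfolding L2_norm_sq[OF f]
  proof (rule integral_mono_AE)
    show "AE x in lborel. (cmod (f x))\<^sup>2 \<le> C\<^sup>2 * (cmod (g x))\<^sup>2"
      using assms(4)
    proof eventually_elim
      case (elim x)
      then have "(cmod (f x))\<^sup>2 \<le> (C * cmod (g x))\<^sup>2" by (intro power_mono) auto
      then show ?case by (simp add: power_mult_distrib)
    qed
  qed (use f assms(1) in \<open>auto simp: sq_int_def\<close>)
  also have "\<dots> = (C * L2_norm g)\<^sup>2"
    by (simp add: L2_norm_sq[OF assms(1)] power_mult_distrib)
  finally show ?thesis by (rule power2_le_imp_le) (use assms(3) in simp)
qed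

lemma sq_int_mult_bounded:
  assumes f: "sq_int f" and m [measurable]: "m \<in> borel_measurable borel"
    and C: "\<And>x. cmod (m x) \<le> C"
  shows "sq_int (\<lambda>x. m x * f x)"
proof (rule sq_int_dominated[OF f, where C=C])
  have [measurable]: "f \<in> borel_measurable borel" by (rule sq_int_measurable[OF f])
  show "(\<lambda>x. m x * f x) \<in> borel_measurable borel" by measurable
  show "AE x in lborel. cmod (m x * f x) \<le> C * cmod (f x)"
    by (rule AE_I2) (simp add: norm_mult mult_right_mono C)
qed

lemma L2_norm_mult_bounded:
  assumes f: "sq_int f" and m [measurable]: "m \<in> borel_measurable borel"
    and C: "\<And>x. cmod (m x) \<le> C"
  shows "L2_norm (\<lambda>x. m x * f x) \<le> C * L2_norm f"
proof (rule L2_norm_dominated[OF f])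
  have [measurable]: "f \<in> borel_measurable borel" by (rule sq_int_measurable[OF f])
  show "(\<lambda>x. m x * f x) \<in> borel_measurable borel" by measurable
  show "AE x in lborel. cmod (m x * f x) \<le> C * cmod (f x)"
    by (rule AE_I2) (simp add: norm_mult mult_right_mono C)
  show "0 \<le> C" using C[of 0] norm_ge_zero order_trans by blast
qed

lemma sq_int_zero [simp]: "sq_int (\<lambda>x. 0)"
  by (simp add: sq_int_def)

lemma sq_int_scale: "sq_int f \<Longrightarrow> sq_int (\<lambda>x. c * f x)"
  by (rule sq_int_mult_bounded[where C="cmod c"]) auto

lemma L2_norm_scale:
  assumes "sq_int f" shows "L2_norm (\<lambda>x. c * f x) = cmod c * L2_norm f"
  by (simp add: L2_norm_eq[OF assms] L2_norm_eq[OF sq_int_scale[OF assms]] norm_mult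
      power_mult_distrib real_sqrt_mult)

lemma borel_measurable_cnj [measurable]:
  "f \<in> borel_measurable M \<Longrightarrow> (\<lambda>x. cnj (f x)) \<in> borel_measurable M"
  by (rule borel_measurable_continuous_on[OF continuous_on_cnj[OF continuous_on_id, unfolded id_def]])

lemma sq_int_cnj: "sq_int f \<Longrightarrow> sq_int (\<lambda>x. cnj (f x))"
  by (auto simp: sq_int_def)

lemma sq_int_uminus: "sq_int f \<Longrightarrow> sq_int (\<lambda>x. - f x)"
  using sq_int_scale[of f "-1"] by simp

lemma sq_int_cong_AE:
  assumes "sq_int f" "g \<in> borel_measurable borel" "AE x in lborel. g x = f x"
  shows "sq_int g"
  by (rule sq_int_dominated[OF assms(1,2), where C=1]) (use assms(3) in auto)

lemma integrable_mult_sq_int: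
  assumes f: "sq_int f" and g: "sq_int g"
  shows "integrable lborel (\<lambda>x. f x * g x)"
proof -
  have [measurable]: "f \<in> borel_measurable borel" "g \<in> borel_measurable borel"
    using f g by (auto simp: sq_int_def)
  have "integrable lborel (\<lambda>x. (cmod (f x))\<^sup>2 + (cmod (g x))\<^sup>2)"
    using f g by (auto simp: sq_int_def)
  then show ?thesis
  proof (rule Bochner_Integration.integrable_bound)
    show "AE x in lborel. norm (f x * g x) \<le> norm ((cmod (f x))\<^sup>2 + (cmod (g x))\<^sup>2)"
    proof (rule AE_I2)
      fix x
      have "2 * cmod (f x) * cmod (g x) \<le> (cmod (f x))\<^sup>2 + (cmod (g x))\<^sup>2"
        by (rule sum_squares_bound)
      moreover have "0 \<le> cmod (f x) * cmod (g x)" by simp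
      ultimately have "cmod (f x) * cmod (g x) \<le> (cmod (f x))\<^sup>2 + (cmod (g x))\<^sup>2" by linarith
      then show "norm (f x * g x) \<le> norm ((cmod (f x))\<^sup>2 + (cmod (g x))\<^sup>2)"
        by (simp add: norm_mult)
    qed
  qed simp
qed

lemma integrable_inner:
  "sq_int f \<Longrightarrow> sq_int g \<Longrightarrow> integrable lborel (\<lambda>x. cnj (f x) * g x)"
  by (rule integrable_mult_sq_int[OF sq_int_cnj])

lemma integral_norm_mult_le:
  assumes f: "sq_int f" and g: "sq_int g"
  shows "(\<integral>x. cmod (f x) * cmod (g x) \<partial>lborel) \<le> L2_norm f * L2_norm g"
proof -
  have [measurable]: "f \<in> borel_measurable borel" "g \<in> borel_measurable borel"
    using f g by (auto simp: sq_int_def)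
  let ?I = "\<integral>x. cmod (f x) * cmod (g x) \<partial>lborel"
  have I: "integrable lborel (\<lambda>x. cmod (f x) * cmod (g x))"
    using integrable_norm[OF integrable_mult_sq_int[OF f g]] by (simp add: norm_mult)
  have "(\<integral>\<^sup>+x. ennreal (cmod (f x)) * ennreal (cmod (g x)) \<partial>lborel)\<^sup>2
      \<le> (\<integral>\<^sup>+x. ennreal (cmod (f x)) ^ 2 \<partial>lborel) * (\<integral>\<^sup>+x. ennreal (cmod (g x)) ^ 2 \<partial>lborel)"
    by (rule Cauchy_Schwarz_nn_integral) auto
  also have "(\<integral>\<^sup>+x. ennreal (cmod (f x)) * ennreal (cmod (g x)) \<partial>lborel) = ennreal ?I"
    using nn_integral_eq_integral[OF I] by (simp add: ennreal_mult')
  also have "(\<integral>\<^sup>+x. ennreal (cmod (f x)) ^ 2 \<partial>lborel) = ennreal ((L2_norm f)\<^sup>2)"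
    using L2_sq_eq_norm[OF f] by (simp add: L2_sq_lborel ennreal_power)
  also have "(\<integral>\<^sup>+x. ennreal (cmod (g x)) ^ 2 \<partial>lborel) = ennreal ((L2_norm g)\<^sup>2)"
    using L2_sq_eq_norm[OF g] by (simp add: L2_sq_lborel ennreal_power)
  finally have "ennreal (?I\<^sup>2) \<le> ennreal ((L2_norm f * L2_norm g)\<^sup>2)"
    by (simp add: ennreal_power ennreal_mult' power_mult_distrib)
  then have "?I\<^sup>2 \<le> (L2_norm f * L2_norm g)\<^sup>2"
    by (subst (asm) ennreal_le_iff) auto
  then show ?thesis by (rule power2_le_imp_le) simp
qed

lemma L2_inner_le:
  assumes f: "sq_int f" and g: "sq_int g"
  shows "cmod (L2_inner f g) \<le> L2_norm f * L2_norm g"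
proof -
  have "cmod (L2_inner f g) \<le> (\<integral>x. cmod (cnj (f x) * g x) \<partial>lborel)"
    unfolding L2_inner_def by (rule integral_norm_bound)
  also have "\<dots> \<le> L2_norm f * L2_norm g"
    using integral_norm_mult_le[OF f g] by (simp add: norm_mult)
  finally show ?thesis .
qed

lemma L2_inner_self:
  assumes f: "sq_int f" shows "L2_inner f f = complex_of_real ((L2_norm f)\<^sup>2)"
  unfolding L2_inner_def L2_norm_sq[OF f] integral_complex_of_real[symmetric]
  by (rule Bochner_Integration.integral_cong) (auto simp: complex_norm_square mult.commute simp del: of_real_power)

lemma sq_int_add:
  assumes f: "sq_int f" and g: "sq_int g"
  shows "sq_int (\<lambda>x. f x + g x)"
proof -
  have [measurable]: "f \<in> borel_measurable borel" "g \<in> borel_measurable borel"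
    using f g by (auto simp: sq_int_def)
  have "integrable lborel (\<lambda>x. 2 * (cmod (f x))\<^sup>2 + 2 * (cmod (g x))\<^sup>2)"
    using f g by (auto simp: sq_int_def)
  then have "integrable lborel (\<lambda>x. (cmod (f x + g x))\<^sup>2)"
  proof (rule Bochner_Integration.integrable_bound)
    show "AE x in lborel. norm ((cmod (f x + g x))\<^sup>2) \<le> norm (2 * (cmod (f x))\<^sup>2 + 2 * (cmod (g x))\<^sup>2)"
    proof (rule AE_I2)
      fix x
      have "(cmod (f x + g x))\<^sup>2 \<le> (cmod (f x) + cmod (g x))\<^sup>2"
        by (intro power_mono norm_triangle_ineq) auto
      also have "\<dots> \<le> 2 * (cmod (f x))\<^sup>2 + 2 * (cmod (g x))\<^sup>2"
        using sum_squares_bound[of "cmod (f x)" "cmod (g x)"] by (simp add: power2_sum)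
      finally show "norm ((cmod (f x + g x))\<^sup>2) \<le> norm (2 * (cmod (f x))\<^sup>2 + 2 * (cmod (g x))\<^sup>2)"
        by simp
    qed
  qed simp
  then show ?thesis by (simp add: sq_int_def)
qed

lemma sq_int_diff: "sq_int f \<Longrightarrow> sq_int g \<Longrightarrow> sq_int (\<lambda>x. f x - g x)"
  using sq_int_add[OF _ sq_int_uminus, of f g] by simp

lemma L2_norm_add_sq:
  assumes f: "sq_int f" and g: "sq_int g"
  shows "(L2_norm (\<lambda>x. f x + g x))\<^sup>2 = (L2_norm f)\<^sup>2 + (L2_norm g)\<^sup>2 + 2 * Re (L2_inner f g)"
proof -
  have "(L2_norm (\<lambda>x. f x + g x))\<^sup>2
     = (\<integral>x. (cmod (f x))\<^sup>2 + (cmod (g x))\<^sup>2 + 2 * Re (cnj (f x) * g x) \<partial>lborel)"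
    unfolding L2_norm_sq[OF sq_int_add[OF f g]]
    by (rule Bochner_Integration.integral_cong)
      (simp_all add: cmod_power2 power2_sum algebra_simps)
  also have "\<dots> = (L2_norm f)\<^sup>2 + (L2_norm g)\<^sup>2 + 2 * Re (L2_inner f g)"
  proof -
    have I: "integrable lborel (\<lambda>x. (cmod (f x))\<^sup>2)" "integrable lborel (\<lambda>x. (cmod (g x))\<^sup>2)"
        "integrable lborel (\<lambda>x. 2 * Re (cnj (f x) * g x))"
      using f g integrable_inner[OF f g] by (auto simp: sq_int_def simp del: complex_cnj_mult times_complex.sel)
    have "(\<integral>x. 2 * Re (cnj (f x) * g x) \<partial>lborel) = 2 * Re (L2_inner f g)"
      unfolding L2_inner_def using integrable_inner[OF f g]
      by (subst integral_mult_right_zero, subst integral_Re) auto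
    then show ?thesis
      using Bochner_Integration.integral_add[OF Bochner_Integration.integrable_add[OF I(1,2)] I(3)]
        Bochner_Integration.integral_add[OF I(1,2)]
      by (simp only: L2_norm_sq[OF f] L2_norm_sq[OF g])
  qed
  finally show ?thesis .
qed

lemma L2_norm_triangle:
  assumes f: "sq_int f" and g: "sq_int g"
  shows "L2_norm (\<lambda>x. f x + g x) \<le> L2_norm f + L2_norm g"
proof (rule power2_le_imp_le)
  have "Re (L2_inner f g) \<le> L2_norm f * L2_norm g"
    using L2_inner_le[OF f g] complex_Re_le_cmod order_trans by blast
  then show "(L2_norm (\<lambda>x. f x + g x))\<^sup>2 \<le> (L2_norm f + L2_norm g)\<^sup>2"
    unfolding L2_norm_add_sq[OF f g] by (simp add: power2_sum)
qed simp

lemma L2_norm_minus_commute: "L2_norm (\<lambda>x. f x - g x) = L2_norm (\<lambda>x. g x - f x)"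
  by (rule L2_norm_cong) (rule norm_minus_commute)

lemma L2_norm_uminus: "L2_norm (\<lambda>x. - f x) = L2_norm f"
  by (rule L2_norm_cong) simp

lemma L2_norm_triangle_diff:
  assumes "sq_int f" "sq_int g"
  shows "L2_norm (\<lambda>x. f x - g x) \<le> L2_norm f + L2_norm g"
  using L2_norm_triangle[OF assms(1) sq_int_uminus[OF assms(2)]] by (simp add: L2_norm_uminus)

lemma L2_norm_triangle3:
  assumes "sq_int f" "sq_int g" "sq_int h"
  shows "L2_norm (\<lambda>x. f x - h x) \<le> L2_norm (\<lambda>x. f x - g x) + L2_norm (\<lambda>x. g x - h x)"
  using L2_norm_triangle[OF sq_int_diff[OF assms(1,2)] sq_int_diff[OF assms(2,3)]] by simp

lemma L2_norm_triangle2: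
  assumes "sq_int f" "sq_int g"
  shows "L2_norm f \<le> L2_norm (\<lambda>x. f x - g x) + L2_norm g"
  using L2_norm_triangle[OF sq_int_diff[OF assms] assms(2)] by simp

lemma L2_norm_diff_le:
  assumes "sq_int f" "sq_int g"
  shows "\<bar>L2_norm f - L2_norm g\<bar> \<le> L2_norm (\<lambda>x. f x - g x)"
  using L2_norm_triangle2[OF assms] L2_norm_triangle2[OF assms(2,1)]
  by (simp add: L2_norm_minus_commute[of g f])

lemma L2_norm_diff_sq:
  assumes f: "sq_int f" and g: "sq_int g"
  shows "(L2_norm (\<lambda>x. f x - g x))\<^sup>2 = (L2_norm f)\<^sup>2 + (L2_norm g)\<^sup>2 - 2 * Re (L2_inner f g)"
proof -
  have "L2_inner f (\<lambda>x. - g x) = - L2_inner f g" by (simp add: L2_inner_def)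
  then show ?thesis
    using L2_norm_add_sq[OF f sq_int_uminus[OF g]] by (simp add: L2_norm_uminus)
qed

lemma L2_norm_eq_0_AE:
  assumes "sq_int f" "L2_norm f = 0"
  shows "AE x in lborel. f x = 0"
proof -
  have "(\<integral>x. (cmod (f x))\<^sup>2 \<partial>lborel) = 0" using assms L2_norm_sq[of f] by simp
  then have "AE x in lborel. (cmod (f x))\<^sup>2 = 0"
    using assms(1) by (subst (asm) integral_nonneg_eq_0_iff_AE) (auto simp: sq_int_def)
  then show ?thesis by simp
qed

lemma L2_inner_diff_right:
  "sq_int f \<Longrightarrow> sq_int g \<Longrightarrow> sq_int h \<Longrightarrow> L2_inner f (\<lambda>x. g x - h x) = L2_inner f g - L2_inner f h"
  unfolding L2_inner_def using integrable_inner[of f g] integrable_inner[of f h]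
  by (simp add: right_diff_distrib)

lemma L2_inner_add_right:
  "sq_int f \<Longrightarrow> sq_int g \<Longrightarrow> sq_int h \<Longrightarrow> L2_inner f (\<lambda>x. g x + h x) = L2_inner f g + L2_inner f h"
  unfolding L2_inner_def using integrable_inner[of f g] integrable_inner[of f h]
  by (simp add: distrib_left)

lemma L2_inner_scale_right: "L2_inner f (\<lambda>x. c * g x) = c * L2_inner f g"
  unfolding L2_inner_def by (subst integral_mult_right_zero[symmetric]) (simp add: mult_ac)

lemma L2_inner_commute: "L2_inner g f = cnj (L2_inner f g)"
proof -
  have "cnj (L2_inner f g) = (\<integral>x. cnj (cnj (f x) * g x) \<partial>lborel)"
    unfolding L2_inner_def by (rule Bochner_Integration.integral_cnj[symmetric])
  then show ?thesis by (simp add: L2_inner_def mult.commute del: Bochner_Integration.integral_cnj)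
qed

lemma L2_inner_diff_left:
  assumes "sq_int f" "sq_int g" "sq_int h"
  shows "L2_inner (\<lambda>x. g x - h x) f = L2_inner g f - L2_inner h f"
  using L2_inner_diff_right[OF assms]
  by (simp add: L2_inner_commute[of _ f])

lemma L2_inner_tendsto:
  assumes "\<And>n. sq_int (f n)" "\<And>n. sq_int (g n)" "sq_int f0" "sq_int g0"
    "((\<lambda>n. L2_norm (\<lambda>x. f n x - f0 x)) \<longlongrightarrow> 0) F" "((\<lambda>n. L2_norm (\<lambda>x. g n x - g0 x)) \<longlongrightarrow> 0) F"
  shows "((\<lambda>n. L2_inner (f n) (g n)) \<longlongrightarrow> L2_inner f0 g0) F"
proof -
  define a where "a n = L2_norm (\<lambda>x. f n x - f0 x)" for n
  define b where "b n = L2_norm (\<lambda>x. g n x - g0 x)" for n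
  have "((\<lambda>n. a n * (b n + L2_norm g0) + L2_norm f0 * b n) \<longlongrightarrow> 0 * (0 + L2_norm g0) + L2_norm f0 * 0) F"
    using assms(5,6) unfolding a_def b_def by (intro tendsto_intros)
  then have lim: "((\<lambda>n. a n * (b n + L2_norm g0) + L2_norm f0 * b n) \<longlongrightarrow> 0) F" by simp
  have "norm (L2_inner (f n) (g n) - L2_inner f0 g0) \<le> a n * (b n + L2_norm g0) + L2_norm f0 * b n" for n
  proof -
    have "L2_inner (f n) (g n) - L2_inner f0 g0 = L2_inner (\<lambda>x. f n x - f0 x) (g n) + L2_inner f0 (\<lambda>x. g n x - g0 x)"
      using assms(1-4) by (simp add: L2_inner_diff_left L2_inner_diff_right)
    also have "norm \<dots> \<le> norm (L2_inner (\<lambda>x. f n x - f0 x) (g n)) + norm (L2_inner f0 (\<lambda>x. g n x - g0 x))"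
      by (rule norm_triangle_ineq)
    also have "\<dots> \<le> a n * L2_norm (g n) + L2_norm f0 * b n"
      unfolding a_def b_def using assms(1-4) by (intro add_mono L2_inner_le sq_int_diff)
    also have "\<dots> \<le> a n * (b n + L2_norm g0) + L2_norm f0 * b n"
      unfolding a_def b_def using L2_norm_triangle2[OF assms(2,4)] by (intro add_mono mult_left_mono) auto
    finally show ?thesis .
  qed
  then show ?thesis
    by (intro LIM_zero_cancel[of _ "L2_inner f0 g0"] Lim_null_comparison[OF _ lim] always_eventually allI)
qed

lemma L2_norm_tendsto:
  assumes "\<And>n. sq_int (f n)" "sq_int f0" "((\<lambda>n. L2_norm (\<lambda>x. f n x - f0 x)) \<longlongrightarrow> 0) F"
  shows "((\<lambda>n. L2_norm (f n)) \<longlongrightarrow> L2_norm f0) F"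
proof (rule LIM_zero_cancel, rule Lim_null_comparison[OF _ assms(3)])
  show "\<forall>\<^sub>F n in F. norm (L2_norm (f n) - L2_norm f0) \<le> L2_norm (\<lambda>x. f n x - f0 x)"
    using L2_norm_diff_le[OF assms(1,2)] by simp
qed

lemma L2_sq_tendsto_0_iff:
  assumes "eventually (\<lambda>n. sq_int (f n)) F"
  shows "((\<lambda>n. L2_sq (f n)) \<longlongrightarrow> 0) F \<longleftrightarrow> ((\<lambda>n. L2_norm (f n)) \<longlongrightarrow> 0) F"
proof
  assume "((\<lambda>n. L2_sq (f n)) \<longlongrightarrow> 0) F"
  then have "((\<lambda>n. sqrt (enn2real (L2_sq (f n)))) \<longlongrightarrow> sqrt (enn2real 0)) F"
    by (intro tendsto_real_sqrt tendsto_enn2real) auto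
  then show "((\<lambda>n. L2_norm (f n)) \<longlongrightarrow> 0) F" by (simp add: L2_norm_def)
next
  assume "((\<lambda>n. L2_norm (f n)) \<longlongrightarrow> 0) F"
  then have "((\<lambda>n. ennreal ((L2_norm (f n))\<^sup>2)) \<longlongrightarrow> ennreal (0\<^sup>2)) F"
    by (intro tendsto_ennrealI tendsto_power)
  then have "((\<lambda>n. ennreal ((L2_norm (f n))\<^sup>2)) \<longlongrightarrow> 0) F" by simp
  moreover have "\<forall>\<^sub>F n in F. ennreal ((L2_norm (f n))\<^sup>2) = L2_sq (f n)"
    using assms by eventually_elim (simp add: L2_sq_eq_norm)
  ultimately show "((\<lambda>n. L2_sq (f n)) \<longlongrightarrow> 0) F"
    by (rule Lim_transform_eventually)
qed

section \<open>Convergence theorems, completeness, and density of continuous functions in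
  L^2\<close>

lemma L2_dominated_convergence:
  fixes f :: "nat \<Rightarrow> 'a::euclidean_space \<Rightarrow> complex"
  assumes "\<And>n. f n \<in> borel_measurable borel" "f0 \<in> borel_measurable borel" "sq_int g"
    "\<And>n. AE x in lborel. cmod (f n x - f0 x) \<le> C * cmod (g x)"
    "AE x in lborel. (\<lambda>n. f n x) \<longlonglongrightarrow> f0 x"
  shows "(\<lambda>n. L2_norm (\<lambda>x. f n x - f0 x)) \<longlonglongrightarrow> 0"
proof -
  have [measurable]: "f n \<in> borel_measurable borel" "f0 \<in> borel_measurable borel" for n
    using assms(1,2) by auto
  have "(\<lambda>n. \<integral>x. (cmod (f n x - f0 x))\<^sup>2 \<partial>lborel) \<longlonglongrightarrow> (\<integral>x. 0 \<partial>(lborel::'a measure))"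
  proof (rule integral_dominated_convergence[where w="\<lambda>x. C\<^sup>2 * (cmod (g x))\<^sup>2"])
    show "integrable lborel (\<lambda>x. C\<^sup>2 * (cmod (g x))\<^sup>2)" using assms(3) by (auto simp: sq_int_def)
    show "AE x in lborel. (\<lambda>n. (cmod (f n x - f0 x))\<^sup>2) \<longlonglongrightarrow> 0"
      using assms(5)
    proof eventually_elim
      case (elim x)
      then have "(\<lambda>n. (cmod (f n x - f0 x))\<^sup>2) \<longlonglongrightarrow> (cmod (f0 x - f0 x))\<^sup>2"
        by (intro tendsto_intros)
      then show ?case by simp
    qed
    show "AE x in lborel. norm ((cmod (f n x - f0 x))\<^sup>2) \<le> C\<^sup>2 * (cmod (g x))\<^sup>2" for n
      using assms(4)[of n]
    proof eventually_elim
      case (elim x)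
      then have "(cmod (f n x - f0 x))\<^sup>2 \<le> (C * cmod (g x))\<^sup>2" by (intro power_mono) auto
      then show ?case by (simp add: power_mult_distrib)
    qed
  qed simp_all
  then have "(\<lambda>n. sqrt (\<integral>x. (cmod (f n x - f0 x))\<^sup>2 \<partial>lborel)) \<longlonglongrightarrow> sqrt 0"
    by (intro tendsto_real_sqrt) simp
  moreover have "sq_int (\<lambda>x. f n x - f0 x)" for n
    by (rule sq_int_dominated[OF assms(3) _ assms(4)]) simp
  ultimately show ?thesis by (simp add: L2_norm_eq)
qed

text \<open>Strong convergence of multiplication operators: bounded pointwise convergence of the
  symbols suffices. Truncations, phases and approximating Fourier multipliers all enter through this
  lemma.\<close>

lemma L2_mult_convergence:
  fixes m :: "nat \<Rightarrow> 'a::euclidean_space \<Rightarrow> complex"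
  assumes p: "sq_int p" and [measurable]: "\<And>n. m n \<in> borel_measurable borel" "m0 \<in> borel_measurable borel"
    and C: "\<And>n x. cmod (m n x) \<le> C" and lim: "\<And>x. (\<lambda>n. m n x) \<longlonglongrightarrow> m0 x"
  shows "(\<lambda>n. L2_norm (\<lambda>x. m n x * p x - m0 x * p x)) \<longlonglongrightarrow> 0"
proof (rule L2_dominated_convergence[OF _ _ p, where C="C + C"])
  have [measurable]: "p \<in> borel_measurable borel" by (rule sq_int_measurable[OF p])
  show "(\<lambda>x. m n x * p x) \<in> borel_measurable borel" for n by measurable
  show "(\<lambda>x. m0 x * p x) \<in> borel_measurable borel" by measurable
  have "cmod (m0 x) \<le> C" for x
    using tendsto_norm[OF lim[of x]] by (rule LIMSEQ_le_const2) (use C in auto)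
  then have "cmod (m n x - m0 x) \<le> C + C" for n x
    using norm_triangle_ineq4[of "m n x" "m0 x"] C[of n x] by (meson add_mono order_trans)
  then show "AE x in lborel. cmod (m n x * p x - m0 x * p x) \<le> (C + C) * cmod (p x)" for n
    by (intro AE_I2) (simp only: left_diff_distrib[symmetric] norm_mult mult_right_mono norm_ge_zero)
  show "AE x in lborel. (\<lambda>n. m n x * p x) \<longlonglongrightarrow> m0 x * p x"
    by (intro AE_I2 tendsto_intros lim)
qed

text \<open>The Riesz-Fischer argument: a rapidly converging subsequence converges almost
  everywhere, and Fatou's lemma turns the pointwise limit into a limit in norm.\<close>

lemma L2_complete:
  fixes f :: "nat \<Rightarrow> 'a::euclidean_space \<Rightarrow> complex"
  assumes f: "\<And>n. sq_int (f n)"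
    and cauchy: "\<And>e. e > 0 \<Longrightarrow> \<exists>N. \<forall>m\<ge>N. \<forall>n\<ge>N. L2_norm (\<lambda>x. f m x - f n x) < e"
  obtains g where "sq_int g" "(\<lambda>n. L2_norm (\<lambda>x. f n x - g x)) \<longlonglongrightarrow> 0"
proof -
  have [measurable]: "f n \<in> borel_measurable borel" for n using f sq_int_measurable by blast
  have "\<forall>k. \<exists>N. \<forall>m\<ge>N. \<forall>n\<ge>N. L2_norm (\<lambda>x. f m x - f n x) < (1/2)^k"
    using cauchy by simp
  then obtain N where N: "\<And>k m n. m \<ge> N k \<Longrightarrow> n \<ge> N k \<Longrightarrow> L2_norm (\<lambda>x. f m x - f n x) < (1/2)^k"
    by metis
  \<comment> \<open>Adding up the \<open>N i\<close> makes every index from \<open>M k\<close> on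
    admissible for stage \<open>k\<close>, and the summand \<open>k\<close> forces
    \<open>M k\<close> to tend to infinity.\<close>
  define M where "M k = (\<Sum>i\<le>k. N i) + k" for k
  have MN: "N k \<le> M k" for k unfolding M_def by (simp add: member_le_sum trans_le_add1)
  have Mk: "k \<le> M k" for k by (simp add: M_def)
  define D where "D k x = f (M (Suc k)) x - f (M k) x" for k x
  have [measurable]: "D k \<in> borel_measurable borel" for k unfolding D_def by measurable
  have sqD: "sq_int (D k)" for k unfolding D_def by (intro sq_int_diff f)
  have D: "L2_norm (D k) \<le> (1/2)^k" for k
  proof -
    have "N k \<le> M (Suc k)" using MN[of k] by (simp add: M_def)
    then show ?thesis unfolding D_def using N[OF _ MN[of k], of "M (Suc k)"] by simp
  qed
  \<comment> \<open>The factor \<open>2^k\<close> still leaves a convergent series, since the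
    squared norms decay like \<open>(1/4)^k\<close>. Finiteness of the sum at \<open>x\<close> then
    yields a geometric bound on \<open>D k x\<close>.\<close>
  have "(\<integral>\<^sup>+x. (\<Sum>k. ennreal (2^k * (cmod (D k x))\<^sup>2)) \<partial>lborel)
      = (\<Sum>k. \<integral>\<^sup>+x. ennreal (2^k * (cmod (D k x))\<^sup>2) \<partial>lborel)"
    by (rule nn_integral_suminf) simp
  also have "\<dots> \<le> (\<Sum>k. ennreal ((1/2)^k))"
  proof (rule suminf_le)
    fix k
    have "(\<integral>\<^sup>+x. ennreal (2^k * (cmod (D k x))\<^sup>2) \<partial>lborel) = ennreal (2^k) * L2_sq (D k)"
      unfolding L2_sq_lborel by (subst nn_integral_cmult[symmetric]) (simp_all add: ennreal_mult')
    also have "\<dots> = ennreal (2^k * (L2_norm (D k))\<^sup>2)"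
      by (simp add: L2_sq_eq_norm[OF sqD] ennreal_mult')
    also have "2^k * (L2_norm (D k))\<^sup>2 \<le> 2^k * ((1/2)^k)\<^sup>2"
      by (intro mult_left_mono power_mono D) auto
    also have "2^k * ((1/2)^k)\<^sup>2 = (1/2::real)^k"
      by (simp add: power2_eq_square power_divide)
    finally show "(\<integral>\<^sup>+x. ennreal (2^k * (cmod (D k x))\<^sup>2) \<partial>lborel) \<le> ennreal ((1/2)^k)"
      using ennreal_leI by auto
  qed auto
  also have "\<dots> = ennreal 2"
    using sums_unique[OF geometric_sums[of "1/2::real"]] by (subst suminf_ennreal2) (auto intro!: summable_geometric)
  finally have "(\<integral>\<^sup>+x. (\<Sum>k. ennreal (2^k * (cmod (D k x))\<^sup>2)) \<partial>lborel) < \<infinity>"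
    by (rule le_less_trans) simp
  then have fin: "(\<integral>\<^sup>+x. (\<Sum>k. ennreal (2^k * (cmod (D k x))\<^sup>2)) \<partial>lborel) \<noteq> \<infinity>"
    by simp
  have "AE x in lborel. (\<Sum>k. ennreal (2^k * (cmod (D k x))\<^sup>2)) \<noteq> \<infinity>"
  proof (rule nn_integral_noteq_infinite[OF _ fin])
    have "(\<lambda>x. ennreal (2^k * (cmod (D k x))\<^sup>2)) \<in> borel_measurable lborel" for k by simp
    then show "(\<lambda>x. \<Sum>k. ennreal (2^k * (cmod (D k x))\<^sup>2)) \<in> borel_measurable lborel"
      by (rule borel_measurable_suminf_order)
  qed
  then have conv: "AE x in lborel. convergent (\<lambda>k. f (M k) x)"
  proof eventually_elim
    case (elim x)
    have "summable (\<lambda>k. 2^k * (cmod (D k x))\<^sup>2)"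
      by (rule summable_suminf_not_top) (use elim in auto)
    then have "(\<lambda>k. 2^k * (cmod (D k x))\<^sup>2) \<longlonglongrightarrow> 0" by (rule summable_LIMSEQ_zero)
    then have "\<forall>\<^sub>F k in sequentially. 2^k * (cmod (D k x))\<^sup>2 < 1" by (rule order_tendstoD) simp
    then have "\<forall>\<^sub>F k in sequentially. norm (D k x) \<le> (1 / sqrt 2)^k"
    proof eventually_elim
      case (elim k)
      have "((1 / sqrt 2)^k)\<^sup>2 = ((1 / sqrt 2)\<^sup>2)^k"
        by (simp only: power_mult[symmetric] mult.commute)
      also have "\<dots> = (1/2::real)^k" by (simp add: power_divide)
      finally have eq: "((1 / sqrt 2)^k)\<^sup>2 = 1 / (2::real)^k" by (simp add: power_divide)
      have "(cmod (D k x))\<^sup>2 \<le> ((1 / sqrt 2)^k)\<^sup>2"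
        unfolding eq using elim by (simp add: field_simps)
      then show ?case by (rule power2_le_imp_le) simp
    qed
    moreover have "summable (\<lambda>k. (1 / sqrt 2)^k)" by (rule summable_geometric) simp
    ultimately have "summable (\<lambda>k. D k x)" by (rule summable_comparison_test_ev)
    then have "convergent (\<lambda>k. f (M 0) x + (\<Sum>i<k. D i x))"
      by (intro convergent_add convergent_const) (simp add: summable_iff_convergent)
    moreover have "f (M 0) x + (\<Sum>i<k. D i x) = f (M k) x" for k
      unfolding D_def by (subst sum_lessThan_telescope) simp
    ultimately show ?case by simp
  qed
  define g where "g x = lim (\<lambda>k. f (M k) x)" for x
  have [measurable]: "g \<in> borel_measurable borel"
    unfolding g_def by (rule borel_measurable_lim_metric) measurable
  \<comment> \<open>Fatou's lemma along the subsequence: the distance from \<open>f n\<close> to the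
    limit is controlled by the distances from \<open>f n\<close> to late members of the
    sequence.\<close>
  have bound: "L2_sq (\<lambda>x. f n x - g x) \<le> ennreal (e\<^sup>2)"
    if "e > 0" "\<And>m. m \<ge> K \<Longrightarrow> L2_norm (\<lambda>x. f n x - f m x) < e" for n K e
  proof -
    have "L2_sq (\<lambda>x. f n x - g x) = (\<integral>\<^sup>+x. liminf (\<lambda>k. ennreal ((cmod (f n x - f (M k) x))\<^sup>2)) \<partial>lborel)"
      unfolding L2_sq_lborel
    proof (rule nn_integral_cong_AE)
      show "AE x in lborel. ennreal ((cmod (f n x - g x))\<^sup>2) = liminf (\<lambda>k. ennreal ((cmod (f n x - f (M k) x))\<^sup>2))"
        using conv
      proof eventually_elim
        case (elim x)
        then have "(\<lambda>k. f (M k) x) \<longlonglongrightarrow> g x" by (simp add: g_def convergent_LIMSEQ_iff)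
        then have "(\<lambda>k. ennreal ((cmod (f n x - f (M k) x))\<^sup>2)) \<longlonglongrightarrow> ennreal ((cmod (f n x - g x))\<^sup>2)"
          by (intro tendsto_intros tendsto_ennrealI)
        then show ?case by (intro lim_imp_Liminf[symmetric]) simp_all
      qed
    qed
    also have "\<dots> \<le> liminf (\<lambda>k. \<integral>\<^sup>+x. ennreal ((cmod (f n x - f (M k) x))\<^sup>2) \<partial>lborel)"
      by (rule nn_integral_liminf) simp
    also have "\<dots> \<le> ennreal (e\<^sup>2)"
    proof (rule Liminf_le)
      show "\<forall>\<^sub>F k in sequentially. (\<integral>\<^sup>+x. ennreal ((cmod (f n x - f (M k) x))\<^sup>2) \<partial>lborel) \<le> ennreal (e\<^sup>2)"
        using eventually_ge_at_top[of K]
      proof eventually_elim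
        case (elim k)
        then have "L2_norm (\<lambda>x. f n x - f (M k) x) < e" using that(2) Mk[of k] by simp
        then have "(L2_norm (\<lambda>x. f n x - f (M k) x))\<^sup>2 \<le> e\<^sup>2" by (intro power_mono) auto
        then show ?case
          using L2_sq_eq_norm[OF sq_int_diff[OF f f], of n "M k"] by (simp add: L2_sq_lborel ennreal_leI)
      qed
    qed simp
    finally show ?thesis .
  qed
  have sqd: "\<exists>n0. \<forall>n\<ge>n0. sq_int (\<lambda>x. f n x - g x) \<and> L2_norm (\<lambda>x. f n x - g x) \<le> e" if e: "e > 0" for e
  proof -
    obtain K where K: "\<And>m n. m \<ge> K \<Longrightarrow> n \<ge> K \<Longrightarrow> L2_norm (\<lambda>x. f m x - f n x) < e"
      using cauchy[OF e] by blast
    have "sq_int (\<lambda>x. f n x - g x) \<and> L2_norm (\<lambda>x. f n x - g x) \<le> e" if n: "n \<ge> K" for n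
    proof -
      have b: "L2_sq (\<lambda>x. f n x - g x) \<le> ennreal (e\<^sup>2)" by (rule bound[OF e]) (use K n in auto)
      then have "L2_sq (\<lambda>x. f n x - g x) < \<infinity>" by (rule le_less_trans) simp
      then have sq: "sq_int (\<lambda>x. f n x - g x)" by (simp add: sq_int_iff)
      then have "(L2_norm (\<lambda>x. f n x - g x))\<^sup>2 \<le> e\<^sup>2"
        using b unfolding L2_sq_eq_norm[OF sq] by (subst (asm) ennreal_le_iff) auto
      then have "L2_norm (\<lambda>x. f n x - g x) \<le> e" by (rule power2_le_imp_le) (use e in simp)
      with sq show ?thesis by blast
    qed
    then show ?thesis by blast
  qed
  show thesis
  proof
    obtain n where "sq_int (\<lambda>x. f n x - g x)" using sqd[of 1] by auto
    then show "sq_int g" using sq_int_diff[OF f[of n], of "\<lambda>x. f n x - g x"] by simp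
    show "(\<lambda>n. L2_norm (\<lambda>x. f n x - g x)) \<longlonglongrightarrow> 0"
    proof (rule LIMSEQ_I)
      fix e :: real assume "e > 0"
      then obtain n0 where "\<forall>n\<ge>n0. L2_norm (\<lambda>x. f n x - g x) \<le> e / 2" using sqd[of "e/2"] by auto
      then have "\<forall>n\<ge>n0. norm (L2_norm (\<lambda>x. f n x - g x) - 0) < e"
        using \<open>e > 0\<close> by (auto intro: le_less_trans[of _ "e/2"])
      then show "\<exists>no. \<forall>n\<ge>no. norm (L2_norm (\<lambda>x. f n x - g x) - 0) < e" by blast
    qed
  qed
qed

lemma L2_norm_truncate_tendsto:
  fixes f :: "'a::euclidean_space \<Rightarrow> complex"
  assumes f: "sq_int f"
  shows "((\<lambda>R. L2_norm (\<lambda>x. indicator (ball 0 R) x * f x - f x)) \<longlongrightarrow> 0) at_top"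
proof (rule tendsto_at_topI_sequentially)
  fix X :: "nat \<Rightarrow> real" assume X: "filterlim X at_top sequentially"
  have "(\<lambda>n. L2_norm (\<lambda>x. indicator (ball 0 (X n)) x * f x - 1 * f x)) \<longlonglongrightarrow> 0"
  proof (rule L2_mult_convergence[OF f, where C=1])
    show "(\<lambda>n. indicator (ball 0 (X n)) x :: complex) \<longlonglongrightarrow> 1" for x :: 'a
    proof (rule tendsto_eventually)
      show "\<forall>\<^sub>F n in sequentially. (indicator (ball 0 (X n)) x :: complex) = 1"
        using filterlim_at_top_dense[THEN iffD1, OF X, rule_format, of "norm x"]
        by eventually_elim (simp add: indicator_def)
    qed
  qed (auto simp: indicator_def)
  then show "(\<lambda>n. L2_norm (\<lambda>x. indicator (ball 0 (X n)) x * f x - f x)) \<longlonglongrightarrow> 0" by simp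
qed

lemma sq_int_indicator_ball: "sq_int (\<lambda>x::'a::euclidean_space. indicator (ball 0 R) x)"
proof -
  have "(\<lambda>x::'a. (cmod (indicator (ball 0 R) x))\<^sup>2) = indicator (ball 0 R)"
    by (auto simp: indicator_def)
  moreover have "integrable lborel (indicator (ball 0 R) :: 'a \<Rightarrow> real)"
    using emeasure_bounded_finite[of "ball (0::'a) R"] by (intro integrable_real_indicator) auto
  moreover have "(indicator (ball 0 R) :: 'a \<Rightarrow> complex) \<in> borel_measurable borel" by (intro borel_measurable_indicator) auto
  ultimately show ?thesis unfolding sq_int_def by simp
qed

text \<open>Reduction to bounded functions of bounded support, which are limits almost everywhere of
  continuous functions. The latter are modified to share a bound and a support, so that dominated
  convergence applies.\<close>

lemma L2_dense_continuous:
  fixes f :: "'a::euclidean_space \<Rightarrow> complex"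
  assumes f: "sq_int f" and e: "e > 0"
  obtains g R where "continuous_on UNIV g" "\<And>x. norm x \<ge> R \<Longrightarrow> g x = 0"
    "sq_int g" "L2_norm (\<lambda>x. f x - g x) < e"
proof -
  have [measurable]: "f \<in> borel_measurable borel" using f by (rule sq_int_measurable)
  define m where "m n x = (if norm x < real n \<and> cmod (f x) \<le> real n then 1 else 0 :: complex)" for n x
  have [measurable]: "m n \<in> borel_measurable borel" for n unfolding m_def by measurable
  have "(\<lambda>n. L2_norm (\<lambda>x. m n x * f x - 1 * f x)) \<longlonglongrightarrow> 0"
  proof (rule L2_mult_convergence[OF f, where C=1])
    fix x :: 'a
    show "(\<lambda>n. m n x) \<longlonglongrightarrow> 1"
    proof (rule tendsto_eventually)
      show "\<forall>\<^sub>F n in sequentially. m n x = 1"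
        using eventually_gt_at_top[of "nat \<lceil>norm x\<rceil>"] eventually_gt_at_top[of "nat \<lceil>cmod (f x)\<rceil>"]
        by eventually_elim (auto simp: m_def, linarith+)
    qed
  qed (auto simp: m_def)
  then have "(\<lambda>n. L2_norm (\<lambda>x. m n x * f x - f x)) \<longlonglongrightarrow> 0" by simp
  then have "\<forall>\<^sub>F n in sequentially. L2_norm (\<lambda>x. m n x * f x - f x) < e/2"
    by (rule order_tendstoD) (use e in simp)
  then obtain n where n: "L2_norm (\<lambda>x. m n x * f x - f x) < e/2"
    by (auto simp: eventually_sequentially)
  define h where "h x = m n x * f x" for x
  have [measurable]: "h \<in> borel_measurable borel" unfolding h_def by measurable
  have sqh: "sq_int h" unfolding h_def by (rule sq_int_mult_bounded[OF f, where C=1]) (auto simp: m_def)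
  have hn: "cmod (h x) \<le> real n" for x by (auto simp: h_def m_def)
  have h0: "h x = 0" if "norm x \<ge> real n" for x using that by (auto simp: h_def m_def)
  have "h \<in> borel_measurable lebesgue" by (rule measurable_completion) simp
  then have "h measurable_on UNIV" by (rule lebesgue_measurable_imp_measurable_on) simp
  then obtain N g where N: "negligible N" and g: "\<And>k. continuous_on UNIV (g k)"
    and lim: "\<And>x. x \<notin> N \<Longrightarrow> (\<lambda>k. g k x) \<longlonglongrightarrow> h x"
    unfolding measurable_on_def by auto
  \<comment> \<open>The cutoff \<open>c\<close> is 1 on the ball of radius n and 0 outside radius n
    + 1; the retraction \<open>p\<close> onto the disc of radius n is continuous. Neither changes
    the limit \<open>h\<close>, which has support and values in the respective balls.\<close>
  define c where "c x = complex_of_real (max 0 (min 1 (real n + 1 - norm x)))" for x :: 'a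
  define p where "p = closest_point (cball (0::complex) (real n))"
  have pc: "continuous_on UNIV p" unfolding p_def by (intro continuous_on_closest_point) auto
  have pn: "cmod (p z) \<le> real n" for z
    using closest_point_in_set[of "cball (0::complex) (real n)" z] by (auto simp: p_def)
  have pid: "p z = z" if "cmod z \<le> real n" for z unfolding p_def by (rule closest_point_self) (use that in simp)
  define G where "G k x = c x * p (g k x)" for k x
  have cc: "continuous_on UNIV c" unfolding c_def by (intro continuous_intros)
  have Gc: "continuous_on UNIV (G k)" for k
    unfolding G_def using continuous_on_compose2[OF pc g[of k]] by (intro continuous_intros cc) auto
  have G0: "G k x = 0" if "norm x \<ge> real n + 1" for k x using that by (simp add: G_def c_def)
  define w where "w x = (indicator (ball 0 (real n + 1)) x :: complex)" for x :: 'a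
  have sqw: "sq_int w" unfolding w_def by (rule sq_int_indicator_ball)
  then have [measurable]: "w \<in> borel_measurable borel" by (rule sq_int_measurable)
  have cn: "cmod (c x) \<le> 1" for x by (simp add: c_def)
  have Gw: "cmod (G k x) \<le> real n * cmod (w x)" for k x
  proof (cases "norm x < real n + 1")
    case True
    then show ?thesis using mult_mono[OF cn[of x] pn[of "g k x"]] by (simp add: G_def w_def norm_mult)
  qed (simp add: G0)
  have hw: "cmod (h x) \<le> real n * cmod (w x)" for x
    using hn[of x] h0[of x] by (cases "norm x < real n + 1") (auto simp: w_def)
  have [measurable]: "G k \<in> borel_measurable borel" for k
    by (rule borel_measurable_continuous_onI[OF Gc])
  have "(\<lambda>k. L2_norm (\<lambda>x. G k x - h x)) \<longlonglongrightarrow> 0"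
  proof (rule L2_dominated_convergence[OF _ _ sqw, where C="real n + real n"])
    show "AE x in lborel. cmod (G k x - h x) \<le> (real n + real n) * cmod (w x)" for k
      using Gw hw norm_triangle_ineq4[of "G k _" "h _"]
      by (intro AE_I2) (smt (verit) distrib_right)
    have "AE x in lebesgue. x \<notin> N" using N by (simp add: negligible_iff_null_sets AE_not_in)
    then have "AE x in lebesgue. (\<lambda>k. G k x) \<longlonglongrightarrow> h x"
    proof eventually_elim
      case (elim x)
      have "(\<lambda>k. c x * p (g k x)) \<longlonglongrightarrow> c x * p (h x)"
        using pc lim[OF elim]
        by (intro tendsto_intros) (auto simp: continuous_on_eq_continuous_at intro: isCont_tendsto_compose)
      also have "c x * p (h x) = h x"
        using hn[of x] h0[of x] by (cases "norm x < real n") (auto simp: pid c_def)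
      finally show ?case by (simp add: G_def)
    qed
    then show "AE x in lborel. (\<lambda>k. G k x) \<longlonglongrightarrow> h x"
      by (simp add: AE_completion_iff)
  qed simp_all
  then have "\<forall>\<^sub>F k in sequentially. L2_norm (\<lambda>x. G k x - h x) < e/2"
    by (rule order_tendstoD) (use e in simp)
  then obtain k where k: "L2_norm (\<lambda>x. G k x - h x) < e/2"
    by (auto simp: eventually_sequentially)
  have sqG: "sq_int (G k)" by (rule sq_int_dominated[OF sqw _ AE_I2[OF Gw]]) simp
  show thesis
  proof
    show "L2_norm (\<lambda>x. f x - G k x) < e"
      using L2_norm_triangle3[OF f sqh sqG] n k L2_norm_minus_commute[of h f]
        L2_norm_minus_commute[of h "G k"] unfolding h_def by linarith
  qed (use Gc G0 sqG in auto)
qed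

section \<open>Affine substitutions and the Fourier transform of Gaussians\<close>

lemma nn_integral_lborel_affine:
  fixes f :: "'a::euclidean_space \<Rightarrow> ennreal"
  assumes [measurable]: "f \<in> borel_measurable borel" and c: "c \<noteq> 0"
  shows "(\<integral>\<^sup>+x. f x \<partial>lborel) = ennreal (\<bar>c\<bar> ^ DIM('a)) * (\<integral>\<^sup>+x. f (t + c *\<^sub>R x) \<partial>lborel)"
  by (subst lborel_affine[OF c, of t])
     (simp add: nn_integral_density nn_integral_distr nn_integral_cmult)

lemma integrable_lborel_affine:
  fixes f :: "'a::euclidean_space \<Rightarrow> 'b::{banach, second_countable_topology}"
  assumes f: "integrable lborel f" and c: "c \<noteq> 0"
  shows "integrable lborel (\<lambda>x. f (t + c *\<^sub>R x))"
proof -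
  have [measurable]: "f \<in> borel_measurable borel" using f by auto
  have "(\<integral>\<^sup>+x. ennreal (norm (f x)) \<partial>lborel) < \<infinity>" using f by (simp add: integrable_iff_bounded)
  then show ?thesis
    unfolding integrable_iff_bounded
    using c by (subst (asm) nn_integral_lborel_affine[OF _ c, of _ t]) (auto simp: ennreal_mult_less_top)
qed

lemma integrable_lborel_affine_iff:
  fixes f :: "'a::euclidean_space \<Rightarrow> 'b::{banach, second_countable_topology}"
  assumes c: "c \<noteq> 0"
  shows "integrable lborel (\<lambda>x. f (t + c *\<^sub>R x)) \<longleftrightarrow> integrable lborel f"
  using integrable_lborel_affine[OF _ c, of f t]
    integrable_lborel_affine[of "\<lambda>x. f (t + c *\<^sub>R x)" "1/c" "- (1/c) *\<^sub>R t"] c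
  by (auto simp: scaleR_add_right scaleR_diff_right)

lemma integral_lborel_affine:
  fixes f :: "'a::euclidean_space \<Rightarrow> 'b::{banach, second_countable_topology}"
  assumes c: "c \<noteq> 0"
  shows "(\<integral>x. f x \<partial>lborel) = (\<bar>c\<bar> ^ DIM('a)) *\<^sub>R (\<integral>x. f (t + c *\<^sub>R x) \<partial>lborel)"
proof (cases "integrable lborel f")
  case True
  then have [measurable]: "f \<in> borel_measurable borel" by auto
  show ?thesis
    by (subst lborel_affine[OF c, of t])
       (simp add: integral_density integral_distr)
next
  case False
  then show ?thesis
    using integrable_lborel_affine_iff[OF c, of f t] by (simp add: not_integrable_integral_eq)
qed

text \<open>By \<open>lborel_eq\<close>, Lebesgue measure is the image of a product of
  one-dimensional Lebesgue measures under the coordinate map, so product integrands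
  factorize.\<close>

lemma lborel_prod_integral:
  fixes f :: "'a::euclidean_space \<Rightarrow> real \<Rightarrow> complex"
  assumes f: "\<And>b. b \<in> Basis \<Longrightarrow> integrable lborel (f b)"
  shows "integrable lborel (\<lambda>x::'a. \<Prod>b\<in>Basis. f b (x \<bullet> b))" (is ?A)
    and "(\<integral>x. (\<Prod>b\<in>Basis. f b (x \<bullet> b)) \<partial>lborel) = (\<Prod>b\<in>Basis. \<integral>x. f b x \<partial>lborel)" (is ?B)
proof -
  interpret P: product_sigma_finite "\<lambda>b::'a. lborel :: real measure" ..
  have [measurable]: "f b \<in> borel_measurable borel" if "b \<in> Basis" for b using f[OF that] by auto
  have [measurable]: "(\<lambda>y. \<Sum>b\<in>Basis. y b *\<^sub>R b) \<in> (\<Pi>\<^sub>M b\<in>(Basis::'a set). (lborel::real measure)) \<rightarrow>\<^sub>M (borel :: 'a measure)"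
    by measurable
  have m: "(\<lambda>x::'a. \<Prod>b\<in>Basis. f b (x \<bullet> b)) \<in> borel_measurable borel" by measurable
  have eq: "(\<Prod>b\<in>Basis. f b ((\<Sum>b\<in>Basis. y b *\<^sub>R b) \<bullet> b)) = (\<Prod>b\<in>Basis. f b (y b))" for y :: "'a \<Rightarrow> real"
    by (intro prod.cong refl) (simp add: inner_sum_left_Basis)
  have "integrable (\<Pi>\<^sub>M b\<in>(Basis::'a set). (lborel::real measure)) (\<lambda>y. \<Prod>b\<in>Basis. f b (y b))"
    by (rule P.product_integrable_prod) (use f in auto)
  then show ?A
    unfolding lborel_eq[where 'a='a] using m by (subst integrable_distr_eq) (auto simp: eq)
  show ?B
    by (subst lborel_eq[where 'a='a], subst integral_distr[OF _ m])
      (auto simp: eq f intro!: P.product_integral_prod)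
qed

text \<open>This is the characteristic function of the standard normal distribution after a
  rescaling of the variable.\<close>

lemma gaussian_fourier_real:
  fixes u t :: real
  assumes t: "t > 0"
  shows "integrable lborel (\<lambda>y. exp (\<i> * complex_of_real (y * u)) * complex_of_real (exp (- t * y\<^sup>2)))" (is ?A)
    and "(\<integral>y. exp (\<i> * complex_of_real (y * u)) * complex_of_real (exp (- t * y\<^sup>2)) \<partial>lborel)
       = complex_of_real (sqrt (pi / t) * exp (- (u\<^sup>2) / (4 * t)))" (is ?B)
proof -
  \<comment> \<open>Chosen so that \<open>std_normal_density (s * y)\<close> is proportional to
    \<open>exp (- t * y\<^sup>2)\<close>.\<close>
  define s where "s = sqrt (2 * t)"
  have s: "s > 0" "s\<^sup>2 = 2 * t" using t by (auto simp: s_def)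
  have "complex_of_real (exp (- ((u/s)\<^sup>2) / 2)) = char std_normal_distribution (u/s)"
    by (simp add: char_std_normal_distribution)
  also have "\<dots> = (\<integral>x. std_normal_density x *\<^sub>R iexp ((u/s) * x) \<partial>lborel)"
    unfolding char_def by (subst integral_density) auto
  also have "\<dots> = \<bar>s\<bar> *\<^sub>R (\<integral>y. std_normal_density (0 + s * y) *\<^sub>R iexp ((u/s) * (0 + s * y)) \<partial>lborel)"
    by (rule lborel_integral_real_affine) (use s in simp)
  also have "(\<lambda>y. std_normal_density (0 + s * y) *\<^sub>R iexp ((u/s) * (0 + s * y)))
     = (\<lambda>y. complex_of_real (1 / sqrt (2 * pi)) * (exp (\<i> * complex_of_real (y * u)) * complex_of_real (exp (- t * y\<^sup>2))))"
    using s by (intro ext) (simp add: std_normal_density_def scaleR_conv_of_real power_mult_distrib mult_ac)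
  finally have eq: "complex_of_real (exp (- ((u/s)\<^sup>2) / 2)) = complex_of_real (s / sqrt (2 * pi)) *
     (\<integral>y. exp (\<i> * complex_of_real (y * u)) * complex_of_real (exp (- t * y\<^sup>2)) \<partial>lborel)"
    using s by (simp add: scaleR_conv_of_real)
  have s2: "s / sqrt (2 * pi) = 1 / sqrt (pi / t)"
    using t by (simp add: s_def real_sqrt_divide real_sqrt_mult)
  have "sqrt (pi / t) > 0" using t by simp
  then show ?B
    using arg_cong[OF eq, of "\<lambda>z. complex_of_real (sqrt (pi / t)) * z"] s t unfolding s2
    by (simp add: power_divide mult.assoc[symmetric] of_real_mult[symmetric] del: of_real_mult)
  have "integrable lborel (\<lambda>y. std_normal_density (0 + s * y))"
    using s by (intro lborel_integrable_real_affine integrable_normal_density) auto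
  then have "integrable lborel (\<lambda>y. sqrt (2 * pi) * std_normal_density (0 + s * y))" by simp
  then show ?A
    by (rule Bochner_Integration.integrable_bound)
      (use s in \<open>auto simp: norm_mult std_normal_density_def power_mult_distrib\<close>)
qed

text \<open>Both the phase and the Gaussian split into products over the coordinates, which reduces
  the integral to dimension one.\<close>

lemma gaussian_fourier:
  fixes x :: "'a::euclidean_space"
  assumes t: "t > 0"
  shows "integrable lborel (\<lambda>\<xi>::'a. exp (\<i> * complex_of_real (\<xi> \<bullet> x)) * complex_of_real (exp (- t * (norm \<xi>)\<^sup>2)))" (is ?A)
    and "(\<integral>\<xi>. exp (\<i> * complex_of_real (\<xi> \<bullet> x)) * complex_of_real (exp (- t * (norm \<xi>)\<^sup>2)) \<partial>lborel)
       = complex_of_real ((pi / t) powr (real DIM('a) / 2) * exp (- (norm x)\<^sup>2 / (4 * t)))" (is ?B)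
proof -
  have nrm: "(norm y)\<^sup>2 = (\<Sum>b\<in>Basis. (y \<bullet> b)\<^sup>2)" for y :: 'a
    unfolding power2_norm_eq_inner by (subst euclidean_inner) (simp add: power2_eq_square)
  have eq: "exp (\<i> * complex_of_real (\<xi> \<bullet> x)) * complex_of_real (exp (- t * (norm \<xi>)\<^sup>2))
    = (\<Prod>b\<in>Basis. exp (\<i> * complex_of_real ((\<xi> \<bullet> b) * (x \<bullet> b))) * complex_of_real (exp (- t * (\<xi> \<bullet> b)\<^sup>2)))" for \<xi> :: 'a
    unfolding nrm euclidean_inner[of \<xi> x]
    by (simp add: prod.distrib exp_sum sum_distrib_left flip: of_real_prod)
  note I = gaussian_fourier_real[OF t]
  show ?A unfolding eq by (rule lborel_prod_integral(1)) (rule I)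
  have "(\<integral>\<xi>. exp (\<i> * complex_of_real (\<xi> \<bullet> x)) * complex_of_real (exp (- t * (norm \<xi>)\<^sup>2)) \<partial>lborel)
    = (\<Prod>b\<in>Basis. complex_of_real (sqrt (pi / t) * exp (- ((x \<bullet> b)\<^sup>2) / (4 * t))))"
    unfolding eq by (subst lborel_prod_integral(2)) (simp_all only: I)
  also have "\<dots> = complex_of_real (sqrt (pi / t) ^ DIM('a) * exp (- (norm x)\<^sup>2 / (4 * t)))"
    unfolding of_real_prod[symmetric] prod.distrib nrm
    by (simp add: exp_sum[symmetric] sum_negf[symmetric] sum_divide_distrib)
  also have "sqrt (pi / t) ^ DIM('a) = (pi / t) powr (real DIM('a) / 2)"
    using t by (simp add: powr_half_sqrt[symmetric] powr_powr powr_realpow[symmetric])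
  finally show ?B .
qed

subsection \<open>Plancherel's theorem\<close>

lemma fourier_L1_measurable [measurable]:
  fixes f :: "'a::euclidean_space \<Rightarrow> complex"
  assumes [measurable]: "f \<in> borel_measurable borel"
  shows "fourier_L1 f \<in> borel_measurable borel"
proof -
  have "(\<lambda>\<xi>. \<integral>x. exp (- \<i> * complex_of_real (inner \<xi> x)) * f x \<partial>lborel) \<in> borel_measurable borel"
    by (rule lborel.borel_measurable_lebesgue_integral) measurable
  then show ?thesis unfolding fourier_L1_def[abs_def] by measurable
qed

lemma integrable_mult_unimodular:
  fixes f :: "'a::euclidean_space \<Rightarrow> complex"
  assumes f: "integrable lborel f" and e: "e \<in> borel_measurable borel" and C: "\<And>x. cmod (e x) \<le> C"
  shows "integrable lborel (\<lambda>x. e x * f x)"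
proof (rule Bochner_Integration.integrable_bound[OF integrable_mult_right[OF integrable_norm[OF f], of C]])
  have [measurable]: "f \<in> borel_measurable borel" "e \<in> borel_measurable borel" using f e by auto
  show "(\<lambda>x. e x * f x) \<in> borel_measurable lborel" by measurable
  have "0 \<le> C" using C[of 0] norm_ge_zero order_trans by blast
  then show "AE x in lborel. norm (e x * f x) \<le> norm (C * norm (f x))"
    by (intro AE_I2) (simp add: norm_mult C mult_right_mono)
qed

lemma fourier_L1_integrable:
  fixes f :: "'a::euclidean_space \<Rightarrow> complex"
  assumes f: "integrable lborel f"
  shows "integrable lborel (\<lambda>x. exp (- \<i> * complex_of_real (inner \<xi> x)) * f x)"
  by (rule integrable_mult_unimodular[OF f, where C=1]) auto

lemma fourier_L1_bound:
  fixes f :: "'a::euclidean_space \<Rightarrow> complex"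
  shows "cmod (fourier_L1 f \<xi>) \<le> (2 * pi) powr (- real DIM('a) / 2) * (\<integral>x. cmod (f x) \<partial>lborel)"
proof -
  have "cmod (\<integral>x. exp (- \<i> * complex_of_real (inner \<xi> x)) * f x \<partial>lborel)
     \<le> (\<integral>x. cmod (exp (- \<i> * complex_of_real (inner \<xi> x)) * f x) \<partial>lborel)"
    by (rule integral_norm_bound)
  then show ?thesis
    unfolding fourier_L1_def norm_mult by (intro mult_mono) auto
qed

lemma fourier_L1_diff:
  assumes "integrable lborel f" "integrable lborel g"
  shows "fourier_L1 (\<lambda>x. f x - g x) \<xi> = fourier_L1 f \<xi> - fourier_L1 g \<xi>"
  using fourier_L1_integrable[OF assms(1), of \<xi>] fourier_L1_integrable[OF assms(2), of \<xi>]
  by (simp add: fourier_L1_def right_diff_distrib)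

lemma fourier_L1_add:
  assumes "integrable lborel f" "integrable lborel g"
  shows "fourier_L1 (\<lambda>x. f x + g x) \<xi> = fourier_L1 f \<xi> + fourier_L1 g \<xi>"
  using fourier_L1_integrable[OF assms(1), of \<xi>] fourier_L1_integrable[OF assms(2), of \<xi>]
  by (simp add: fourier_L1_def distrib_left)

lemma fourier_L1_scale: "fourier_L1 (\<lambda>x. c * f x) \<xi> = c * fourier_L1 f \<xi>"
proof -
  have "(\<lambda>x. exp (- \<i> * complex_of_real (inner \<xi> x)) * (c * f x))
      = (\<lambda>x. c * (exp (- \<i> * complex_of_real (inner \<xi> x)) * f x))" by (simp add: mult_ac)
  then show ?thesis unfolding fourier_L1_def by (simp only: integral_mult_right_zero) (simp add: mult_ac)
qed

text \<open>Provides the hypothesis of Fubini's theorem for the multiplication formula, where the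
  kernel is the Fourier exponential.\<close>

lemma integrable_kernel_mult:
  fixes f :: "'a::euclidean_space \<Rightarrow> complex" and g :: "'b::euclidean_space \<Rightarrow> complex"
  assumes f: "integrable lborel f" and g: "integrable lborel g"
    and K [measurable]: "(\<lambda>(x, y). K x y) \<in> borel_measurable (borel \<Otimes>\<^sub>M borel)"
    and C: "\<And>x y. cmod (K x y) \<le> C"
  shows "integrable (lborel \<Otimes>\<^sub>M lborel) (\<lambda>(x, y). K x y * (f x * g y))"
proof (rule lborel_pair.Fubini_integrable)
  have [measurable]: "f \<in> borel_measurable borel" "g \<in> borel_measurable borel" using f g by auto
  have C0: "0 \<le> C" using C[of 0 0] norm_ge_zero order_trans by blast
  show meas [measurable]: "(\<lambda>(x, y). K x y * (f x * g y)) \<in> borel_measurable (lborel \<Otimes>\<^sub>M lborel)"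
    by measurable
  have int: "integrable lborel (\<lambda>y. K x y * (f x * g y))" for x
  proof -
    have "(\<lambda>y. K x y) \<in> borel_measurable borel" by measurable
    from integrable_mult_unimodular[OF integrable_mult_right[OF g, of "f x"] this C]
    show ?thesis by simp
  qed
  then show "AE x in lborel. integrable lborel (\<lambda>y. case (x, y) of (x, y) \<Rightarrow> K x y * (f x * g y))" by simp
  have "integrable lborel (\<lambda>x. C * (\<integral>y. cmod (g y) \<partial>lborel) * cmod (f x))" using f by simp
  then show "integrable lborel (\<lambda>x. \<integral>y. norm (case (x, y) of (x, y) \<Rightarrow> K x y * (f x * g y)) \<partial>lborel)"
  proof (rule Bochner_Integration.integrable_bound)
    show "(\<lambda>x. \<integral>y. norm (case (x, y) of (x, y) \<Rightarrow> K x y * (f x * g y)) \<partial>lborel) \<in> borel_measurable lborel"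
      by (rule lborel.borel_measurable_lebesgue_integral) simp
    have "(\<integral>y. norm (K x y * (f x * g y)) \<partial>lborel) \<le> C * (\<integral>y. cmod (g y) \<partial>lborel) * cmod (f x)" for x
    proof -
      have "(\<integral>y. norm (K x y * (f x * g y)) \<partial>lborel) \<le> (\<integral>y. (C * cmod (f x)) * cmod (g y) \<partial>lborel)"
      proof (rule integral_mono)
        show "integrable lborel (\<lambda>y. norm (K x y * (f x * g y)))" by (rule integrable_norm[OF int])
        show "integrable lborel (\<lambda>y. (C * cmod (f x)) * cmod (g y))" using g by simp
        show "norm (K x y * (f x * g y)) \<le> (C * cmod (f x)) * cmod (g y)" for y
          using C[of x y] by (simp add: norm_mult mult.assoc mult_right_mono)
      qed
      then show ?thesis by (simp add: mult_ac)
    qed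
    moreover have "0 \<le> (\<integral>y. norm (K x y * (f x * g y)) \<partial>lborel)" for x by simp
    moreover have "0 \<le> C * (\<integral>y. cmod (g y) \<partial>lborel) * cmod (f x)" for x using C0 by simp
    ultimately show "AE x in lborel. norm (\<integral>y. norm (case (x, y) of (x, y) \<Rightarrow> K x y * (f x * g y)) \<partial>lborel)
        \<le> norm (C * (\<integral>y. cmod (g y) \<partial>lborel) * cmod (f x))"
      by (intro AE_I2) simp
  qed
qed

text \<open>Fubini's theorem together with the symmetry of the kernel in its two variables. This
  duality is the source of Plancherel's theorem and of the inversion below.\<close>

lemma fourier_L1_mult_formula:
  fixes f g :: "'a::euclidean_space \<Rightarrow> complex"
  assumes f: "integrable lborel f" and g: "integrable lborel g"
  shows "(\<integral>\<xi>. fourier_L1 f \<xi> * g \<xi> \<partial>lborel) = (\<integral>x. f x * fourier_L1 g x \<partial>lborel)"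
proof -
  define K where "K \<xi> x = exp (- \<i> * complex_of_real (inner \<xi> x))" for \<xi> x :: 'a
  define c where "c = complex_of_real ((2 * pi) powr (- real DIM('a) / 2))"
  have K [measurable]: "(\<lambda>(x, y). K x y) \<in> borel_measurable (borel \<Otimes>\<^sub>M borel)" unfolding K_def by measurable
  have "integrable (lborel \<Otimes>\<^sub>M lborel) (\<lambda>(\<xi>, x). K \<xi> x * (g \<xi> * f x))"
    by (rule integrable_kernel_mult[OF g f K, of 1]) (simp add: K_def)
  from lborel_pair.Fubini_integral[OF this]
  have eq: "(\<integral>x. \<integral>\<xi>. K \<xi> x * (g \<xi> * f x) \<partial>lborel \<partial>lborel) = (\<integral>\<xi>. \<integral>x. K \<xi> x * (g \<xi> * f x) \<partial>lborel \<partial>lborel)"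
    by simp
  have "fourier_L1 f \<xi> * g \<xi> = c * (\<integral>x. K \<xi> x * (g \<xi> * f x) \<partial>lborel)" for \<xi>
  proof -
    have "(\<integral>x. K \<xi> x * (g \<xi> * f x) \<partial>lborel) = (\<integral>x. g \<xi> * (K \<xi> x * f x) \<partial>lborel)" by (simp add: mult_ac)
    then show ?thesis unfolding fourier_L1_def c_def K_def by (simp only: integral_mult_right_zero) (simp add: mult_ac)
  qed
  moreover have "f x * fourier_L1 g x = c * (\<integral>\<xi>. K \<xi> x * (g \<xi> * f x) \<partial>lborel)" for x
  proof -
    have "(\<integral>\<xi>. K \<xi> x * (g \<xi> * f x) \<partial>lborel) = (\<integral>\<xi>. f x * (K x \<xi> * g \<xi>) \<partial>lborel)"
      by (simp add: mult_ac K_def inner_commute)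
    then show ?thesis unfolding fourier_L1_def c_def K_def by (simp only: integral_mult_right_zero) (simp add: mult_ac)
  qed
  ultimately show ?thesis using eq by (simp only: integral_mult_right_zero)
qed

section \<open>Gaussian regularization by the heat kernel\<close>

lemma integrable_gaussian:
  "t > 0 \<Longrightarrow> integrable lborel (\<lambda>\<xi>::'a::euclidean_space. complex_of_real (exp (- t * (norm \<xi>)\<^sup>2)))"
  using gaussian_fourier(1)[of t "0::'a"] by simp

lemma fourier_L1_gaussian:
  fixes x y :: "'a::euclidean_space"
  assumes t: "t > 0"
  shows "fourier_L1 (\<lambda>\<xi>. exp (\<i> * complex_of_real (\<xi> \<bullet> x)) * complex_of_real (exp (- t * (norm \<xi>)\<^sup>2))) y
    = complex_of_real ((2 * t) powr (- real DIM('a) / 2) * exp (- (norm (x - y))\<^sup>2 / (4 * t)))"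
proof -
  have "exp (- \<i> * complex_of_real (inner y \<xi>)) * (exp (\<i> * complex_of_real (\<xi> \<bullet> x)) * complex_of_real (exp (- t * (norm \<xi>)\<^sup>2)))
    = exp (\<i> * complex_of_real (\<xi> \<bullet> (x - y))) * complex_of_real (exp (- t * (norm \<xi>)\<^sup>2))" for \<xi>
    by (simp add: mult.assoc[symmetric] exp_add[symmetric] inner_diff_right inner_commute algebra_simps)
  then have "fourier_L1 (\<lambda>\<xi>. exp (\<i> * complex_of_real (\<xi> \<bullet> x)) * complex_of_real (exp (- t * (norm \<xi>)\<^sup>2))) y
    = complex_of_real ((2 * pi) powr (- real DIM('a) / 2) * ((pi / t) powr (real DIM('a) / 2) * exp (- (norm (x - y))\<^sup>2 / (4 * t))))"
    unfolding fourier_L1_def by (simp only: gaussian_fourier(2)[OF t, of "x - y"] of_real_mult)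
  also have "(2 * pi) powr (- real DIM('a) / 2) * ((pi / t) powr (real DIM('a) / 2) * exp (- (norm (x - y))\<^sup>2 / (4 * t)))
     = (2 * t) powr (- real DIM('a) / 2) * exp (- (norm (x - y))\<^sup>2 / (4 * t))"
    using t by (simp add: powr_minus powr_mult powr_divide field_simps)
  finally show ?thesis .
qed

definition heat_kernel :: "real \<Rightarrow> 'a::euclidean_space \<Rightarrow> real" where
  "heat_kernel t z = (4 * pi * t) powr (- real DIM('a) / 2) * exp (- (norm z)\<^sup>2 / (4 * t))"

lemma heat_kernel_nonneg [simp]: "heat_kernel t z \<ge> 0"
  by (simp add: heat_kernel_def)

lemma heat_kernel_measurable [measurable]: "heat_kernel t \<in> borel_measurable borel"
  unfolding heat_kernel_def[abs_def] by measurable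

lemma heat_kernel_1:
  shows "integrable lborel (heat_kernel 1 :: 'a::euclidean_space \<Rightarrow> real)" (is ?A)
    and "(\<integral>z. heat_kernel 1 (z::'a) \<partial>lborel) = 1" (is ?B)
proof -
  have I: "integrable lborel (\<lambda>\<xi>::'a. complex_of_real (exp (- (1/4) * (norm \<xi>)\<^sup>2)))"
    by (rule integrable_gaussian) simp
  from integrable_Re[OF this] have I': "integrable lborel (\<lambda>\<xi>::'a. exp (- (norm \<xi>)\<^sup>2 / 4))" by simp
  then show ?A unfolding heat_kernel_def[abs_def] by simp
  have "complex_of_real (\<integral>\<xi>. exp (- (norm (\<xi>::'a))\<^sup>2 / 4) \<partial>lborel) = complex_of_real ((4 * pi) powr (real DIM('a) / 2))"
    using gaussian_fourier(2)[of "1/4" "0::'a"] by (simp flip: integral_complex_of_real add: mult.commute)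
  then have "(\<integral>\<xi>. exp (- (norm (\<xi>::'a))\<^sup>2 / 4) \<partial>lborel) = (4 * pi) powr (real DIM('a) / 2)"
    by (simp only: of_real_eq_iff)
  then show ?B unfolding heat_kernel_def[abs_def] by (simp add: powr_minus)
qed

lemma heat_kernel_scale:
  "t > 0 \<Longrightarrow> sqrt t ^ DIM('a) * heat_kernel t (sqrt t *\<^sub>R (u::'a::euclidean_space)) = heat_kernel 1 u"
  by (simp add: heat_kernel_def power_mult_distrib powr_mult powr_realpow[symmetric] powr_half_sqrt[symmetric]
      powr_powr powr_minus field_simps)

text \<open>The duality \<open>fourier_L1_mult_formula\<close> moves the transform from
  \<open>f\<close> to a modulated Gaussian, whose transform is explicit. The result is a regularized
  inversion formula.\<close>

lemma fourier_L1_heat: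
  fixes f :: "'a::euclidean_space \<Rightarrow> complex"
  assumes f: "integrable lborel f" and t: "t > 0"
  shows "complex_of_real ((2 * pi) powr (- real DIM('a) / 2)) *
      (\<integral>\<xi>. exp (\<i> * complex_of_real (\<xi> \<bullet> x)) * (complex_of_real (exp (- t * (norm \<xi>)\<^sup>2)) * fourier_L1 f \<xi>) \<partial>lborel)
    = (\<integral>y. complex_of_real (heat_kernel t (x - y)) * f y \<partial>lborel)"
proof -
  define c where "c = complex_of_real ((2 * pi) powr (- real DIM('a) / 2))"
  have "(\<integral>\<xi>. fourier_L1 f \<xi> * (exp (\<i> * complex_of_real (\<xi> \<bullet> x)) * complex_of_real (exp (- t * (norm \<xi>)\<^sup>2))) \<partial>lborel)
     = (\<integral>y. f y * fourier_L1 (\<lambda>\<xi>. exp (\<i> * complex_of_real (\<xi> \<bullet> x)) * complex_of_real (exp (- t * (norm \<xi>)\<^sup>2))) y \<partial>lborel)"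
    by (rule fourier_L1_mult_formula[OF f gaussian_fourier(1)[OF t]])
  also have "c * \<dots> = (\<integral>y. c * (f y * fourier_L1 (\<lambda>\<xi>. exp (\<i> * complex_of_real (\<xi> \<bullet> x)) * complex_of_real (exp (- t * (norm \<xi>)\<^sup>2))) y) \<partial>lborel)"
    by (rule integral_mult_right_zero[symmetric])
  also have "\<dots> = (\<integral>y. complex_of_real (heat_kernel t (x - y)) * f y \<partial>lborel)"
  proof (rule Bochner_Integration.integral_cong[OF refl])
    fix y
    have "(2 * pi) powr (- real DIM('a) / 2) * ((2 * t) powr (- real DIM('a) / 2) * exp (- (norm (x - y))\<^sup>2 / (4 * t)))
       = heat_kernel t (x - y)"
    proof -
      have "(2 * pi * (2 * t)) powr (- real DIM('a) / 2) = (2 * pi) powr (- real DIM('a) / 2) * (2 * t) powr (- real DIM('a) / 2)"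
        by (rule powr_mult)
      moreover have "2 * pi * (2 * t) = 4 * pi * t" by simp
      ultimately show ?thesis unfolding heat_kernel_def by (simp only: mult.assoc)
    qed
    note h = this
    show "c * (f y * fourier_L1 (\<lambda>\<xi>. exp (\<i> * complex_of_real (\<xi> \<bullet> x)) * complex_of_real (exp (- t * (norm \<xi>)\<^sup>2))) y)
        = complex_of_real (heat_kernel t (x - y)) * f y"
      unfolding fourier_L1_gaussian[OF t] c_def h[symmetric] by (simp only: of_real_mult mult_ac)
  qed
  finally show ?thesis unfolding c_def by (simp add: mult_ac)
qed

lemma sq_int_translate:
  fixes f :: "'a::euclidean_space \<Rightarrow> complex"
  assumes f: "sq_int f" shows "sq_int (\<lambda>x. f (x - a))" "L2_norm (\<lambda>x. f (x - a)) = L2_norm f"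
proof -
  have [measurable]: "f \<in> borel_measurable borel" using f by (rule sq_int_measurable)
  have I: "integrable lborel (\<lambda>x. (cmod (f x))\<^sup>2)" using f by (simp add: sq_int_def)
  show 1: "sq_int (\<lambda>x. f (x - a))"
    using integrable_lborel_affine[OF I, of 1 "-a"] by (simp add: sq_int_def)
  show "L2_norm (\<lambda>x. f (x - a)) = L2_norm f"
    unfolding L2_norm_eq[OF f] L2_norm_eq[OF 1]
    using integral_lborel_affine[of 1 "\<lambda>x. (cmod (f x))\<^sup>2" "-a"] by simp
qed

text \<open>For continuous functions of bounded support this is dominated convergence; translations
  are isometries, so it passes to the closure in L^2.\<close>

lemma L2_translate_tendsto:
  fixes f :: "'a::euclidean_space \<Rightarrow> complex" and a :: "nat \<Rightarrow> 'a"
  assumes f: "sq_int f" and a: "a \<longlonglongrightarrow> 0"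
  shows "(\<lambda>n. L2_norm (\<lambda>x. f (x - a n) - f x)) \<longlonglongrightarrow> 0"
proof (rule LIMSEQ_I)
  fix e :: real assume e: "e > 0"
  obtain g R where g: "continuous_on UNIV g" "\<And>x. norm x \<ge> R \<Longrightarrow> g x = 0" "sq_int g"
    "L2_norm (\<lambda>x. f x - g x) < e/3"
    using L2_dense_continuous[OF f, of "e/3"] e by auto
  obtain C where C: "\<And>x. cmod (g x) \<le> C"
  proof -
    have "compact (g ` cball 0 R)"
      by (intro compact_continuous_image continuous_on_subset[OF g(1)]) auto
    then obtain C where C: "\<And>x. x \<in> cball 0 R \<Longrightarrow> cmod (g x) \<le> C"
      by (meson bounded_iff compact_imp_bounded imageI)
    have "cmod (g x) \<le> max C 0" for x
      using C[of x] g(2)[of x] by (cases "norm x \<le> R") auto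
    then show thesis by (rule that)
  qed
  have C0: "0 \<le> C" using C[of 0] norm_ge_zero order_trans by blast
  define w where "w x = (indicator (ball 0 (R + 1)) x :: complex)" for x :: 'a
  have sqw: "sq_int w" unfolding w_def by (rule sq_int_indicator_ball)
  have [measurable]: "g \<in> borel_measurable borel" by (rule borel_measurable_continuous_onI[OF g(1)])
  \<comment> \<open>From index \<open>N\<close> on the shifts are shorter than 1, so all translates
    of \<open>g\<close> vanish outside the ball of radius R + 1, whose indicator dominates
    them.\<close>
  obtain N where N: "\<And>n. n \<ge> N \<Longrightarrow> norm (a n) < 1"
    using LIMSEQ_D[OF a, of 1] by auto
  have "(\<lambda>n. L2_norm (\<lambda>x. g (x - a (n + N)) - g x)) \<longlonglongrightarrow> 0"
  proof (rule L2_dominated_convergence[OF _ _ sqw, where C="C + C"])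
    show "(\<lambda>x. g (x - a (n + N))) \<in> borel_measurable borel" for n by measurable
    show "AE x in lborel. cmod (g (x - a (n + N)) - g x) \<le> (C + C) * cmod (w x)" for n
    proof (rule AE_I2)
      fix x
      show "cmod (g (x - a (n + N)) - g x) \<le> (C + C) * cmod (w x)"
      proof (cases "norm x < R + 1")
        case True
        then show ?thesis
          using norm_triangle_ineq4[of "g (x - a (n+N))" "g x"] C[of "x - a (n+N)"] C[of x] by (simp add: w_def)
      next
        case False
        then have "norm (x - a (n + N)) \<ge> R" "norm x \<ge> R"
          using N[of "n + N"] norm_triangle_ineq2[of x "a (n + N)"] by auto
        then show ?thesis using C0 by (simp add: g(2))
      qed
    qed
    show "AE x in lborel. (\<lambda>n. g (x - a (n + N))) \<longlonglongrightarrow> g x"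
    proof (rule AE_I2)
      fix x
      have "(\<lambda>n. x - a (n + N)) \<longlonglongrightarrow> x - 0"
        by (intro tendsto_intros LIMSEQ_ignore_initial_segment a)
      moreover have "isCont g x" using g(1) by (simp add: continuous_on_eq_continuous_at)
      ultimately show "(\<lambda>n. g (x - a (n + N))) \<longlonglongrightarrow> g x"
        using isCont_tendsto_compose by fastforce
    qed
  qed simp
  then have "(\<lambda>n. L2_norm (\<lambda>x. g (x - a n) - g x)) \<longlonglongrightarrow> 0" by (rule LIMSEQ_offset)
  then obtain M where M: "\<And>n. n \<ge> M \<Longrightarrow> L2_norm (\<lambda>x. g (x - a n) - g x) < e/3"
    using LIMSEQ_D[of _ 0 "e/3"] e by force
  have "norm (L2_norm (\<lambda>x. f (x - a n) - f x) - 0) < e" if n: "n \<ge> M" for n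
  proof -
    have "L2_norm (\<lambda>x. f (x - a n) - f x) \<le> L2_norm (\<lambda>x. f (x - a n) - g (x - a n)) + L2_norm (\<lambda>x. g (x - a n) - f x)"
      by (rule L2_norm_triangle3) (intro sq_int_translate f g)+
    also have "L2_norm (\<lambda>x. g (x - a n) - f x) \<le> L2_norm (\<lambda>x. g (x - a n) - g x) + L2_norm (\<lambda>x. g x - f x)"
      by (rule L2_norm_triangle3) (intro sq_int_translate f g)+
    also have "L2_norm (\<lambda>x. f (x - a n) - g (x - a n)) = L2_norm (\<lambda>x. f x - g x)"
      using sq_int_translate(2)[OF sq_int_diff[OF f g(3)], of "a n"] .
    also have "L2_norm (\<lambda>x. g x - f x) = L2_norm (\<lambda>x. f x - g x)"
      by (rule L2_norm_minus_commute)
    finally show ?thesis using M[OF n] g(4) by simp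
  qed
  then show "\<exists>no. \<forall>n\<ge>no. norm (L2_norm (\<lambda>x. f (x - a n) - f x) - 0) < e" by blast
qed

text \<open>The substitution \<open>y = x - sqrt t *\<^sub>R u\<close> fixes the kernel and puts all
  dependence on \<open>t\<close> into a translation of \<open>f\<close>, which is continuous in L^2
  as \<open>t\<close> tends to 0.\<close>

lemma heat_convolution:
  fixes f :: "'a::euclidean_space \<Rightarrow> complex"
  assumes t: "t > 0"
  shows "(\<integral>y. complex_of_real (heat_kernel t (x - y)) * f y \<partial>lborel)
     = (\<integral>u. complex_of_real (heat_kernel 1 u) * f (x - sqrt t *\<^sub>R u) \<partial>lborel)"
proof -
  have "(\<integral>y. complex_of_real (heat_kernel t (x - y)) * f y \<partial>lborel)
     = (sqrt t ^ DIM('a)) *\<^sub>R (\<integral>u. complex_of_real (heat_kernel t (sqrt t *\<^sub>R u)) * f (x - sqrt t *\<^sub>R u) \<partial>lborel)"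
    using integral_lborel_affine[of "- sqrt t" "\<lambda>y. complex_of_real (heat_kernel t (x - y)) * f y" x] t by simp
  also have "\<dots> = (\<integral>u. (sqrt t ^ DIM('a)) *\<^sub>R (complex_of_real (heat_kernel t (sqrt t *\<^sub>R u)) * f (x - sqrt t *\<^sub>R u)) \<partial>lborel)"
    by (rule integral_scaleR_right[symmetric])
  also have "\<dots> = (\<integral>u. complex_of_real (heat_kernel 1 u) * f (x - sqrt t *\<^sub>R u) \<partial>lborel)"
    by (rule Bochner_Integration.integral_cong[OF refl])
       (simp add: scaleR_conv_of_real mult.assoc[symmetric] heat_kernel_scale[OF t, symmetric])
  finally show ?thesis .
qed

lemma fourier_L1_gaussian_weight:
  fixes f :: "'a::euclidean_space \<Rightarrow> complex"
  assumes f: "integrable lborel f" and t: "t > 0"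
  shows "integrable lborel (\<lambda>\<xi>. complex_of_real (exp (- t * (norm \<xi>)\<^sup>2)) * fourier_L1 f \<xi>)"
    and "sq_int (\<lambda>\<xi>. complex_of_real (exp (- t * (norm \<xi>)\<^sup>2)) * fourier_L1 f \<xi>)"
proof -
  define C where "C = (2 * pi) powr (- real DIM('a) / 2) * (\<integral>x. cmod (f x) \<partial>lborel)"
  have [measurable]: "f \<in> borel_measurable borel" using f by auto
  have C: "cmod (fourier_L1 f \<xi>) \<le> C" for \<xi> unfolding C_def by (rule fourier_L1_bound)
  have "integrable lborel (\<lambda>\<xi>. fourier_L1 f \<xi> * complex_of_real (exp (- t * (norm \<xi>)\<^sup>2)))"
    by (rule integrable_mult_unimodular[OF integrable_gaussian[OF t] _ C]) measurable
  then show "integrable lborel (\<lambda>\<xi>. complex_of_real (exp (- t * (norm \<xi>)\<^sup>2)) * fourier_L1 f \<xi>)"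
    by (simp add: mult.commute)
  have "sq_int (\<lambda>\<xi>::'a. complex_of_real (exp (- t * (norm \<xi>)\<^sup>2)))"
  proof -
    have "integrable lborel (\<lambda>\<xi>::'a. complex_of_real (exp (- (2*t) * (norm \<xi>)\<^sup>2)))"
      by (rule integrable_gaussian) (use t in simp)
    from integrable_Re[OF this] have "integrable lborel (\<lambda>\<xi>::'a. exp (- (2*t) * (norm \<xi>)\<^sup>2))" by simp
    moreover have "exp (- (2*t) * (norm \<xi>)\<^sup>2) = (exp (- t * (norm \<xi>)\<^sup>2))\<^sup>2" for \<xi> :: 'a
      by (simp add: power2_eq_square exp_add[symmetric])
    ultimately show ?thesis by (simp add: sq_int_def)
  qed
  from sq_int_mult_bounded[OF this _ C]
  have "sq_int (\<lambda>\<xi>. fourier_L1 f \<xi> * complex_of_real (exp (- t * (norm \<xi>)\<^sup>2)))" by measurable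
  then show "sq_int (\<lambda>\<xi>. complex_of_real (exp (- t * (norm \<xi>)\<^sup>2)) * fourier_L1 f \<xi>)"
    by (simp add: mult.commute)
qed

text \<open>With \<open>g\<close> the conjugate of the damped transform, duality turns the damped
  norm of the transform into a pairing of \<open>f\<close> with its own heat regularization, that
  is, into an average of autocorrelations of \<open>f\<close>.\<close>

lemma plancherel_regularized:
  fixes f :: "'a::euclidean_space \<Rightarrow> complex"
  assumes f: "integrable lborel f" and f2: "sq_int f" and t: "t > 0"
  shows "integrable lborel (\<lambda>\<xi>. exp (- t * (norm \<xi>)\<^sup>2) * (cmod (fourier_L1 f \<xi>))\<^sup>2)"
    and "complex_of_real (\<integral>\<xi>. exp (- t * (norm \<xi>)\<^sup>2) * (cmod (fourier_L1 f \<xi>))\<^sup>2 \<partial>lborel)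
      = (\<integral>u. complex_of_real (heat_kernel 1 u) * L2_inner (\<lambda>x. f (x - sqrt t *\<^sub>R u)) f \<partial>lborel)"
proof -
  define c where "c = complex_of_real ((2 * pi) powr (- real DIM('a) / 2))"
  define g where "g \<xi> = complex_of_real (exp (- t * (norm \<xi>)\<^sup>2)) * cnj (fourier_L1 f \<xi>)" for \<xi> :: 'a
  have [measurable]: "f \<in> borel_measurable borel" using f by auto
  have gc: "g = (\<lambda>\<xi>. cnj (complex_of_real (exp (- t * (norm \<xi>)\<^sup>2)) * fourier_L1 f \<xi>))" by (simp add: g_def fun_eq_iff)
  have g: "integrable lborel g"
    unfolding gc by (rule integrable_cnj[OF fourier_L1_gaussian_weight(1)[OF f t]])
  have Fg: "fourier_L1 g x = cnj (\<integral>u. complex_of_real (heat_kernel 1 u) * f (x - sqrt t *\<^sub>R u) \<partial>lborel)" for x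
  proof -
    have "cnj (fourier_L1 g x) = c * (\<integral>\<xi>. exp (\<i> * complex_of_real (\<xi> \<bullet> x)) * (complex_of_real (exp (- t * (norm \<xi>)\<^sup>2)) * fourier_L1 f \<xi>) \<partial>lborel)"
    proof -
      have e: "cnj (exp (- \<i> * complex_of_real (x \<bullet> \<xi>)) * g \<xi>)
          = exp (\<i> * complex_of_real (\<xi> \<bullet> x)) * (complex_of_real (exp (- t * (norm \<xi>)\<^sup>2)) * fourier_L1 f \<xi>)" for \<xi>
        by (simp add: g_def exp_cnj inner_commute)
      have "cnj (\<integral>\<xi>. exp (- \<i> * complex_of_real (x \<bullet> \<xi>)) * g \<xi> \<partial>lborel)
          = (\<integral>\<xi>. cnj (exp (- \<i> * complex_of_real (x \<bullet> \<xi>)) * g \<xi>) \<partial>lborel)"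
        by (rule Bochner_Integration.integral_cnj[symmetric])
      then show ?thesis
        unfolding fourier_L1_def[of g] c_def complex_cnj_mult[of "complex_of_real _"] complex_cnj_complex_of_real e
        by (rule arg_cong)
    qed
    also have "\<dots> = (\<integral>u. complex_of_real (heat_kernel 1 u) * f (x - sqrt t *\<^sub>R u) \<partial>lborel)"
      unfolding c_def fourier_L1_heat[OF f t] heat_convolution[OF t] ..
    finally show ?thesis by (metis complex_cnj_cnj)
  qed
  have eq: "fourier_L1 f \<xi> * g \<xi> = complex_of_real (exp (- t * (norm \<xi>)\<^sup>2) * (cmod (fourier_L1 f \<xi>))\<^sup>2)" for \<xi>
    by (simp add: g_def complex_norm_square del: of_real_power)
  define C where "C = (2 * pi) powr (- real DIM('a) / 2) * (\<integral>x. cmod (f x) \<partial>lborel)"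
  have C: "cmod (fourier_L1 f \<xi>) \<le> C" for \<xi> unfolding C_def by (rule fourier_L1_bound)
  have "integrable lborel (\<lambda>\<xi>. fourier_L1 f \<xi> * g \<xi>)"
    by (rule integrable_mult_unimodular[OF g _ C]) measurable
  then have "integrable lborel (\<lambda>\<xi>. Re (fourier_L1 f \<xi> * g \<xi>))" by (rule integrable_Re)
  then show "integrable lborel (\<lambda>\<xi>. exp (- t * (norm \<xi>)\<^sup>2) * (cmod (fourier_L1 f \<xi>))\<^sup>2)"
    unfolding eq Re_complex_of_real .
  define H where "H u x = complex_of_real (heat_kernel 1 u) * (cnj (f (x - sqrt t *\<^sub>R u)) * f x)" for u x
  have Hm [measurable]: "case_prod H \<in> borel_measurable (borel \<Otimes>\<^sub>M borel)" unfolding H_def by measurable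
  have Hint: "integrable lborel (H u)" for u
    unfolding H_def by (intro integrable_mult_right integrable_inner sq_int_translate f2)
  have "integrable (lborel \<Otimes>\<^sub>M lborel) (case_prod H)"
  proof (rule lborel_pair.Fubini_integrable)
    show "case_prod H \<in> borel_measurable (lborel \<Otimes>\<^sub>M lborel)" by measurable
    show "AE x in lborel. integrable lborel (\<lambda>y. case (x, y) of (u, x) \<Rightarrow> H u x)" using Hint by simp
    have "integrable lborel (\<lambda>u::'a. heat_kernel 1 u * (L2_norm f)\<^sup>2)" by (intro integrable_mult_left heat_kernel_1)
    then show "integrable lborel (\<lambda>x. \<integral>y. norm (case (x, y) of (u, x) \<Rightarrow> H u x) \<partial>lborel)"
    proof (rule Bochner_Integration.integrable_bound)
      show "(\<lambda>x. \<integral>y. norm (case (x, y) of (u, x) \<Rightarrow> H u x) \<partial>lborel) \<in> borel_measurable lborel"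
        by (rule lborel.borel_measurable_lebesgue_integral) simp
      have "norm (\<integral>y. norm (H u y) \<partial>lborel) \<le> norm (heat_kernel 1 u * (L2_norm f)\<^sup>2)" for u
      proof -
        have "(\<integral>y. norm (H u y) \<partial>lborel) = heat_kernel 1 u * (\<integral>y. cmod (f (y - sqrt t *\<^sub>R u)) * cmod (f y) \<partial>lborel)"
          by (simp add: H_def norm_mult)
        also have "\<dots> \<le> heat_kernel 1 u * (L2_norm (\<lambda>y. f (y - sqrt t *\<^sub>R u)) * L2_norm f)"
          by (intro mult_left_mono integral_norm_mult_le sq_int_translate f2) simp
        also have "\<dots> = heat_kernel 1 u * (L2_norm f)\<^sup>2" by (simp add: sq_int_translate(2)[OF f2] power2_eq_square)
        finally show ?thesis by simp
      qed
      then show "AE x in lborel. norm (\<integral>y. norm (case (x, y) of (u, x) \<Rightarrow> H u x) \<partial>lborel) \<le> norm (heat_kernel 1 x * (L2_norm f)\<^sup>2)"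
        by simp
    qed
  qed
  from lborel_pair.Fubini_integral[OF this]
  have Fub: "(\<integral>x. \<integral>u. H u x \<partial>lborel \<partial>lborel) = (\<integral>u. \<integral>x. H u x \<partial>lborel \<partial>lborel)" .
  have "complex_of_real (\<integral>\<xi>. exp (- t * (norm \<xi>)\<^sup>2) * (cmod (fourier_L1 f \<xi>))\<^sup>2 \<partial>lborel)
     = (\<integral>\<xi>. fourier_L1 f \<xi> * g \<xi> \<partial>lborel)" unfolding eq by (rule integral_complex_of_real[symmetric])
  also have "\<dots> = (\<integral>x. f x * fourier_L1 g x \<partial>lborel)" by (rule fourier_L1_mult_formula[OF f g])
  also have "\<dots> = (\<integral>x. \<integral>u. H u x \<partial>lborel \<partial>lborel)"
  proof (rule Bochner_Integration.integral_cong[OF refl])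
    fix x
    have "f x * fourier_L1 g x = f x * (\<integral>u. complex_of_real (heat_kernel 1 u) * cnj (f (x - sqrt t *\<^sub>R u)) \<partial>lborel)"
      unfolding Fg Bochner_Integration.integral_cnj[symmetric] by simp
    also have "\<dots> = (\<integral>u. f x * (complex_of_real (heat_kernel 1 u) * cnj (f (x - sqrt t *\<^sub>R u))) \<partial>lborel)"
      by (rule integral_mult_right_zero[symmetric])
    finally show "f x * fourier_L1 g x = (\<integral>u. H u x \<partial>lborel)" by (simp add: H_def mult_ac)
  qed
  also have "\<dots> = (\<integral>u. complex_of_real (heat_kernel 1 u) * L2_inner (\<lambda>x. f (x - sqrt t *\<^sub>R u)) f \<partial>lborel)"
    unfolding Fub unfolding H_def L2_inner_def by (simp only: integral_mult_right_zero)
  finally show "complex_of_real (\<integral>\<xi>. exp (- t * (norm \<xi>)\<^sup>2) * (cmod (fourier_L1 f \<xi>))\<^sup>2 \<partial>lborel)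
      = (\<integral>u. complex_of_real (heat_kernel 1 u) * L2_inner (\<lambda>x. f (x - sqrt t *\<^sub>R u)) f \<partial>lborel)" .
qed

text \<open>The damping in \<open>plancherel_regularized\<close> is removed by monotone convergence
  on the Fourier side and, on the other side, by dominated convergence with continuity of
  translations.\<close>

lemma plancherel_L1_L2:
  fixes f :: "'a::euclidean_space \<Rightarrow> complex"
  assumes f: "integrable lborel f" and f2: "sq_int f"
  shows "sq_int (fourier_L1 f)" and "L2_norm (fourier_L1 f) = L2_norm f"
proof -
  have [measurable]: "f \<in> borel_measurable borel" using f by auto
  \<comment> \<open>Squares of \<open>1 / (n + 1)\<close> make \<open>sqrt (t n)\<close> explicit,
    and the sequence decreases, as monotone convergence requires.\<close>
  define t where "t n = 1 / real (Suc n) ^ 2" for n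
  have t: "t n > 0" for n by (simp add: t_def)
  have st: "sqrt (t n) = 1 / real (Suc n)" for n by (simp add: t_def real_sqrt_divide)
  define A where "A n u = L2_inner (\<lambda>x. f (x - sqrt (t n) *\<^sub>R u)) f" for n u
  have A_bound: "cmod (A n u) \<le> (L2_norm f)\<^sup>2" for n u
    using L2_inner_le[OF sq_int_translate(1)[OF f2] f2, of "sqrt (t n) *\<^sub>R u"]
    by (simp add: A_def sq_int_translate(2)[OF f2] power2_eq_square)
  have A_lim: "(\<lambda>n. A n u) \<longlonglongrightarrow> L2_inner f f" for u
    unfolding A_def
  proof (rule L2_inner_tendsto[OF sq_int_translate(1)[OF f2] f2 f2 f2])
    have "(\<lambda>n. (1 / real (Suc n)) *\<^sub>R u) \<longlonglongrightarrow> 0 *\<^sub>R u"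
      using LIMSEQ_inverse_real_of_nat by (intro tendsto_intros) (simp add: inverse_eq_divide)
    then show "(\<lambda>n. L2_norm (\<lambda>x. f (x - sqrt (t n) *\<^sub>R u) - f x)) \<longlonglongrightarrow> 0"
      unfolding st by (intro L2_translate_tendsto[OF f2]) simp
    show "(\<lambda>n. L2_norm (\<lambda>x. f x - f x)) \<longlonglongrightarrow> 0" by (simp add: L2_norm_eq)
  qed
  have A_meas [measurable]: "A n \<in> borel_measurable borel" for n
    unfolding A_def[abs_def] L2_inner_def by (rule lborel.borel_measurable_lebesgue_integral) measurable
  have "(\<lambda>n. \<integral>u. complex_of_real (heat_kernel 1 u) * A n u \<partial>lborel)
      \<longlonglongrightarrow> (\<integral>u. complex_of_real (heat_kernel 1 (u::'a)) * L2_inner f f \<partial>lborel)"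
  proof (rule integral_dominated_convergence[where w="\<lambda>u. heat_kernel 1 u * (L2_norm f)\<^sup>2"])
    show "integrable lborel (\<lambda>u::'a. heat_kernel 1 u * (L2_norm f)\<^sup>2)" by (intro integrable_mult_left heat_kernel_1)
    show "AE u in lborel. (\<lambda>n. complex_of_real (heat_kernel 1 u) * A n u) \<longlonglongrightarrow> complex_of_real (heat_kernel 1 u) * L2_inner f f"
      by (intro AE_I2 tendsto_intros A_lim)
    show "AE u in lborel. norm (complex_of_real (heat_kernel 1 u) * A n u) \<le> heat_kernel 1 u * (L2_norm f)\<^sup>2" for n
      by (intro AE_I2) (simp add: norm_mult A_bound mult_left_mono)
  qed measurable
  also have "(\<integral>u. complex_of_real (heat_kernel 1 (u::'a)) * L2_inner f f \<partial>lborel) = L2_inner f f"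
    using heat_kernel_1(2)[where 'a='a] by (simp only: integral_mult_left_zero integral_complex_of_real) simp
  finally have "(\<lambda>n. complex_of_real (\<integral>\<xi>. exp (- t n * (norm \<xi>)\<^sup>2) * (cmod (fourier_L1 f \<xi>))\<^sup>2 \<partial>lborel)) \<longlonglongrightarrow> complex_of_real ((L2_norm f)\<^sup>2)"
    unfolding plancherel_regularized(2)[OF f f2 t] A_def L2_inner_self[OF f2] .
  then have lim: "(\<lambda>n. \<integral>\<xi>. exp (- t n * (norm \<xi>)\<^sup>2) * (cmod (fourier_L1 f \<xi>))\<^sup>2 \<partial>lborel) \<longlonglongrightarrow> (L2_norm f)\<^sup>2"
    by (simp only: tendsto_of_real_iff)
  have tmono: "t n \<le> t m" if "m \<le> n" for m n
    unfolding t_def using that by (intro divide_left_mono power_mono) auto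
  have tlim: "t \<longlonglongrightarrow> 0"
  proof -
    have "t = (\<lambda>n. (inverse (real (Suc n)))\<^sup>2)" by (simp add: t_def fun_eq_iff inverse_eq_divide power_divide)
    then show ?thesis using tendsto_power[OF LIMSEQ_inverse_real_of_nat, of 2] by simp
  qed
  have mono: "AE \<xi> in lborel. mono (\<lambda>n. exp (- t n * (norm \<xi>)\<^sup>2) * (cmod (fourier_L1 f \<xi>))\<^sup>2)"
    by (intro AE_I2 monoI mult_right_mono) (auto intro!: mult_right_mono tmono)
  have lim2: "AE \<xi> in lborel. (\<lambda>n. exp (- t n * (norm \<xi>)\<^sup>2) * (cmod (fourier_L1 f \<xi>))\<^sup>2) \<longlonglongrightarrow> (cmod (fourier_L1 f \<xi>))\<^sup>2"
  proof (rule AE_I2)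
    fix \<xi> :: 'a
    have "(\<lambda>n. exp (- t n * (norm \<xi>)\<^sup>2) * (cmod (fourier_L1 f \<xi>))\<^sup>2) \<longlonglongrightarrow> exp (- 0 * (norm \<xi>)\<^sup>2) * (cmod (fourier_L1 f \<xi>))\<^sup>2"
      by (intro tendsto_intros tlim)
    then show "(\<lambda>n. exp (- t n * (norm \<xi>)\<^sup>2) * (cmod (fourier_L1 f \<xi>))\<^sup>2) \<longlonglongrightarrow> (cmod (fourier_L1 f \<xi>))\<^sup>2" by simp
  qed
  have meas: "(\<lambda>\<xi>. (cmod (fourier_L1 f \<xi>))\<^sup>2) \<in> borel_measurable lborel" by measurable
  note mc = plancherel_regularized(1)[OF f f2 t] mono lim2 lim meas
  show *: "sq_int (fourier_L1 f)"
    using integrable_monotone_convergence[OF mc] by (simp add: sq_int_def)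
  show "L2_norm (fourier_L1 f) = L2_norm f"
    using integral_monotone_convergence[OF mc] by (simp add: L2_norm_eq[OF *])
qed

subsection \<open>The Fourier transform on square integrable functions\<close>

lemma truncate_integrable:
  fixes f :: "'a::euclidean_space \<Rightarrow> complex"
  assumes "sq_int f" shows "integrable lborel (\<lambda>x. indicator (ball 0 R) x * f x)"
  by (rule integrable_mult_sq_int[OF sq_int_indicator_ball assms])

lemma truncate_sq_int:
  fixes f :: "'a::euclidean_space \<Rightarrow> complex"
  assumes "sq_int f" shows "sq_int (\<lambda>x. indicator (ball 0 R) x * f x)"
  by (rule sq_int_mult_bounded[OF assms, where C=1]) (auto simp: indicator_def)

lemma fourier_truncate_sq_int:
  "sq_int f \<Longrightarrow> sq_int (fourier_L1 (\<lambda>x. indicator (ball 0 R) x * f x))"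
  by (intro plancherel_L1_L2 truncate_integrable truncate_sq_int)

text \<open>By Plancherel every truncated transform is square integrable, so the extended-valued
  convergence in the definition is convergence of real norms.\<close>

lemma is_fourier_L2_iff:
  "is_fourier_L2 f g \<longleftrightarrow> sq_int f \<and> sq_int g \<and>
    ((\<lambda>R. L2_norm (\<lambda>\<xi>. fourier_L1 (\<lambda>x. indicator (ball 0 R) x * f x) \<xi> - g \<xi>)) \<longlongrightarrow> 0) at_top"
  unfolding is_fourier_L2_def
  by (intro conj_cong refl L2_sq_tendsto_0_iff always_eventually allI sq_int_diff fourier_truncate_sq_int)

lemma is_fourier_L2D:
  assumes "is_fourier_L2 f g"
  shows "sq_int f" "sq_int g"
    "((\<lambda>R. L2_norm (\<lambda>\<xi>. fourier_L1 (\<lambda>x. indicator (ball 0 R) x * f x) \<xi> - g \<xi>)) \<longlongrightarrow> 0) at_top"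
  using assms by (auto simp: is_fourier_L2_iff)

lemma is_fourier_L2_norm:
  assumes "is_fourier_L2 f g" shows "L2_norm g = L2_norm f"
proof -
  note D = is_fourier_L2D[OF assms]
  have "((\<lambda>R. L2_norm (fourier_L1 (\<lambda>x. indicator (ball 0 R) x * f x))) \<longlongrightarrow> L2_norm g) at_top"
    by (intro L2_norm_tendsto fourier_truncate_sq_int D)
  then have "((\<lambda>R. L2_norm (\<lambda>x. indicator (ball 0 R) x * f x)) \<longlongrightarrow> L2_norm g) at_top"
    by (simp only: plancherel_L1_L2(2)[OF truncate_integrable[OF D(1)] truncate_sq_int[OF D(1)]])
  moreover have "((\<lambda>R. L2_norm (\<lambda>x. indicator (ball 0 R) x * f x)) \<longlongrightarrow> L2_norm f) at_top"
    by (intro L2_norm_tendsto truncate_sq_int D L2_norm_truncate_tendsto)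
  ultimately show ?thesis using tendsto_unique[OF trivial_limit_at_top_linorder] by blast
qed

lemma is_fourier_L2_add:
  assumes 1: "is_fourier_L2 f1 g1" and 2: "is_fourier_L2 f2 g2"
  shows "is_fourier_L2 (\<lambda>x. f1 x + f2 x) (\<lambda>x. g1 x + g2 x)"
  unfolding is_fourier_L2_iff
proof (intro conjI sq_int_add is_fourier_L2D[OF 1] is_fourier_L2D[OF 2])
  note D1 = is_fourier_L2D[OF 1] and D2 = is_fourier_L2D[OF 2]
  have eq: "fourier_L1 (\<lambda>x. indicator (ball 0 R) x * (f1 x + f2 x)) \<xi>
    = fourier_L1 (\<lambda>x. indicator (ball 0 R) x * f1 x) \<xi> + fourier_L1 (\<lambda>x. indicator (ball 0 R) x * f2 x) \<xi>" for R \<xi>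
    unfolding distrib_left by (intro fourier_L1_add truncate_integrable D1 D2)
  show "((\<lambda>R. L2_norm (\<lambda>\<xi>. fourier_L1 (\<lambda>x. indicator (ball 0 R) x * (f1 x + f2 x)) \<xi> - (g1 \<xi> + g2 \<xi>))) \<longlongrightarrow> 0) at_top"
  proof (rule Lim_null_comparison)
    show "((\<lambda>R. L2_norm (\<lambda>\<xi>. fourier_L1 (\<lambda>x. indicator (ball 0 R) x * f1 x) \<xi> - g1 \<xi>)
        + L2_norm (\<lambda>\<xi>. fourier_L1 (\<lambda>x. indicator (ball 0 R) x * f2 x) \<xi> - g2 \<xi>)) \<longlongrightarrow> 0) at_top"
      using tendsto_add[OF D1(3) D2(3)] by simp
    have "L2_norm (\<lambda>\<xi>. fourier_L1 (\<lambda>x. indicator (ball 0 R) x * (f1 x + f2 x)) \<xi> - (g1 \<xi> + g2 \<xi>))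
       \<le> L2_norm (\<lambda>\<xi>. fourier_L1 (\<lambda>x. indicator (ball 0 R) x * f1 x) \<xi> - g1 \<xi>)
        + L2_norm (\<lambda>\<xi>. fourier_L1 (\<lambda>x. indicator (ball 0 R) x * f2 x) \<xi> - g2 \<xi>)" for R
      unfolding eq add_diff_add by (intro L2_norm_triangle sq_int_diff fourier_truncate_sq_int D1 D2)
    then show "\<forall>\<^sub>F R in at_top. norm (L2_norm (\<lambda>\<xi>. fourier_L1 (\<lambda>x. indicator (ball 0 R) x * (f1 x + f2 x)) \<xi> - (g1 \<xi> + g2 \<xi>)))
       \<le> L2_norm (\<lambda>\<xi>. fourier_L1 (\<lambda>x. indicator (ball 0 R) x * f1 x) \<xi> - g1 \<xi>)
        + L2_norm (\<lambda>\<xi>. fourier_L1 (\<lambda>x. indicator (ball 0 R) x * f2 x) \<xi> - g2 \<xi>)"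
      by simp
  qed
qed

lemma is_fourier_L2_scale:
  assumes 1: "is_fourier_L2 f g" shows "is_fourier_L2 (\<lambda>x. c * f x) (\<lambda>x. c * g x)"
  unfolding is_fourier_L2_iff
proof (intro conjI sq_int_scale is_fourier_L2D[OF 1])
  note D = is_fourier_L2D[OF 1]
  have eq: "fourier_L1 (\<lambda>x. indicator (ball 0 R) x * (c * f x)) \<xi> - c * g \<xi>
     = c * (fourier_L1 (\<lambda>x. indicator (ball 0 R) x * f x) \<xi> - g \<xi>)" for R \<xi>
    unfolding mult.left_commute[of _ c] fourier_L1_scale by (simp add: right_diff_distrib)
  have "((\<lambda>R. cmod c * L2_norm (\<lambda>\<xi>. fourier_L1 (\<lambda>x. indicator (ball 0 R) x * f x) \<xi> - g \<xi>)) \<longlongrightarrow> 0) at_top"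
    by (rule tendsto_mult_right_zero[OF D(3)])
  then show "((\<lambda>R. L2_norm (\<lambda>\<xi>. fourier_L1 (\<lambda>x. indicator (ball 0 R) x * (c * f x)) \<xi> - c * g \<xi>)) \<longlongrightarrow> 0) at_top"
    unfolding eq by (subst L2_norm_scale) (intro sq_int_diff fourier_truncate_sq_int D)
qed

lemma is_fourier_L2_diff:
  assumes 1: "is_fourier_L2 f1 g1" and 2: "is_fourier_L2 f2 g2"
  shows "is_fourier_L2 (\<lambda>x. f1 x - f2 x) (\<lambda>x. g1 x - g2 x)"
  using is_fourier_L2_add[OF 1 is_fourier_L2_scale[OF 2, of "-1"]] by simp

lemma is_fourier_L2_cong_AE:
  assumes 1: "is_fourier_L2 f g" and f': "f' \<in> borel_measurable borel" "AE x in lborel. f' x = f x"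
    and g': "g' \<in> borel_measurable borel" "AE x in lborel. g' x = g x"
  shows "is_fourier_L2 f' g'"
proof -
  note D = is_fourier_L2D[OF 1]
  have [measurable]: "f \<in> borel_measurable borel" "f' \<in> borel_measurable borel" using D f' sq_int_measurable by auto
  have eq: "fourier_L1 (\<lambda>x. indicator (ball 0 R) x * f' x) \<xi> = fourier_L1 (\<lambda>x. indicator (ball 0 R) x * f x) \<xi>" for R \<xi>
  proof -
    have "(\<integral>x. exp (- \<i> * complex_of_real (inner \<xi> x)) * (indicator (ball 0 R) x * f' x) \<partial>lborel)
        = (\<integral>x. exp (- \<i> * complex_of_real (inner \<xi> x)) * (indicator (ball 0 R) x * f x) \<partial>lborel)"
    proof (rule integral_cong_AE)
      have [measurable]: "(\<lambda>x. indicator (ball 0 R) x :: complex) \<in> borel_measurable borel"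
        by (intro borel_measurable_indicator) auto
      show "(\<lambda>x. exp (- \<i> * complex_of_real (inner \<xi> x)) * (indicator (ball 0 R) x * f' x)) \<in> borel_measurable lborel"
        by measurable
      show "(\<lambda>x. exp (- \<i> * complex_of_real (inner \<xi> x)) * (indicator (ball 0 R) x * f x)) \<in> borel_measurable lborel"
        by measurable
      show "AE x in lborel. exp (- \<i> * complex_of_real (inner \<xi> x)) * (indicator (ball 0 R) x * f' x)
         = exp (- \<i> * complex_of_real (inner \<xi> x)) * (indicator (ball 0 R) x * f x)"
        using f'(2) by eventually_elim simp
    qed
    then show ?thesis by (simp add: fourier_L1_def)
  qed
  have eq2: "L2_norm (\<lambda>\<xi>. F \<xi> - g' \<xi>) = L2_norm (\<lambda>\<xi>. F \<xi> - g \<xi>)" for F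
    by (rule L2_norm_cong_AE) (use g'(2) in eventually_elim, simp)
  show ?thesis
    unfolding is_fourier_L2_iff eq eq2
    using D sq_int_cong_AE[OF D(1) f'] sq_int_cong_AE[OF D(2) g'] by blast
qed

lemma is_fourier_L2_unique:
  assumes "is_fourier_L2 f g" "is_fourier_L2 f g'"
  shows "AE \<xi> in lborel. g \<xi> = g' \<xi>"
proof -
  note D = is_fourier_L2_diff[OF assms]
  have "L2_norm (\<lambda>x. g x - g' x) = 0"
    using is_fourier_L2_norm[OF D] by (simp add: L2_norm_eq)
  then have "AE \<xi> in lborel. g \<xi> - g' \<xi> = 0"
    by (rule L2_norm_eq_0_AE[OF is_fourier_L2D(2)[OF D]])
  then show ?thesis by simp
qed

lemma is_fourier_L2_inj:
  assumes "is_fourier_L2 f g" "is_fourier_L2 f' g"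
  shows "AE \<xi> in lborel. f \<xi> = f' \<xi>"
proof -
  note D = is_fourier_L2_diff[OF assms]
  have "L2_norm (\<lambda>x. f x - f' x) = 0"
    using is_fourier_L2_norm[OF D] by (simp add: L2_norm_eq)
  then have "AE \<xi> in lborel. f \<xi> - f' \<xi> = 0"
    by (rule L2_norm_eq_0_AE[OF is_fourier_L2D(1)[OF D]])
  then show ?thesis by simp
qed

lemma is_fourier_L2_L1:
  assumes f: "integrable lborel f" and f2: "sq_int f"
  shows "is_fourier_L2 f (fourier_L1 f)"
proof -
  have "L2_norm (\<lambda>\<xi>. fourier_L1 (\<lambda>x. indicator (ball 0 R) x * f x) \<xi> - fourier_L1 f \<xi>)
      = L2_norm (\<lambda>x. indicator (ball 0 R) x * f x - f x)" for R
  proof -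
    have "(\<lambda>\<xi>. fourier_L1 (\<lambda>x. indicator (ball 0 R) x * f x) \<xi> - fourier_L1 f \<xi>)
      = fourier_L1 (\<lambda>x. indicator (ball 0 R) x * f x - f x)"
      by (intro ext fourier_L1_diff[symmetric] truncate_integrable f f2)
    then show ?thesis
      using plancherel_L1_L2(2)[of "\<lambda>x. indicator (ball 0 R) x * f x - f x"]
        Bochner_Integration.integrable_diff[OF truncate_integrable[OF f2] f] sq_int_diff[OF truncate_sq_int[OF f2] f2]
      by simp
  qed
  then show ?thesis
    unfolding is_fourier_L2_iff using f2 plancherel_L1_L2(1)[OF f f2] L2_norm_truncate_tendsto[OF f2] by simp
qed

text \<open>The truncations converge in L^2, so by Plancherel their transforms form a Cauchy
  sequence.\<close>

lemma is_fourier_L2_ex: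
  fixes f :: "'a::euclidean_space \<Rightarrow> complex"
  assumes f: "sq_int f"
  obtains g where "is_fourier_L2 f g"
proof -
  define T where "T R x = indicator (ball 0 R) x * f x" for R x
  have Ti: "integrable lborel (T R)" "sq_int (T R)" for R
    unfolding T_def by (intro truncate_integrable truncate_sq_int f)+
  have Tlim: "((\<lambda>R. L2_norm (\<lambda>x. T R x - f x)) \<longlongrightarrow> 0) at_top"
    unfolding T_def by (rule L2_norm_truncate_tendsto[OF f])
  then have Tlim': "(\<lambda>n. L2_norm (\<lambda>x. T (real n) x - f x)) \<longlonglongrightarrow> 0"
    by (rule filterlim_compose[OF _ filterlim_real_sequentially])
  have Fd: "L2_norm (\<lambda>\<xi>. fourier_L1 (T R) \<xi> - fourier_L1 (T S) \<xi>) \<le> L2_norm (\<lambda>x. T R x - f x) + L2_norm (\<lambda>x. T S x - f x)" for R S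
  proof -
    have "(\<lambda>\<xi>. fourier_L1 (T R) \<xi> - fourier_L1 (T S) \<xi>) = fourier_L1 (\<lambda>x. T R x - T S x)"
      by (intro ext fourier_L1_diff[symmetric] Ti)
    then have "L2_norm (\<lambda>\<xi>. fourier_L1 (T R) \<xi> - fourier_L1 (T S) \<xi>) = L2_norm (\<lambda>x. T R x - T S x)"
      using plancherel_L1_L2(2)[OF Bochner_Integration.integrable_diff[OF Ti(1) Ti(1)] sq_int_diff[OF Ti(2) Ti(2)]] by simp
    also have "\<dots> \<le> L2_norm (\<lambda>x. T R x - f x) + L2_norm (\<lambda>x. f x - T S x)"
      by (intro L2_norm_triangle3 Ti f)
    also have "L2_norm (\<lambda>x. f x - T S x) = L2_norm (\<lambda>x. T S x - f x)" by (rule L2_norm_minus_commute)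
    finally show ?thesis .
  qed
  have Fsq: "sq_int (fourier_L1 (T R))" for R by (intro plancherel_L1_L2 Ti)
  obtain g where g: "sq_int g" "(\<lambda>n. L2_norm (\<lambda>x. fourier_L1 (T (real n)) x - g x)) \<longlonglongrightarrow> 0"
  proof (rule L2_complete[of "\<lambda>n. fourier_L1 (T (real n))"])
    show "sq_int (fourier_L1 (T (real n)))" for n by (rule Fsq)
    fix e :: real assume e: "e > 0"
    then obtain N where N: "\<And>n. n \<ge> N \<Longrightarrow> norm (L2_norm (\<lambda>x. T (real n) x - f x) - 0) < e/2"
      using LIMSEQ_D[OF Tlim', of "e/2"] by auto
    have "L2_norm (\<lambda>x. fourier_L1 (T (real m)) x - fourier_L1 (T (real n)) x) < e" if "m \<ge> N" "n \<ge> N" for m n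
      using Fd[of "real m" "real n"] N[OF that(1)] N[OF that(2)] by simp
    then show "\<exists>N. \<forall>m\<ge>N. \<forall>n\<ge>N. L2_norm (\<lambda>x. fourier_L1 (T (real m)) x - fourier_L1 (T (real n)) x) < e" by blast
  qed auto
  \<comment> \<open>Completeness gives convergence along integer radii; the estimate
    \<open>Fd\<close>, with \<open>n\<close> tending to infinity, extends it to all real radii, as
    \<open>is_fourier_L2\<close> demands.\<close>
  have "L2_norm (\<lambda>x. fourier_L1 (T R) x - g x) \<le> L2_norm (\<lambda>x. T R x - f x)" for R
  proof (rule LIMSEQ_le_const)
    show "(\<lambda>n. L2_norm (\<lambda>x. T R x - f x) + L2_norm (\<lambda>x. T (real n) x - f x) + L2_norm (\<lambda>x. fourier_L1 (T (real n)) x - g x))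
      \<longlonglongrightarrow> L2_norm (\<lambda>x. T R x - f x)"
      using tendsto_add[OF tendsto_add[OF tendsto_const Tlim'] g(2)] by simp
    show "\<exists>N. \<forall>n\<ge>N. L2_norm (\<lambda>x. fourier_L1 (T R) x - g x)
        \<le> L2_norm (\<lambda>x. T R x - f x) + L2_norm (\<lambda>x. T (real n) x - f x) + L2_norm (\<lambda>x. fourier_L1 (T (real n)) x - g x)"
      using Fd[of R] L2_norm_triangle3[OF Fsq Fsq g(1)] by (intro exI allI impI) (meson add_right_mono order_trans)
  qed
  then have "((\<lambda>R. L2_norm (\<lambda>x. fourier_L1 (T R) x - g x)) \<longlongrightarrow> 0) at_top"
    by (intro Lim_null_comparison[OF _ Tlim] always_eventually allI) simp
  then have "is_fourier_L2 f g"
    unfolding is_fourier_L2_iff using f g(1) by (simp add: T_def[abs_def])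
  then show thesis by (rule that)
qed

lemma is_fourier_L2_mult_formula:
  assumes 1: "is_fourier_L2 f f'" and 2: "is_fourier_L2 g g'"
  shows "(\<integral>x. f' x * g x \<partial>lborel) = (\<integral>x. f x * g' x \<partial>lborel)"
proof -
  note D1 = is_fourier_L2D[OF 1] and D2 = is_fourier_L2D[OF 2]
  define T :: "real \<Rightarrow> ('a \<Rightarrow> complex) \<Rightarrow> 'a \<Rightarrow> complex" where "T R f x = indicator (ball 0 R) x * f x" for R f x
  have Ti: "integrable lborel (T R h)" "sq_int (T R h)" "sq_int (fourier_L1 (T R h))" if "sq_int h" for R h
    unfolding T_def by (intro truncate_integrable truncate_sq_int fourier_truncate_sq_int that)+
  have lim1: "((\<lambda>R. L2_inner (\<lambda>x. cnj (fourier_L1 (T R f) x)) (T R g)) \<longlongrightarrow> L2_inner (\<lambda>x. cnj (f' x)) g) at_top"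
  proof (rule L2_inner_tendsto)
    have "L2_norm (\<lambda>x. cnj (fourier_L1 (T R f) x) - cnj (f' x)) = L2_norm (\<lambda>x. fourier_L1 (T R f) x - f' x)" for R
      by (rule L2_norm_cong) (simp flip: complex_cnj_diff)
    then show "((\<lambda>R. L2_norm (\<lambda>x. cnj (fourier_L1 (T R f) x) - cnj (f' x))) \<longlongrightarrow> 0) at_top"
      using D1(3) by (simp add: T_def[abs_def])
    show "((\<lambda>R. L2_norm (\<lambda>x. T R g x - g x)) \<longlongrightarrow> 0) at_top"
      unfolding T_def by (rule L2_norm_truncate_tendsto[OF D2(1)])
  qed (intro sq_int_cnj Ti D1 D2)+
  have lim2: "((\<lambda>R. L2_inner (\<lambda>x. cnj (T R f x)) (fourier_L1 (T R g))) \<longlongrightarrow> L2_inner (\<lambda>x. cnj (f x)) g') at_top"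
  proof (rule L2_inner_tendsto)
    show "((\<lambda>R. L2_norm (\<lambda>x. fourier_L1 (T R g) x - g' x)) \<longlongrightarrow> 0) at_top"
      using D2(3) by (simp add: T_def[abs_def])
    have "L2_norm (\<lambda>x. cnj (T R f x) - cnj (f x)) = L2_norm (\<lambda>x. T R f x - f x)" for R
      by (rule L2_norm_cong) (simp flip: complex_cnj_diff)
    then show "((\<lambda>R. L2_norm (\<lambda>x. cnj (T R f x) - cnj (f x))) \<longlongrightarrow> 0) at_top"
      using L2_norm_truncate_tendsto[OF D1(1)] by (simp add: T_def[abs_def])
  qed (intro sq_int_cnj Ti D1 D2)+
  have "L2_inner (\<lambda>x. cnj (fourier_L1 (T R f) x)) (T R g) = L2_inner (\<lambda>x. cnj (T R f x)) (fourier_L1 (T R g))" for R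
    unfolding L2_inner_def complex_cnj_cnj by (rule fourier_L1_mult_formula) (intro Ti D1 D2)+
  then have "L2_inner (\<lambda>x. cnj (f' x)) g = L2_inner (\<lambda>x. cnj (f x)) g'"
    using lim1 lim2 tendsto_unique[OF trivial_limit_at_top_linorder] by simp
  then show ?thesis unfolding L2_inner_def by simp
qed

text \<open>The inverse of the Fourier transform is its conjugate by complex conjugation. The reason
  is equality in the Cauchy-Schwarz inequality: \<open>g\<close> and the transform \<open>k\<close>
  have equal norms, and the real part of their inner product is the squared norm, so they
  coincide.\<close>

lemma is_fourier_L2_inverse:
  assumes "is_fourier_L2 (\<lambda>x. cnj (g x)) h"
  shows "is_fourier_L2 (\<lambda>x. cnj (h x)) g"
proof -
  note D = is_fourier_L2D[OF assms]
  have g: "sq_int g" using sq_int_cnj[OF D(1)] by simp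
  obtain k where k: "is_fourier_L2 (\<lambda>x. cnj (h x)) k"
    using is_fourier_L2_ex[OF sq_int_cnj[OF D(2)]] .
  note Dk = is_fourier_L2D[OF k]
  have nk: "L2_norm k = L2_norm g"
  proof -
    have "L2_norm k = L2_norm (\<lambda>x. cnj (h x))" by (rule is_fourier_L2_norm[OF k])
    also have "\<dots> = L2_norm h" by (rule L2_norm_cong) simp
    also have "\<dots> = L2_norm (\<lambda>x. cnj (g x))" by (rule is_fourier_L2_norm[OF assms])
    also have "\<dots> = L2_norm g" by (rule L2_norm_cong) simp
    finally show ?thesis .
  qed
  have "(\<integral>x. k x * cnj (g x) \<partial>lborel) = (\<integral>x. cnj (h x) * h x \<partial>lborel)"
    by (rule is_fourier_L2_mult_formula[OF k assms])
  then have "L2_inner g k = L2_inner h h" by (simp add: L2_inner_def mult.commute)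
  also have "\<dots> = complex_of_real ((L2_norm h)\<^sup>2)" by (rule L2_inner_self[OF D(2)])
  also have "L2_norm h = L2_norm g"
    using is_fourier_L2_norm[OF assms] L2_norm_cong[of "\<lambda>x. cnj (g x)" g] by simp
  finally have "Re (L2_inner g k) = (L2_norm g)\<^sup>2" by simp
  then have "(L2_norm (\<lambda>x. g x - k x))\<^sup>2 = 0"
    unfolding L2_norm_diff_sq[OF g Dk(2)] nk by simp
  then have "AE x in lborel. g x - k x = 0"
    by (intro L2_norm_eq_0_AE sq_int_diff g Dk) simp
  then have "AE x in lborel. g x = k x" by simp
  then show ?thesis
    by (intro is_fourier_L2_cong_AE[OF k]) (use g Dk sq_int_measurable in auto)
qed

lemma is_fourier_L2_surj:
  assumes g: "sq_int g"
  obtains f where "is_fourier_L2 f g"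
proof -
  obtain h where "is_fourier_L2 (\<lambda>x. cnj (g x)) h" using is_fourier_L2_ex[OF sq_int_cnj[OF g]] .
  then show thesis using that is_fourier_L2_inverse by blast
qed

text \<open>Parseval's identity from duality: with \<open>h\<close> the transform of the conjugate
  of \<open>g1\<close>, \<open>is_fourier_L2_inverse\<close> identifies the conjugate of
  \<open>h\<close> with \<open>f1\<close>.\<close>

lemma is_fourier_L2_inner:
  assumes 1: "is_fourier_L2 f1 g1" and 2: "is_fourier_L2 f2 g2"
  shows "L2_inner g1 g2 = L2_inner f1 f2"
proof -
  obtain h where h: "is_fourier_L2 (\<lambda>x. cnj (g1 x)) h"
    using is_fourier_L2_ex[OF sq_int_cnj[OF is_fourier_L2D(2)[OF 1]]] .
  have ae: "AE x in lborel. cnj (h x) = f1 x"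
    by (rule is_fourier_L2_inj[OF is_fourier_L2_inverse[OF h] 1])
  have "L2_inner g1 g2 = (\<integral>x. g2 x * cnj (g1 x) \<partial>lborel)" by (simp add: L2_inner_def mult.commute)
  also have "\<dots> = (\<integral>x. f2 x * h x \<partial>lborel)" by (rule is_fourier_L2_mult_formula[OF 2 h])
  also have "\<dots> = (\<integral>x. cnj (f1 x) * f2 x \<partial>lborel)"
  proof (rule integral_cong_AE)
    have [measurable]: "f1 \<in> borel_measurable borel" "f2 \<in> borel_measurable borel" "h \<in> borel_measurable borel"
      using is_fourier_L2D[OF 1] is_fourier_L2D[OF 2] is_fourier_L2D[OF h] sq_int_measurable by auto
    show "(\<lambda>x. f2 x * h x) \<in> borel_measurable lborel" by measurable
    show "(\<lambda>x. cnj (f1 x) * f2 x) \<in> borel_measurable lborel" by measurable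
    show "AE x in lborel. f2 x * h x = cnj (f1 x) * f2 x"
      using ae
    proof eventually_elim
      case (elim x)
      then have "h x = cnj (f1 x)" by (metis complex_cnj_cnj)
      then show ?case by simp
    qed
  qed
  finally show ?thesis by (simp add: L2_inner_def)
qed

subsection \<open>Fourier multipliers on exponentially weighted spaces\<close>

text \<open>Formally \<open>q\<close> at \<xi> is the analytic continuation of \<open>p\<close> to
  the complex frequency \<xi> + i v. The common origin \<open>f\<close> encodes this
  relation.\<close>

definition weighted_pair :: "'a::euclidean_space \<Rightarrow> ('a \<Rightarrow> complex) \<Rightarrow> ('a \<Rightarrow> complex) \<Rightarrow> bool" where
  "weighted_pair v p q \<longleftrightarrow> (\<exists>f. is_fourier_L2 f p \<and> is_fourier_L2 (\<lambda>x. complex_of_real (exp (v \<bullet> x)) * f x) q)"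

text \<open>Expresses, through the action on weighted pairs, that \<open>M\<close> is the shift of
  the multiplier \<open>m\<close> by i v. The common bound is what later allows power series such as
  the exponential to be applied.\<close>

definition weighted_multiplier :: "'a::euclidean_space \<Rightarrow> ('a \<Rightarrow> complex) \<Rightarrow> ('a \<Rightarrow> complex) \<Rightarrow> bool" where
  "weighted_multiplier v m M \<longleftrightarrow> m \<in> borel_measurable borel \<and> M \<in> borel_measurable borel \<and>
     (\<exists>C. \<forall>\<xi>. cmod (m \<xi>) \<le> C \<and> cmod (M \<xi>) \<le> C) \<and>
     (\<forall>p q. weighted_pair v p q \<longrightarrow> weighted_pair v (\<lambda>\<xi>. m \<xi> * p \<xi>) (\<lambda>\<xi>. M \<xi> * q \<xi>))"

lemma weighted_pair_sq_int: "weighted_pair v p q \<Longrightarrow> sq_int p \<and> sq_int q"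
  by (auto simp: weighted_pair_def is_fourier_L2_iff)

lemma weighted_pair_add:
  assumes "weighted_pair v p q" "weighted_pair v p' q'"
  shows "weighted_pair v (\<lambda>x. p x + p' x) (\<lambda>x. q x + q' x)"
proof -
  obtain f where f: "is_fourier_L2 f p" "is_fourier_L2 (\<lambda>x. complex_of_real (exp (v \<bullet> x)) * f x) q"
    using assms(1) by (auto simp: weighted_pair_def)
  obtain f' where f': "is_fourier_L2 f' p'" "is_fourier_L2 (\<lambda>x. complex_of_real (exp (v \<bullet> x)) * f' x) q'"
    using assms(2) by (auto simp: weighted_pair_def)
  show ?thesis
    unfolding weighted_pair_def
    using is_fourier_L2_add[OF f(1) f'(1)] is_fourier_L2_add[OF f(2) f'(2)]
    by (intro exI[of _ "\<lambda>x. f x + f' x"]) (simp add: distrib_left)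
qed

lemma weighted_pair_scale:
  assumes "weighted_pair v p q"
  shows "weighted_pair v (\<lambda>x. c * p x) (\<lambda>x. c * q x)"
proof -
  obtain f where f: "is_fourier_L2 f p" "is_fourier_L2 (\<lambda>x. complex_of_real (exp (v \<bullet> x)) * f x) q"
    using assms(1) by (auto simp: weighted_pair_def)
  show ?thesis
    unfolding weighted_pair_def
    using is_fourier_L2_scale[OF f(1), of c] is_fourier_L2_scale[OF f(2), of c]
    by (intro exI[of _ "\<lambda>x. c * f x"]) (simp add: mult_ac)
qed

text \<open>Multiplication by the unbounded weight is a closed operator: on each ball the weight is
  bounded, so the first limit determines the second there, and countably many balls cover the
  space.\<close>

lemma weighted_pair_limit:
  fixes v :: "'a::euclidean_space"
  assumes pq: "\<And>n::nat. weighted_pair v (p n) (q n)" and sq: "sq_int p0" "sq_int q0"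
    and lim: "(\<lambda>n. L2_norm (\<lambda>x. p n x - p0 x)) \<longlonglongrightarrow> 0" "(\<lambda>n. L2_norm (\<lambda>x. q n x - q0 x)) \<longlonglongrightarrow> 0"
  shows "weighted_pair v p0 q0"
proof -
  define W where "W x = complex_of_real (exp (v \<bullet> x))" for x
  have [measurable]: "W \<in> borel_measurable borel" unfolding W_def by measurable
  obtain f where f: "\<And>n. is_fourier_L2 (f n) (p n)" "\<And>n. is_fourier_L2 (\<lambda>x. W x * f n x) (q n)"
    using pq unfolding weighted_pair_def W_def by metis
  obtain f0 where f0: "is_fourier_L2 f0 p0" using is_fourier_L2_surj[OF sq(1)] .
  obtain u where u: "is_fourier_L2 u q0" using is_fourier_L2_surj[OF sq(2)] .
  have sqi: "sq_int (f n)" "sq_int (\<lambda>x. W x * f n x)" "sq_int f0" "sq_int u" for n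
    using f f0 u is_fourier_L2D by blast+
  have [measurable]: "f0 \<in> borel_measurable borel" "u \<in> borel_measurable borel"
    using sqi sq_int_measurable by auto
  have l1: "(\<lambda>n. L2_norm (\<lambda>x. f n x - f0 x)) \<longlonglongrightarrow> 0"
    using lim(1) is_fourier_L2_norm[OF is_fourier_L2_diff[OF f(1) f0]] by simp
  have l2: "(\<lambda>n. L2_norm (\<lambda>x. W x * f n x - u x)) \<longlonglongrightarrow> 0"
    using lim(2) is_fourier_L2_norm[OF is_fourier_L2_diff[OF f(2) u]] by simp
  have "AE x in lborel. \<forall>k::nat. x \<in> ball 0 (real k) \<longrightarrow> W x * f0 x = u x"
  proof (rule AE_all_countable[THEN iffD2], rule allI)
    fix k :: nat
    define b where "b x = (indicator (ball 0 (real k)) x :: complex)" for x :: 'a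
    have bm [measurable]: "b \<in> borel_measurable borel" unfolding b_def by (intro borel_measurable_indicator) auto
    have b1: "cmod (b x) \<le> 1" for x by (auto simp: b_def indicator_def)
    define C where "C = exp (norm v * real k)"
    have bW: "cmod (b x * W x) \<le> C" for x
    proof (cases "x \<in> ball 0 (real k)")
      case True
      then have "v \<bullet> x \<le> norm v * real k"
        using norm_cauchy_schwarz[of v x] by (meson dual_order.trans less_imp_le mem_ball_0 mult_left_mono norm_ge_zero)
      then show ?thesis using True by (simp add: b_def W_def C_def)
    qed (simp add: b_def C_def)
    have sqb: "sq_int (\<lambda>x. b x * W x * f0 x)" "sq_int (\<lambda>x. b x * W x * f n x)" "sq_int (\<lambda>x. b x * u x)" for n
      using sqi by (intro sq_int_mult_bounded[OF _ _ bW] sq_int_mult_bounded[OF _ _ b1]; simp)+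
    have le: "L2_norm (\<lambda>x. b x * W x * f0 x - b x * u x) \<le> C * L2_norm (\<lambda>x. f n x - f0 x) + L2_norm (\<lambda>x. W x * f n x - u x)" for n
    proof -
      have "L2_norm (\<lambda>x. b x * W x * f0 x - b x * u x) \<le> L2_norm (\<lambda>x. b x * W x * f0 x - b x * W x * f n x) + L2_norm (\<lambda>x. b x * W x * f n x - b x * u x)"
        by (intro L2_norm_triangle3 sqb)
      also have "L2_norm (\<lambda>x. b x * W x * f0 x - b x * W x * f n x) = L2_norm (\<lambda>x. (b x * W x) * (f0 x - f n x))"
        by (simp add: right_diff_distrib)
      also have "\<dots> \<le> C * L2_norm (\<lambda>x. f0 x - f n x)"
        by (intro L2_norm_mult_bounded sq_int_diff sqi bW) measurable
      also have "L2_norm (\<lambda>x. f0 x - f n x) = L2_norm (\<lambda>x. f n x - f0 x)" by (rule L2_norm_minus_commute)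
      also have "L2_norm (\<lambda>x. b x * W x * f n x - b x * u x) = L2_norm (\<lambda>x. b x * (W x * f n x - u x))"
        by (simp add: right_diff_distrib mult.assoc)
      also have "\<dots> \<le> 1 * L2_norm (\<lambda>x. W x * f n x - u x)"
        by (intro L2_norm_mult_bounded sq_int_diff sqi b1) measurable
      finally show ?thesis by simp
    qed
    have "(\<lambda>n. C * L2_norm (\<lambda>x. f n x - f0 x) + L2_norm (\<lambda>x. W x * f n x - u x)) \<longlonglongrightarrow> C * 0 + 0"
      by (intro tendsto_intros l1 l2)
    then have "L2_norm (\<lambda>x. b x * W x * f0 x - b x * u x) \<le> C * 0 + 0"
      by (rule LIMSEQ_le_const) (use le in auto)
    then have "L2_norm (\<lambda>x. b x * W x * f0 x - b x * u x) = 0"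
      using L2_norm_nonneg[of "\<lambda>x. b x * W x * f0 x - b x * u x"] by simp
    then have "AE x in lborel. b x * W x * f0 x - b x * u x = 0"
      by (intro L2_norm_eq_0_AE sq_int_diff sqb)
    then show "AE x in lborel. x \<in> ball 0 (real k) \<longrightarrow> W x * f0 x = u x"
      by eventually_elim (auto simp: b_def)
  qed
  then have "AE x in lborel. W x * f0 x = u x"
  proof eventually_elim
    case (elim x)
    moreover have "x \<in> ball 0 (real (nat \<lceil>norm x\<rceil> + 1))" by simp linarith
    ultimately show ?case by blast
  qed
  then have "is_fourier_L2 (\<lambda>x. W x * f0 x) q0"
    using sq_int_measurable[OF sq(2)] by (intro is_fourier_L2_cong_AE[OF u]) auto
  then show ?thesis using f0 unfolding weighted_pair_def W_def by blast
qed

lemma weighted_multiplier_const: "weighted_multiplier v (\<lambda>_. c) (\<lambda>_. c)"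
  unfolding weighted_multiplier_def using weighted_pair_scale by auto

lemma weighted_multiplier_add:
  assumes 1: "weighted_multiplier v m M" and 2: "weighted_multiplier v m' M'"
  shows "weighted_multiplier v (\<lambda>x. m x + m' x) (\<lambda>x. M x + M' x)"
proof -
  obtain C where C: "\<And>x. cmod (m x) \<le> C \<and> cmod (M x) \<le> C" using 1 unfolding weighted_multiplier_def by blast
  obtain C' where C': "\<And>x. cmod (m' x) \<le> C' \<and> cmod (M' x) \<le> C'" using 2 unfolding weighted_multiplier_def by blast
  have "cmod (m x + m' x) \<le> C + C' \<and> cmod (M x + M' x) \<le> C + C'" for x
    using C C' by (meson add_mono norm_triangle_le)
  moreover have "weighted_pair v (\<lambda>\<xi>. (m \<xi> + m' \<xi>) * p \<xi>) (\<lambda>\<xi>. (M \<xi> + M' \<xi>) * q \<xi>)" if "weighted_pair v p q" for p q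
    using 1 2 that unfolding weighted_multiplier_def distrib_right by (intro weighted_pair_add) blast+
  ultimately show ?thesis
    using 1 2 unfolding weighted_multiplier_def by (intro conjI borel_measurable_add exI[of _ "C + C'"]) auto
qed

lemma weighted_multiplier_mult:
  assumes 1: "weighted_multiplier v m M" and 2: "weighted_multiplier v m' M'"
  shows "weighted_multiplier v (\<lambda>x. m x * m' x) (\<lambda>x. M x * M' x)"
proof -
  obtain C where C: "\<And>x. cmod (m x) \<le> C \<and> cmod (M x) \<le> C" using 1 unfolding weighted_multiplier_def by blast
  obtain C' where C': "\<And>x. cmod (m' x) \<le> C' \<and> cmod (M' x) \<le> C'" using 2 unfolding weighted_multiplier_def by blast
  have "0 \<le> C" using C norm_ge_zero order_trans by blast
  then have "cmod (m x * m' x) \<le> C * C' \<and> cmod (M x * M' x) \<le> C * C'" for x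
    using C[of x] C'[of x] by (auto simp: norm_mult intro!: mult_mono)
  then show ?thesis
    using 1 2 unfolding weighted_multiplier_def by (auto simp: mult.assoc)
qed

lemma weighted_multiplier_power:
  "weighted_multiplier v m M \<Longrightarrow> weighted_multiplier v (\<lambda>x. m x ^ k) (\<lambda>x. M x ^ k)"
  by (induction k) (auto intro: weighted_multiplier_mult weighted_multiplier_const)

lemma weighted_multiplier_sum:
  "(\<And>k. weighted_multiplier v (m k) (M k)) \<Longrightarrow> weighted_multiplier v (\<lambda>x. \<Sum>k<n. m k x) (\<lambda>x. \<Sum>k<(n::nat). M k x)"
  by (induction n) (auto intro: weighted_multiplier_add weighted_multiplier_const)

lemma weighted_multiplier_limit:
  assumes m: "\<And>n::nat. weighted_multiplier v (m n) (M n)"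
    and C: "\<And>n x. cmod (m n x) \<le> C" "\<And>n x. cmod (M n x) \<le> C"
    and lim: "\<And>x. (\<lambda>n. m n x) \<longlonglongrightarrow> m0 x" "\<And>x. (\<lambda>n. M n x) \<longlonglongrightarrow> M0 x"
  shows "weighted_multiplier v m0 M0"
proof -
  have meas: "m n \<in> borel_measurable borel" "M n \<in> borel_measurable borel" for n
    using m unfolding weighted_multiplier_def by auto
  note meas0 = borel_measurable_LIMSEQ_metric[OF meas(1) lim(1)] borel_measurable_LIMSEQ_metric[OF meas(2) lim(2)]
  have C0: "cmod (m0 x) \<le> C" "cmod (M0 x) \<le> C" for x
    using LIMSEQ_le_const2[OF tendsto_norm[OF lim(1)[of x]], of C] LIMSEQ_le_const2[OF tendsto_norm[OF lim(2)[of x]], of C] C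
    by auto
  have "weighted_pair v (\<lambda>\<xi>. m0 \<xi> * p \<xi>) (\<lambda>\<xi>. M0 \<xi> * q \<xi>)" if pq: "weighted_pair v p q" for p q
  proof (rule weighted_pair_limit)
    note sq = weighted_pair_sq_int[OF pq]
    show "weighted_pair v (\<lambda>\<xi>. m n \<xi> * p \<xi>) (\<lambda>\<xi>. M n \<xi> * q \<xi>)" for n
      using m pq unfolding weighted_multiplier_def by blast
    show "sq_int (\<lambda>\<xi>. m0 \<xi> * p \<xi>)" "sq_int (\<lambda>\<xi>. M0 \<xi> * q \<xi>)"
      using sq meas0 C0 by (auto intro!: sq_int_mult_bounded)
    show "(\<lambda>n. L2_norm (\<lambda>x. m n x * p x - m0 x * p x)) \<longlonglongrightarrow> 0"
      by (rule L2_mult_convergence[OF _ meas(1) meas0(1) C(1) lim(1)]) (use sq in simp)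
    show "(\<lambda>n. L2_norm (\<lambda>x. M n x * q x - M0 x * q x)) \<longlonglongrightarrow> 0"
      by (rule L2_mult_convergence[OF _ meas(2) meas0(2) C(2) lim(2)]) (use sq in simp)
  qed
  then show ?thesis unfolding weighted_multiplier_def using meas0 C0 by blast
qed

lemma weighted_multiplier_power_series:
  assumes m: "weighted_multiplier v m M" and r: "\<And>x. cmod (m x) \<le> r" "\<And>x. cmod (M x) \<le> r"
    and a: "summable (\<lambda>k. cmod (a k) * r ^ k)"
  shows "weighted_multiplier v (\<lambda>x. \<Sum>k. a k * m x ^ k) (\<lambda>x. \<Sum>k. a k * M x ^ k)"
proof (rule weighted_multiplier_limit)
  have r0: "0 \<le> r" using r(1) norm_ge_zero order_trans by blast
  show "weighted_multiplier v (\<lambda>x. \<Sum>k<n. a k * m x ^ k) (\<lambda>x. \<Sum>k<n. a k * M x ^ k)" for n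
    by (intro weighted_multiplier_sum weighted_multiplier_mult weighted_multiplier_const weighted_multiplier_power m)
  have le: "cmod (a k * z ^ k) \<le> cmod (a k) * r ^ k" if "cmod z \<le> r" for z k
    using that by (auto simp: norm_mult norm_power intro!: mult_left_mono power_mono)
  have bd: "cmod (\<Sum>k<n. a k * z ^ k) \<le> (\<Sum>k. cmod (a k) * r ^ k)" if "cmod z \<le> r" for z n
  proof -
    have "cmod (\<Sum>k<n. a k * z ^ k) \<le> (\<Sum>k<n. cmod (a k) * r ^ k)"
      by (intro sum_norm_le le that)
    also have "\<dots> \<le> (\<Sum>k. cmod (a k) * r ^ k)"
      by (rule sum_le_suminf[OF a]) (use r0 in auto)
    finally show ?thesis .
  qed
  show "cmod (\<Sum>k<n. a k * m x ^ k) \<le> (\<Sum>k. cmod (a k) * r ^ k)" for n x by (rule bd[OF r(1)])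
  show "cmod (\<Sum>k<n. a k * M x ^ k) \<le> (\<Sum>k. cmod (a k) * r ^ k)" for n x by (rule bd[OF r(2)])
  have cv: "(\<lambda>n. \<Sum>k<n. a k * z ^ k) \<longlonglongrightarrow> (\<Sum>k. a k * z ^ k)" if "cmod z \<le> r" for z
    by (intro summable_LIMSEQ summable_comparison_test'[OF a, of 0]) (use le[OF that] in simp)
  show "(\<lambda>n. \<Sum>k<n. a k * m x ^ k) \<longlonglongrightarrow> (\<Sum>k. a k * m x ^ k)" for x by (rule cv[OF r(1)])
  show "(\<lambda>n. \<Sum>k<n. a k * M x ^ k) \<longlonglongrightarrow> (\<Sum>k. a k * M x ^ k)" for x by (rule cv[OF r(2)])
qed

section \<open>Gaussian multipliers and their complex shift\<close>

lemma fourier_L1_translate: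
  "fourier_L1 (\<lambda>x. f (x - a)) \<xi> = exp (- \<i> * complex_of_real (\<xi> \<bullet> a)) * fourier_L1 f (\<xi>::'a::euclidean_space)"
proof -
  have "(\<integral>x. exp (- \<i> * complex_of_real (\<xi> \<bullet> x)) * f (x - a) \<partial>lborel)
     = (\<integral>x. exp (- \<i> * complex_of_real (\<xi> \<bullet> a)) * (exp (- \<i> * complex_of_real (\<xi> \<bullet> x)) * f x) \<partial>lborel)"
    using integral_lborel_affine[of 1 "\<lambda>x. exp (- \<i> * complex_of_real (\<xi> \<bullet> x)) * f (x - a)" a]
    by (simp add: inner_add_right exp_add[symmetric] algebra_simps)
  then show ?thesis unfolding fourier_L1_def by (simp only: integral_mult_right_zero) (simp add: mult_ac)
qed

text \<open>The damped transform is integrable as well as square integrable, so its inverse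
  transform is given by the integral in \<open>fourier_L1_heat\<close>.\<close>

lemma is_fourier_L2_heat:
  fixes f :: "'a::euclidean_space \<Rightarrow> complex"
  assumes f: "integrable lborel f" and t: "t > 0"
  shows "is_fourier_L2 (\<lambda>x. \<integral>y. complex_of_real (heat_kernel t (x - y)) * f y \<partial>lborel)
     (\<lambda>\<xi>. complex_of_real (exp (- t * (norm \<xi>)\<^sup>2)) * fourier_L1 f \<xi>)"
proof -
  define g where "g \<xi> = complex_of_real (exp (- t * (norm \<xi>)\<^sup>2)) * fourier_L1 f \<xi>" for \<xi>
  define c where "c = complex_of_real ((2 * pi) powr (- real DIM('a) / 2))"
  have "integrable lborel (\<lambda>\<xi>. cnj (g \<xi>))" "sq_int (\<lambda>\<xi>. cnj (g \<xi>))"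
    unfolding g_def by (intro integrable_cnj sq_int_cnj fourier_L1_gaussian_weight[OF f t])+
  from is_fourier_L2_inverse[OF is_fourier_L2_L1[OF this]]
  have F: "is_fourier_L2 (\<lambda>x. cnj (fourier_L1 (\<lambda>\<xi>. cnj (g \<xi>)) x)) g" .
  have "cnj (fourier_L1 (\<lambda>\<xi>. cnj (g \<xi>)) x) = (\<integral>y. complex_of_real (heat_kernel t (x - y)) * f y \<partial>lborel)" for x
  proof -
    have e: "cnj (exp (- \<i> * complex_of_real (x \<bullet> \<xi>)) * cnj (g \<xi>)) = exp (\<i> * complex_of_real (\<xi> \<bullet> x)) * g \<xi>" for \<xi>
      by (simp add: exp_cnj inner_commute)
    have "cnj (\<integral>\<xi>. exp (- \<i> * complex_of_real (x \<bullet> \<xi>)) * cnj (g \<xi>) \<partial>lborel)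
        = (\<integral>\<xi>. cnj (exp (- \<i> * complex_of_real (x \<bullet> \<xi>)) * cnj (g \<xi>)) \<partial>lborel)"
      by (rule Bochner_Integration.integral_cnj[symmetric])
    then have "cnj (fourier_L1 (\<lambda>\<xi>. cnj (g \<xi>)) x) = c * (\<integral>\<xi>. exp (\<i> * complex_of_real (\<xi> \<bullet> x)) * g \<xi> \<partial>lborel)"
      unfolding fourier_L1_def[of "\<lambda>\<xi>. cnj (g \<xi>)"] c_def complex_cnj_mult[of "complex_of_real _"] complex_cnj_complex_of_real e
      by (rule arg_cong)
    then show ?thesis unfolding g_def c_def fourier_L1_heat[OF f t] .
  qed
  then show ?thesis using F by (simp add: g_def[abs_def])
qed

text \<open>The value of 1 + z . z, the symbol of one minus the Laplacian, at the complex frequency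
  z = \<xi> + i v.\<close>

definition shifted_symbol :: "'a::euclidean_space \<Rightarrow> 'a \<Rightarrow> complex" where
  "shifted_symbol v \<xi> = complex_of_real (1 - (norm v)\<^sup>2 + (norm \<xi>)\<^sup>2) + 2 * \<i> * complex_of_real (v \<bullet> \<xi>)"

lemma shifted_symbol_measurable [measurable]: "shifted_symbol v \<in> borel_measurable borel"
  unfolding shifted_symbol_def[abs_def] by measurable

lemma shifted_symbol_Re: "Re (shifted_symbol v \<xi>) = 1 - (norm v)\<^sup>2 + (norm \<xi>)\<^sup>2"
  by (simp add: shifted_symbol_def)

lemma shifted_symbol_Im: "Im (shifted_symbol v \<xi>) = 2 * (v \<bullet> \<xi>)"
  by (simp add: shifted_symbol_def)

lemma shifted_symbol_0: "shifted_symbol 0 \<xi> = complex_of_real (1 + (norm \<xi>)\<^sup>2)"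
  by (simp add: shifted_symbol_def)

lemma shifted_symbol_Re_ge: "1 - (norm v)\<^sup>2 \<le> Re (shifted_symbol v \<xi>)"
  by (simp add: shifted_symbol_Re)

text \<open>Cauchy-Schwarz places the symbol inside a parabola, where \<open>abs_Im_sqrt_le\<close>
  bounds the imaginary part of the square root by \<open>norm v\<close>. The slack
  \<open>(norm v)\<^sup>2 * (1 - (norm v)\<^sup>2)\<close> is nonnegative because
  \<open>norm v < 1\<close>.\<close>

lemma shifted_symbol_Im_le:
  assumes "norm v < 1"
  shows "(Im (shifted_symbol v \<xi>))\<^sup>2 \<le> 4 * (norm v)\<^sup>2 * Re (shifted_symbol v \<xi>)"
proof -
  have "(v \<bullet> \<xi>)\<^sup>2 \<le> (norm v * norm \<xi>)\<^sup>2"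
    using Cauchy_Schwarz_ineq2[of v \<xi>] by (intro abs_le_square_iff[THEN iffD1]) simp
  also have "\<dots> \<le> (norm v)\<^sup>2 * (1 - (norm v)\<^sup>2 + (norm \<xi>)\<^sup>2)"
  proof -
    have "0 \<le> (norm v)\<^sup>2 * (1 - (norm v)\<^sup>2)" using assms by (simp add: power_le_one)
    then show ?thesis by (simp add: power_mult_distrib algebra_simps)
  qed
  finally show ?thesis by (simp add: shifted_symbol_Re shifted_symbol_Im power_mult_distrib)
qed

text \<open>Completing the square: conjugating the heat kernel with
  \<open>exp (v \<bullet> x)\<close> translates it by 2 t v and multiplies it by exp (t |v|^2),
  which is exactly the effect of shifting the Gaussian symbol. Truncation to balls extends the
  computation from integrable functions to L^2.\<close>

lemma weighted_multiplier_gaussian: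
  fixes v :: "'a::euclidean_space"
  assumes v: "norm v < 1" and t: "t > 0"
  shows "weighted_multiplier v (\<lambda>\<xi>. exp (- complex_of_real t * shifted_symbol 0 \<xi>))
    (\<lambda>\<xi>. exp (- complex_of_real t * shifted_symbol v \<xi>))"
proof -
  define m where "m \<xi> = exp (- complex_of_real t * shifted_symbol 0 \<xi>)" for \<xi> :: 'a
  define M where "M \<xi> = exp (- complex_of_real t * shifted_symbol v \<xi>)" for \<xi>
  have [measurable]: "m \<in> borel_measurable borel" "M \<in> borel_measurable borel"
    unfolding m_def M_def by measurable
  have m1: "cmod (m \<xi>) \<le> 1" for \<xi>
    using t by (simp add: m_def shifted_symbol_Re add_nonneg_nonneg)
  have M1: "cmod (M \<xi>) \<le> 1" for \<xi>
  proof -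
    have "0 \<le> 1 - (norm v)\<^sup>2 + (norm \<xi>)\<^sup>2" using v by (simp add: power_le_one add_nonneg_nonneg)
    then show ?thesis using t by (simp add: M_def shifted_symbol_Re)
  qed
  define W where "W x = complex_of_real (exp (v \<bullet> x))" for x
  have L1_case: "weighted_pair v (\<lambda>\<xi>. m \<xi> * fourier_L1 f \<xi>) (\<lambda>\<xi>. M \<xi> * fourier_L1 (\<lambda>x. W x * f x) \<xi>)"
    if f: "integrable lborel f" and g: "integrable lborel (\<lambda>x. W x * f x)" for f
  proof -
    define u where "u x = (\<integral>y. complex_of_real (heat_kernel t (x - y)) * f y \<partial>lborel)" for x
    \<comment> \<open>In frequency, translation by \<open>a\<close> produces the factor exp (-2 i t
      v . \<xi>), the contribution of the imaginary part of the symbol.\<close>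
    define a where "a = (2 * t) *\<^sub>R v"
    have ga: "integrable lborel (\<lambda>x. W (x - a) * f (x - a))"
      using integrable_lborel_affine[OF g, of 1 "-a"] by simp
    have "is_fourier_L2 (\<lambda>x. complex_of_real (exp (-t)) * u x) (\<lambda>\<xi>. complex_of_real (exp (-t)) * (complex_of_real (exp (- t * (norm \<xi>)\<^sup>2)) * fourier_L1 f \<xi>))"
      unfolding u_def by (rule is_fourier_L2_scale[OF is_fourier_L2_heat[OF f t]])
    moreover have "complex_of_real (exp (-t)) * (complex_of_real (exp (- t * (norm \<xi>)\<^sup>2)) * fourier_L1 f \<xi>) = m \<xi> * fourier_L1 f \<xi>" for \<xi>
    proof -
      have "complex_of_real (exp (-t)) * complex_of_real (exp (- t * (norm \<xi>)\<^sup>2)) = m \<xi>"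
        unfolding m_def shifted_symbol_0 of_real_mult[symmetric] exp_add[symmetric]
        by (simp add: algebra_simps flip: exp_of_real)
      then show ?thesis by (simp add: mult.assoc[symmetric])
    qed
    ultimately have F1: "is_fourier_L2 (\<lambda>x. complex_of_real (exp (-t)) * u x) (\<lambda>\<xi>. m \<xi> * fourier_L1 f \<xi>)" by (simp only:)
    \<comment> \<open>The remaining real constant: \<open>exp (- t)\<close> from the 1 in the
      symbol, times \<open>exp (t * (norm v)\<^sup>2)\<close> from the completed square.\<close>
    define d where "d = exp (- t * (1 - (norm v)\<^sup>2))"
    have F2: "is_fourier_L2 (\<lambda>x. complex_of_real d * (\<integral>y. complex_of_real (heat_kernel t (x - y)) * (W (y - a) * f (y - a)) \<partial>lborel))
       (\<lambda>\<xi>. complex_of_real d * (complex_of_real (exp (- t * (norm \<xi>)\<^sup>2)) * fourier_L1 (\<lambda>y. W (y - a) * f (y - a)) \<xi>))"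
      by (rule is_fourier_L2_scale[OF is_fourier_L2_heat[OF ga t]])
    have e1: "complex_of_real d * (complex_of_real (exp (- t * (norm \<xi>)\<^sup>2)) * fourier_L1 (\<lambda>y. W (y - a) * f (y - a)) \<xi>)
       = M \<xi> * fourier_L1 (\<lambda>x. W x * f x) \<xi>" for \<xi>
    proof -
      have "complex_of_real d * (complex_of_real (exp (- t * (norm \<xi>)\<^sup>2)) * exp (- \<i> * complex_of_real (\<xi> \<bullet> a))) = M \<xi>"
        unfolding d_def M_def shifted_symbol_def a_def exp_of_real[symmetric] exp_add[symmetric]
        by (rule arg_cong[where f=exp]) (simp add: algebra_simps inner_commute)
      then show ?thesis
        unfolding fourier_L1_translate[where f="\<lambda>x. W x * f x"] by (metis mult.assoc)
    qed
    have e2: "complex_of_real d * (\<integral>y. complex_of_real (heat_kernel t (x - y)) * (W (y - a) * f (y - a)) \<partial>lborel)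
       = W x * (complex_of_real (exp (-t)) * u x)" for x
    proof -
      have "(\<integral>y. complex_of_real (heat_kernel t (x - y)) * (W (y - a) * f (y - a)) \<partial>lborel)
          = (\<integral>y. complex_of_real (heat_kernel t (x - a - y)) * (W y * f y) \<partial>lborel)"
        using integral_lborel_affine[of 1 "\<lambda>y. complex_of_real (heat_kernel t (x - y)) * (W (y - a) * f (y - a))" a]
        by (simp add: algebra_simps)
      also have "complex_of_real d * \<dots> = (\<integral>y. complex_of_real d * (complex_of_real (heat_kernel t (x - a - y)) * (W y * f y)) \<partial>lborel)"
        by (rule integral_mult_right_zero[symmetric])
      also have "\<dots> = (\<integral>y. (W x * complex_of_real (exp (-t))) * (complex_of_real (heat_kernel t (x - y)) * f y) \<partial>lborel)"
      proof (rule Bochner_Integration.integral_cong[OF refl])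
        fix y
        have n: "(norm (x - a - y))\<^sup>2 = (norm (x - y))\<^sup>2 - 4 * t * (v \<bullet> (x - y)) + 4 * t\<^sup>2 * (norm v)\<^sup>2"
          unfolding a_def power2_norm_eq_inner
          by (simp add: inner_diff_left inner_diff_right inner_commute power2_eq_square algebra_simps)
        have "- (norm (x - a - y))\<^sup>2 / (4 * t) = - (norm (x - y))\<^sup>2 / (4 * t) + v \<bullet> (x - y) - t * (norm v)\<^sup>2"
          unfolding n using t by (simp add: field_simps power2_eq_square)
        then have "- t * (1 - (norm v)\<^sup>2) + (- (norm (x - a - y))\<^sup>2 / (4 * t) + v \<bullet> y)
           = v \<bullet> x + (- t + (- (norm (x - y))\<^sup>2 / (4 * t)))"
          by (simp add: algebra_simps inner_diff_right)
        then have "d * (exp (- (norm (x - a - y))\<^sup>2 / (4 * t)) * exp (v \<bullet> y))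
           = exp (v \<bullet> x) * (exp (-t) * exp (- (norm (x - y))\<^sup>2 / (4 * t)))"
          unfolding d_def exp_add[symmetric] by simp
        then have "d * (heat_kernel t (x - a - y) * exp (v \<bullet> y)) = exp (v \<bullet> x) * (exp (-t) * heat_kernel t (x - y))"
          unfolding heat_kernel_def by (simp add: mult_ac)
        then have "complex_of_real d * (complex_of_real (heat_kernel t (x - a - y)) * W y)
           = W x * (complex_of_real (exp (-t)) * complex_of_real (heat_kernel t (x - y)))"
          unfolding W_def of_real_mult[symmetric] by simp
        then show "complex_of_real d * (complex_of_real (heat_kernel t (x - a - y)) * (W y * f y))
           = (W x * complex_of_real (exp (-t))) * (complex_of_real (heat_kernel t (x - y)) * f y)"
          by (metis mult.assoc)
      qed
      also have "\<dots> = (W x * complex_of_real (exp (-t))) * u x"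
        unfolding u_def by (rule integral_mult_right_zero)
      finally show ?thesis by (simp only: mult.assoc)
    qed
    show ?thesis
      unfolding weighted_pair_def W_def[symmetric] using F1 F2 unfolding e1 e2 by blast
  qed
  have "weighted_pair v (\<lambda>\<xi>. m \<xi> * p \<xi>) (\<lambda>\<xi>. M \<xi> * q \<xi>)" if pq: "weighted_pair v p q" for p q
  proof -
    obtain f where f: "is_fourier_L2 f p" and g: "is_fourier_L2 (\<lambda>x. W x * f x) q"
      using pq unfolding weighted_pair_def W_def by blast
    note Df = is_fourier_L2D[OF f] and Dg = is_fourier_L2D[OF g]
    \<comment> \<open>Cut off to a ball, both \<open>f\<close> and the weighted \<open>f\<close> are
      integrable; \<open>weighted_pair_limit\<close> then removes the truncation.\<close>
    define T where "T n x = indicator (ball 0 (real n)) x * f x" for n x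
    have WT: "W x * T n x = indicator (ball 0 (real n)) x * (W x * f x)" for n x by (simp add: T_def)
    show ?thesis
    proof (rule weighted_pair_limit)
      show "weighted_pair v (\<lambda>\<xi>. m \<xi> * fourier_L1 (T n) \<xi>) (\<lambda>\<xi>. M \<xi> * fourier_L1 (\<lambda>x. W x * T n x) \<xi>)" for n
      proof (rule L1_case)
        show "integrable lborel (T n)" unfolding T_def by (rule truncate_integrable[OF Df(1)])
        show "integrable lborel (\<lambda>x. W x * T n x)" unfolding WT by (rule truncate_integrable[OF Dg(1)])
      qed
      show "sq_int (\<lambda>\<xi>. m \<xi> * p \<xi>)" by (rule sq_int_mult_bounded[OF Df(2) _ m1]) measurable
      show "sq_int (\<lambda>\<xi>. M \<xi> * q \<xi>)" by (rule sq_int_mult_bounded[OF Dg(2) _ M1]) measurable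
      have le: "L2_norm (\<lambda>\<xi>. mm \<xi> * h \<xi> - mm \<xi> * k \<xi>) \<le> L2_norm (\<lambda>\<xi>. h \<xi> - k \<xi>)"
        if "mm \<in> borel_measurable borel" "\<And>\<xi>. cmod (mm \<xi>) \<le> 1" "sq_int h" "sq_int k" for mm h k :: "'a \<Rightarrow> complex"
        unfolding right_diff_distrib[symmetric]
        using L2_norm_mult_bounded[OF sq_int_diff[OF that(3,4)] that(1,2)] by simp
      show "(\<lambda>n. L2_norm (\<lambda>\<xi>. m \<xi> * fourier_L1 (T n) \<xi> - m \<xi> * p \<xi>)) \<longlonglongrightarrow> 0"
      proof (rule Lim_null_comparison)
        show "(\<lambda>n. L2_norm (\<lambda>\<xi>. fourier_L1 (T n) \<xi> - p \<xi>)) \<longlonglongrightarrow> 0"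
          unfolding T_def by (rule filterlim_compose[OF Df(3) filterlim_real_sequentially])
        show "\<forall>\<^sub>F n in sequentially. norm (L2_norm (\<lambda>\<xi>. m \<xi> * fourier_L1 (T n) \<xi> - m \<xi> * p \<xi>)) \<le> L2_norm (\<lambda>\<xi>. fourier_L1 (T n) \<xi> - p \<xi>)"
        proof (intro always_eventually allI)
          fix n
          have "L2_norm (\<lambda>\<xi>. m \<xi> * fourier_L1 (T n) \<xi> - m \<xi> * p \<xi>) \<le> L2_norm (\<lambda>\<xi>. fourier_L1 (T n) \<xi> - p \<xi>)"
            unfolding T_def by (rule le[OF _ m1 fourier_truncate_sq_int[OF Df(1)] Df(2)]) measurable
          then show "norm (L2_norm (\<lambda>\<xi>. m \<xi> * fourier_L1 (T n) \<xi> - m \<xi> * p \<xi>)) \<le> L2_norm (\<lambda>\<xi>. fourier_L1 (T n) \<xi> - p \<xi>)"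
            by simp
        qed
      qed
      show "(\<lambda>n. L2_norm (\<lambda>\<xi>. M \<xi> * fourier_L1 (\<lambda>x. W x * T n x) \<xi> - M \<xi> * q \<xi>)) \<longlonglongrightarrow> 0"
        unfolding WT
      proof (rule Lim_null_comparison)
        show "(\<lambda>n. L2_norm (\<lambda>\<xi>. fourier_L1 (\<lambda>x. indicator (ball 0 (real n)) x * (W x * f x)) \<xi> - q \<xi>)) \<longlonglongrightarrow> 0"
          by (rule filterlim_compose[OF Dg(3) filterlim_real_sequentially])
        show "\<forall>\<^sub>F n in sequentially. norm (L2_norm (\<lambda>\<xi>. M \<xi> * fourier_L1 (\<lambda>x. indicator (ball 0 (real n)) x * (W x * f x)) \<xi> - M \<xi> * q \<xi>))
            \<le> L2_norm (\<lambda>\<xi>. fourier_L1 (\<lambda>x. indicator (ball 0 (real n)) x * (W x * f x)) \<xi> - q \<xi>)"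
        proof (intro always_eventually allI)
          fix n
          have "L2_norm (\<lambda>\<xi>. M \<xi> * fourier_L1 (\<lambda>x. indicator (ball 0 (real n)) x * (W x * f x)) \<xi> - M \<xi> * q \<xi>)
              \<le> L2_norm (\<lambda>\<xi>. fourier_L1 (\<lambda>x. indicator (ball 0 (real n)) x * (W x * f x)) \<xi> - q \<xi>)"
            by (rule le[OF _ M1 fourier_truncate_sq_int[OF Dg(1)] Dg(2)]) measurable
          then show "norm (L2_norm (\<lambda>\<xi>. M \<xi> * fourier_L1 (\<lambda>x. indicator (ball 0 (real n)) x * (W x * f x)) \<xi> - M \<xi> * q \<xi>))
              \<le> L2_norm (\<lambda>\<xi>. fourier_L1 (\<lambda>x. indicator (ball 0 (real n)) x * (W x * f x)) \<xi> - q \<xi>)"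
            by simp
        qed
      qed
    qed
  qed
  then show ?thesis
    unfolding m_def[symmetric] M_def[symmetric] weighted_multiplier_def using m1 M1 by (auto intro!: exI[of _ 1])
qed

section \<open>Square root and exponential of the shifted symbol\<close>

lemma abs_Im_sqrt_le:
  assumes z: "a\<^sup>2 = z" and Re: "0 \<le> Re z" and Im: "(Im z)\<^sup>2 \<le> 4 * \<kappa>\<^sup>2 * Re z" and \<kappa>: "0 \<le> \<kappa>"
  shows "\<bar>Im a\<bar> \<le> \<kappa>"
proof (rule ccontr)
  assume "\<not> \<bar>Im a\<bar> \<le> \<kappa>"
  then have "\<kappa>\<^sup>2 < \<bar>Im a\<bar>\<^sup>2" using \<kappa> by (intro power_strict_mono) auto
  then have lt: "\<kappa>\<^sup>2 < (Im a)\<^sup>2" by simp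
  \<comment> \<open>Squaring maps the strip |Im a| \<le> \<kappa> onto the region (Im z)^2 \<le> 4
    \<kappa>^2 (Re z + \<kappa>^2), which contains the assumed one. In coordinates, a larger |Im a|
    would force (Im a)^4 \<le> 0.\<close>
  have R: "Re z = (Re a)\<^sup>2 - (Im a)\<^sup>2" and I: "Im z = 2 * Re a * Im a"
    unfolding z[symmetric] by (auto simp: power2_eq_square)
  have "(Re a)\<^sup>2 * (Im a)\<^sup>2 \<le> \<kappa>\<^sup>2 * ((Re a)\<^sup>2 - (Im a)\<^sup>2)"
    using Im unfolding R I by (simp add: power_mult_distrib)
  also have "\<dots> \<le> (Im a)\<^sup>2 * ((Re a)\<^sup>2 - (Im a)\<^sup>2)"
    using lt Re unfolding R by (intro mult_right_mono) auto
  finally have "(Im a)\<^sup>2 * (Im a)\<^sup>2 \<le> 0" by (simp add: algebra_simps)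
  moreover have "(Im a)\<^sup>2 > 0" using lt le_less_trans[OF zero_le_power2] by blast
  ultimately show False by (simp add: mult_le_0_iff)
qed

text \<open>The approximations N (1 - exp (- z / N)) of \<open>z\<close> must satisfy the parabola
  condition with the same constant as \<open>z\<close>, so that the imaginary parts of their square
  roots are bounded uniformly in N. The condition survives because x exp (- x) \<le> 1 - exp (-
  x).\<close>

lemma one_minus_exp_sector:
  assumes Re: "0 \<le> Re z" and Im: "(Im z)\<^sup>2 \<le> 4 * k * Re z"
  shows "0 \<le> Re (1 - exp (- z))" "(Im (1 - exp (- z)))\<^sup>2 \<le> 4 * k * Re (1 - exp (- z))"
proof -
  define x where "x = Re z"
  define y where "y = Im z"
  have x: "0 \<le> x" and y: "y\<^sup>2 \<le> 4 * k * x" using Re Im by (simp_all add: x_def y_def)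
  have R: "Re (1 - exp (- z)) = 1 - exp (- x) * cos y" and I: "Im (1 - exp (- z)) = exp (- x) * sin y"
    by (simp_all add: Re_exp Im_exp x_def y_def)
  have Rge: "1 - exp (- x) \<le> Re (1 - exp (- z))" unfolding R by (simp add: mult_left_le)
  have e1: "exp (- x) \<le> 1" using x by simp
  show R0: "0 \<le> Re (1 - exp (- z))" using Rge e1 by linarith
  show "(Im (1 - exp (- z)))\<^sup>2 \<le> 4 * k * Re (1 - exp (- z))"
  proof (cases "x = 0")
    case True
    then have "y = 0" using y by simp
    then show ?thesis unfolding R I using True by simp
  next
    case False
    then have x0: "x > 0" using x by simp
    have k: "0 \<le> k"
    proof (rule ccontr)
      assume "\<not> 0 \<le> k"
      then have "4 * k * x < 0" using x0 by (simp add: mult_neg_pos)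
      then show False using y zero_le_power2[of y] by linarith
    qed
    have "(exp (- x) * sin y)\<^sup>2 \<le> exp (- x) * y\<^sup>2"
    proof -
      have "(sin y)\<^sup>2 \<le> y\<^sup>2" using abs_sin_x_le_abs_x[of y] by (simp add: abs_le_square_iff)
      moreover have "(exp (- x))\<^sup>2 \<le> exp (- x)" using e1 by (simp add: power2_eq_square mult_left_le)
      ultimately show ?thesis unfolding power_mult_distrib by (intro mult_mono) auto
    qed
    also have "\<dots> \<le> exp (- x) * (4 * k * x)" using y by (intro mult_left_mono) auto
    also have "\<dots> = 4 * k * (x * exp (- x))" by simp
    also have "\<dots> \<le> 4 * k * (1 - exp (- x))"
    proof (intro mult_left_mono)
      have "(1 + x) * exp (- x) \<le> exp x * exp (- x)" by (intro mult_right_mono exp_ge_add_one_self) simp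
      then show "x * exp (- x) \<le> 1 - exp (- x)" by (simp add: exp_minus field_simps)
    qed (use k in simp)
    also have "\<dots> \<le> 4 * k * Re (1 - exp (- z))" using k by (intro mult_left_mono Rge) simp
    finally show ?thesis unfolding I .
  qed
qed

lemma weighted_multiplier_exp:
  assumes m: "weighted_multiplier v m M"
  shows "weighted_multiplier v (\<lambda>x. exp (c * m x)) (\<lambda>x. exp (c * M x))"
proof -
  obtain C where C: "\<And>x. cmod (m x) \<le> C" "\<And>x. cmod (M x) \<le> C" using m unfolding weighted_multiplier_def by blast
  define a where "a k = c ^ k / fact k" for k
  have "summable (\<lambda>k. (cmod c * C) ^ k /\<^sub>R fact k)" by (rule summable_exp_generic)
  then have "summable (\<lambda>k. cmod (a k) * C ^ k)"
    by (simp add: a_def norm_divide norm_power power_mult_distrib field_simps)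
  from weighted_multiplier_power_series[OF m C this]
  have "weighted_multiplier v (\<lambda>x. \<Sum>k. a k * m x ^ k) (\<lambda>x. \<Sum>k. a k * M x ^ k)" .
  moreover have "(\<Sum>k. a k * z ^ k) = exp (c * z)" for z
    unfolding exp_def a_def by (simp add: power_mult_distrib scaleR_conv_of_real field_simps)
  ultimately show ?thesis by simp
qed

lemma csqrt_of_real_mult:
  assumes "0 < r" shows "csqrt (complex_of_real r * z) = complex_of_real (sqrt r) * csqrt z"
proof (rule csqrt_unique)
  have "(complex_of_real (sqrt r))\<^sup>2 = complex_of_real r"
    using assms by (simp flip: of_real_power)
  then show "(complex_of_real (sqrt r) * csqrt z)\<^sup>2 = complex_of_real r * z" by (simp add: power_mult_distrib)
  show "0 < Re (complex_of_real (sqrt r) * csqrt z) \<or> Re (complex_of_real (sqrt r) * csqrt z) = 0 \<and> 0 \<le> Im (complex_of_real (sqrt r) * csqrt z)"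
    using csqrt_principal[of z] assms by auto
qed

lemma csqrt_one_minus_series:
  assumes "cmod q < 1"
  shows "(\<Sum>k. ((1/2 gchoose k) * (-1)^k) * q ^ k) = csqrt (1 - q)"
proof -
  have "(\<lambda>k. (1/2 gchoose k) * (- q) ^ k) sums (1 + (- q)) powr (1/2)"
    by (rule gen_binomial_complex) (use assms in simp)
  moreover have "(1/2 gchoose k) * (- q) ^ k = ((1/2 gchoose k) * (-1)^k) * q ^ k" for k
    by (simp add: power_minus[of q])
  moreover have "1 - q \<noteq> 0" using assms by auto
  ultimately show ?thesis by (simp add: sums_iff csqrt_conv_powr)
qed

text \<open>The square root of the symbol is unbounded, hence outside the class. Its approximation
  is a function of the Gaussian multiplier \<open>q\<close>, and 1 - q has a binomial square root as
  |q| stays below a constant smaller than 1.\<close>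

lemma weighted_multiplier_csqrt_approx:
  fixes v :: "'a::euclidean_space"
  assumes v: "norm v < 1" and N: "N > 0"
  shows "weighted_multiplier v
    (\<lambda>\<xi>. csqrt (complex_of_real N * (1 - exp (- (shifted_symbol 0 \<xi> / complex_of_real N)))))
    (\<lambda>\<xi>. csqrt (complex_of_real N * (1 - exp (- (shifted_symbol v \<xi> / complex_of_real N)))))"
proof -
  \<comment> \<open>The real part of the symbol is at least \<open>1 - (norm v)\<^sup>2\<close>,
    which is positive; this keeps the Gaussian multiplier away from 1, where the square root of 1 -
    q is singular.\<close>
  define r where "r = exp (- (1 - (norm v)\<^sup>2) / N)"
  have d: "1 - (norm v)\<^sup>2 > 0" using v by (simp add: power_less_one_iff abs_square_less_1)
  have r: "0 < r" "r < 1" using d N by (simp_all add: r_def divide_neg_pos)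
  define q where "q w \<xi> = exp (- complex_of_real (1/N) * shifted_symbol w \<xi>)" for w \<xi> :: 'a
  have q: "weighted_multiplier v (q 0) (q v)"
    unfolding q_def[abs_def] by (rule weighted_multiplier_gaussian[OF v]) (use N in simp)
  have qr: "cmod (q w \<xi>) \<le> r" if "w = 0 \<or> w = v" for w \<xi>
  proof -
    have "1 - (norm v)\<^sup>2 \<le> 1 - (norm w)\<^sup>2" using that by auto
    also have "\<dots> \<le> Re (shifted_symbol w \<xi>)" by (rule shifted_symbol_Re_ge)
    finally have "(1 - (norm v)\<^sup>2) / N \<le> Re (shifted_symbol w \<xi>) / N" using N by (simp add: divide_right_mono)
    then show ?thesis by (simp add: q_def r_def diff_divide_distrib)
  qed
  define a where "a k = ((1/2 gchoose k) * (-1)^k :: complex)" for k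
  have "summable (\<lambda>k. cmod (a k) * r ^ k)"
  proof -
    \<comment> \<open>Any radius strictly between \<open>r\<close> and 1 would do: convergence there
      gives absolute convergence at \<open>r\<close>.\<close>
    define s where "s = (1 + r) / 2"
    have s: "r < s" "s < 1" using r by (auto simp: s_def)
    have "(\<lambda>k. (1/2 gchoose k) * (- complex_of_real s) ^ k) sums (1 + (- complex_of_real s)) powr (1/2)"
      by (rule gen_binomial_complex) (use s r in simp)
    then have "summable (\<lambda>k. (1/2 gchoose k) * (- complex_of_real s) ^ k)" by (rule sums_summable)
    from powser_insidea[OF this, of "complex_of_real r"]
    have "summable (\<lambda>k. norm ((1/2 gchoose k) * complex_of_real r ^ k))" using s r by simp
    then show ?thesis using r by (simp add: a_def norm_mult norm_power)
  qed
  from weighted_multiplier_power_series[OF q qr qr this]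
  have "weighted_multiplier v (\<lambda>\<xi>. \<Sum>k. a k * q 0 \<xi> ^ k) (\<lambda>\<xi>. \<Sum>k. a k * q v \<xi> ^ k)" by simp
  from weighted_multiplier_mult[OF weighted_multiplier_const[of v "complex_of_real (sqrt N)"] this]
  have *: "weighted_multiplier v (\<lambda>\<xi>. complex_of_real (sqrt N) * (\<Sum>k. a k * q 0 \<xi> ^ k))
      (\<lambda>\<xi>. complex_of_real (sqrt N) * (\<Sum>k. a k * q v \<xi> ^ k))" .
  have eq: "complex_of_real (sqrt N) * (\<Sum>k. a k * q w \<xi> ^ k)
     = csqrt (complex_of_real N * (1 - exp (- (shifted_symbol w \<xi> / complex_of_real N))))" if "w = 0 \<or> w = v" for w \<xi>
  proof -
    have "cmod (q w \<xi>) < 1" using qr[OF that, of \<xi>] r by linarith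
    from csqrt_one_minus_series[OF this] show ?thesis
      unfolding csqrt_of_real_mult[OF N] by (simp add: a_def q_def)
  qed
  show ?thesis using * by (simp only: eq[OF disjI1[OF refl]] eq[OF disjI2[OF refl]])
qed

lemma exp_difference_quotient_limit:
  fixes z :: complex
  shows "(\<lambda>n. complex_of_real (real (Suc n)) * (1 - exp (- (z / complex_of_real (real (Suc n)))))) \<longlonglongrightarrow> z"
proof (cases "z = 0")
  case False
  have 1: "(\<lambda>n. inverse (complex_of_real (real (Suc n)))) \<longlonglongrightarrow> 0"
    using tendsto_of_real[OF LIMSEQ_inverse_real_of_nat, where 'a=complex] by simp
  have "(\<lambda>n. - z * inverse (complex_of_real (real (Suc n)))) \<longlonglongrightarrow> - z * 0"
    by (intro tendsto_intros 1)
  then have "filterlim (\<lambda>n. - (z / complex_of_real (real (Suc n)))) (at 0) sequentially"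
    using False by (simp add: filterlim_at divide_inverse del: of_nat_Suc)
  from filterlim_compose[OF lim_exp_minus_1 this]
  have "(\<lambda>n. z * ((exp (- (z / complex_of_real (real (Suc n)))) - 1) / (- (z / complex_of_real (real (Suc n)))))) \<longlonglongrightarrow> z * 1"
    by (intro tendsto_intros)
  moreover have "z * ((exp (- (z / complex_of_real (real (Suc n)))) - 1) / (- (z / complex_of_real (real (Suc n)))))
    = complex_of_real (real (Suc n)) * (1 - exp (- (z / complex_of_real (real (Suc n)))))" for n
    using False by (simp add: field_simps del: of_nat_Suc)
  ultimately show ?thesis by simp
qed simp

text \<open>The limit in N is taken after exponentiation, as the square roots themselves are not
  uniformly bounded. Their exponentials are, because the imaginary parts are at most
  \<open>norm v\<close> for every N.\<close>

lemma weighted_multiplier_evolution: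
  fixes v :: "'a::euclidean_space"
  assumes v: "norm v < 1"
  shows "weighted_multiplier v
    (\<lambda>\<xi>. exp (- \<i> * complex_of_real h * csqrt (shifted_symbol 0 \<xi>)))
    (\<lambda>\<xi>. exp (- \<i> * complex_of_real h * csqrt (shifted_symbol v \<xi>)))"
proof (rule weighted_multiplier_limit)
  define a where "a n z = csqrt (complex_of_real (real (Suc n)) * (1 - exp (- (z / complex_of_real (real (Suc n))))))" for n z
  have d: "1 - (norm v)\<^sup>2 > 0" using v by (simp add: power_less_one_iff abs_square_less_1)
  show "weighted_multiplier v (\<lambda>\<xi>. exp (- \<i> * complex_of_real h * a n (shifted_symbol 0 \<xi>)))
      (\<lambda>\<xi>. exp (- \<i> * complex_of_real h * a n (shifted_symbol v \<xi>)))" for n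
    unfolding a_def by (intro weighted_multiplier_exp weighted_multiplier_csqrt_approx v) simp
  have bd: "cmod (exp (- \<i> * complex_of_real h * a n (shifted_symbol w \<xi>))) \<le> exp (\<bar>h\<bar> * norm v)" if w: "w = 0 \<or> w = v" for n w \<xi>
  proof -
    define z where "z = shifted_symbol w \<xi>"
    define N where "N = real (Suc n)"
    have N: "N > 0" by (simp add: N_def)
    have Rz: "0 \<le> Re (z / complex_of_real N)"
    proof -
      have "0 \<le> 1 - (norm w)\<^sup>2" using w d by auto
      then have "0 \<le> Re z" using shifted_symbol_Re_ge[of w \<xi>] by (simp add: z_def)
      then show ?thesis using N by simp
    qed
    have "(Im z)\<^sup>2 \<le> 4 * (norm w)\<^sup>2 * Re z" unfolding z_def by (rule shifted_symbol_Im_le) (use w v in auto)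
    then have "(Im z)\<^sup>2 / N\<^sup>2 \<le> 4 * (norm w)\<^sup>2 * Re z / N\<^sup>2" by (rule divide_right_mono) simp
    then have Iz: "(Im (z / complex_of_real N))\<^sup>2 \<le> 4 * ((norm w)\<^sup>2 / N) * Re (z / complex_of_real N)"
      by (simp add: power_divide power2_eq_square)
    define S where "S = 1 - exp (- (z / complex_of_real N))"
    have S: "0 \<le> Re S" "(Im S)\<^sup>2 \<le> 4 * ((norm w)\<^sup>2 / N) * Re S"
      unfolding S_def by (rule one_minus_exp_sector[OF Rz Iz])+
    have "\<bar>Im (a n z)\<bar> \<le> norm w"
    proof (rule abs_Im_sqrt_le)
      show "(a n z)\<^sup>2 = complex_of_real N * S" by (simp add: a_def S_def N_def)
      show "0 \<le> Re (complex_of_real N * S)" using S N by simp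
      have "N\<^sup>2 * (Im S)\<^sup>2 \<le> N\<^sup>2 * (4 * ((norm w)\<^sup>2 / N) * Re S)" by (intro mult_left_mono S) simp
      then show "(Im (complex_of_real N * S))\<^sup>2 \<le> 4 * (norm w)\<^sup>2 * Re (complex_of_real N * S)"
        using N by (simp add: power_mult_distrib power2_eq_square mult_ac)
    qed simp
    also have "norm w \<le> norm v" using w by auto
    finally have "h * Im (a n z) \<le> \<bar>h\<bar> * norm v"
      by (metis abs_ge_self abs_mult abs_ge_zero mult_left_mono order_trans)
    then show ?thesis by (simp add: z_def)
  qed
  show "cmod (exp (- \<i> * complex_of_real h * a n (shifted_symbol 0 \<xi>))) \<le> exp (\<bar>h\<bar> * norm v)" for n and \<xi> :: 'a
    by (rule bd) simp
  show "cmod (exp (- \<i> * complex_of_real h * a n (shifted_symbol v \<xi>))) \<le> exp (\<bar>h\<bar> * norm v)" for n and \<xi> :: 'a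
    by (rule bd) simp
  have lim: "(\<lambda>n. exp (- \<i> * complex_of_real h * a n (shifted_symbol w \<xi>)))
      \<longlonglongrightarrow> exp (- \<i> * complex_of_real h * csqrt (shifted_symbol w \<xi>))" if w: "w = 0 \<or> w = v" for w \<xi>
  proof -
    have "0 < 1 - (norm w)\<^sup>2" using w d by auto
    then have "0 < Re (shifted_symbol w \<xi>)" using shifted_symbol_Re_ge[of w \<xi>] by linarith
    then have "isCont csqrt (shifted_symbol w \<xi>)"
      by (intro continuous_at_csqrt) (auto simp: complex_nonpos_Reals_iff)
    from isCont_tendsto_compose[OF this exp_difference_quotient_limit]
    show ?thesis unfolding a_def by (intro tendsto_intros)
  qed
  show "(\<lambda>n. exp (- \<i> * complex_of_real h * a n (shifted_symbol 0 \<xi>)))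
      \<longlonglongrightarrow> exp (- \<i> * complex_of_real h * csqrt (shifted_symbol 0 \<xi>))" for \<xi> :: 'a by (rule lim) simp
  show "(\<lambda>n. exp (- \<i> * complex_of_real h * a n (shifted_symbol v \<xi>)))
      \<longlonglongrightarrow> exp (- \<i> * complex_of_real h * csqrt (shifted_symbol v \<xi>))" for \<xi> :: 'a by (rule lim) simp
qed

section \<open>Weighted bounds for the free evolution\<close>

lemma csqrt_shifted_symbol_0: "csqrt (shifted_symbol 0 \<xi>) = complex_of_real (jb \<xi>)"
  unfolding shifted_symbol_0 jb_def by (subst csqrt_of_real_nonneg) (simp_all add: add_nonneg_nonneg)

text \<open>By Plancherel the weighted norm of \<open>u\<close> is the norm of the shifted
  multiplier times the transform of the weighted \<open>f\<close>, and this multiplier has modulus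
  at most \<open>exp (h * norm v)\<close>.\<close>

lemma weighted_evolution_bound:
  fixes v :: "'a::euclidean_space"
  assumes v: "norm v < 1" and h: "h \<ge> 0"
    and f: "is_fourier_L2 f p" and Wf: "sq_int (\<lambda>x. complex_of_real (exp (v \<bullet> x)) * f x)"
    and u: "is_fourier_L2 u (\<lambda>\<xi>. exp (- \<i> * complex_of_real (h * jb \<xi>)) * p \<xi>)"
  shows "sq_int (\<lambda>x. complex_of_real (exp (v \<bullet> x)) * u x)"
    and "L2_norm (\<lambda>x. complex_of_real (exp (v \<bullet> x)) * u x)
      \<le> exp (h * norm v) * L2_norm (\<lambda>x. complex_of_real (exp (v \<bullet> x)) * f x)"
proof -
  define m where "m \<xi> = exp (- \<i> * complex_of_real h * csqrt (shifted_symbol 0 \<xi>))" for \<xi> :: 'a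
  define M where "M \<xi> = exp (- \<i> * complex_of_real h * csqrt (shifted_symbol v \<xi>))" for \<xi>
  have mM: "weighted_multiplier v m M" unfolding m_def M_def by (rule weighted_multiplier_evolution[OF v])
  obtain q where q: "is_fourier_L2 (\<lambda>x. complex_of_real (exp (v \<bullet> x)) * f x) q" using is_fourier_L2_ex[OF Wf] .
  have "weighted_pair v p q" unfolding weighted_pair_def using f q by blast
  then have "weighted_pair v (\<lambda>\<xi>. m \<xi> * p \<xi>) (\<lambda>\<xi>. M \<xi> * q \<xi>)" using mM unfolding weighted_multiplier_def by blast
  then obtain u' where u': "is_fourier_L2 u' (\<lambda>\<xi>. m \<xi> * p \<xi>)"
      "is_fourier_L2 (\<lambda>x. complex_of_real (exp (v \<bullet> x)) * u' x) (\<lambda>\<xi>. M \<xi> * q \<xi>)"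
    unfolding weighted_pair_def by blast
  have "(\<lambda>\<xi>. m \<xi> * p \<xi>) = (\<lambda>\<xi>. exp (- \<i> * complex_of_real (h * jb \<xi>)) * p \<xi>)"
    unfolding m_def csqrt_shifted_symbol_0 by (simp add: mult.assoc)
  with u' u have ae: "AE x in lborel. u x = u' x" by (auto intro: is_fourier_L2_inj)
  have um: "u \<in> borel_measurable borel" using is_fourier_L2D(1)[OF u] by (rule sq_int_measurable)
  then have Wu: "(\<lambda>x. complex_of_real (exp (v \<bullet> x)) * u x) \<in> borel_measurable borel" by measurable
  show "sq_int (\<lambda>x. complex_of_real (exp (v \<bullet> x)) * u x)"
    by (rule sq_int_cong_AE[OF is_fourier_L2D(1)[OF u'(2)] Wu]) (use ae in eventually_elim, simp)
  have "L2_norm (\<lambda>x. complex_of_real (exp (v \<bullet> x)) * u x) = L2_norm (\<lambda>x. complex_of_real (exp (v \<bullet> x)) * u' x)"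
    by (rule L2_norm_cong_AE) (use ae in eventually_elim, simp)
  also have "\<dots> = L2_norm (\<lambda>\<xi>. M \<xi> * q \<xi>)" by (rule is_fourier_L2_norm[OF u'(2), symmetric])
  also have "\<dots> \<le> exp (h * norm v) * L2_norm q"
  proof (rule L2_norm_mult_bounded)
    show "sq_int q" by (rule is_fourier_L2D[OF q])
    show "M \<in> borel_measurable borel" using mM unfolding weighted_multiplier_def by blast
    fix \<xi>
    have d: "1 - (norm v)\<^sup>2 > 0" using v by (simp add: power_less_one_iff abs_square_less_1)
    have "\<bar>Im (csqrt (shifted_symbol v \<xi>))\<bar> \<le> norm v"
      using abs_Im_sqrt_le[of "csqrt (shifted_symbol v \<xi>)" "shifted_symbol v \<xi>" "norm v"]
        shifted_symbol_Im_le[OF v, of \<xi>] shifted_symbol_Re_ge[of v \<xi>] d by simp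
    then have "h * Im (csqrt (shifted_symbol v \<xi>)) \<le> h * norm v" using h by (intro mult_left_mono) auto
    then show "cmod (M \<xi>) \<le> exp (h * norm v)" by (simp add: M_def)
  qed
  also have "L2_norm q = L2_norm (\<lambda>x. complex_of_real (exp (v \<bullet> x)) * f x)" by (rule is_fourier_L2_norm[OF q])
  finally show "L2_norm (\<lambda>x. complex_of_real (exp (v \<bullet> x)) * u x)
      \<le> exp (h * norm v) * L2_norm (\<lambda>x. complex_of_real (exp (v \<bullet> x)) * f x)" .
qed

text \<open>The Cauchy-Schwarz inequality with weights \<open>P\<close> and \<open>1 / d\<close> on
  the two summands; the deficit is an explicit square.\<close>

lemma weighted_parallelogram:
  fixes a b :: complex and P d :: real
  assumes P: "P > 0" and d: "d > 0"
  shows "(cmod (a + b))\<^sup>2 / (1 / P + d) \<le> P * (cmod a)\<^sup>2 + (cmod b)\<^sup>2 / d"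
proof -
  define A where "A = cmod a"
  define B where "B = cmod b"
  have pos: "1 / P + d > 0" using P d by (simp add: add_pos_pos)
  have "(cmod (a + b))\<^sup>2 \<le> (A + B)\<^sup>2"
    unfolding A_def B_def by (intro power_mono norm_triangle_ineq) simp
  also have "\<dots> \<le> (P * A\<^sup>2 + B\<^sup>2 / d) * (1 / P + d)"
  proof -
    have "(P * A\<^sup>2 + B\<^sup>2 / d) * (1 / P + d) - (A + B)\<^sup>2 = (P * d * A - B)\<^sup>2 / (P * d)"
      using P d by (simp add: field_simps power2_eq_square)
    moreover have "0 \<le> (P * d * A - B)\<^sup>2 / (P * d)" using P d by simp
    ultimately show ?thesis by linarith
  qed
  finally show ?thesis using pos by (simp add: A_def B_def pos_divide_le_eq)
qed

text \<open>Up to a factor 2 the minimum of \<open>exp (2 * (v \<bullet> x))\<close> and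
  \<open>1 / d\<close>. The exponent is doubled because the weight multiplies a squared
  modulus.\<close>

definition cutoff_weight :: "'a::euclidean_space \<Rightarrow> real \<Rightarrow> 'a \<Rightarrow> real" where
  "cutoff_weight v d x = 1 / (exp (- 2 * (v \<bullet> x)) + d)"

lemma cutoff_weight_pos: "d > 0 \<Longrightarrow> 0 < cutoff_weight v d x"
  by (simp add: cutoff_weight_def add_pos_pos)

lemma cutoff_weight_le: "d > 0 \<Longrightarrow> cutoff_weight v d x \<le> 1 / d"
  unfolding cutoff_weight_def by (intro divide_left_mono mult_pos_pos add_pos_pos) auto

lemma cutoff_weight_measurable [measurable]: "cutoff_weight v d \<in> borel_measurable borel"
  unfolding cutoff_weight_def[abs_def] by measurable

lemma integrable_cutoff_weight:
  assumes "sq_int f" and d: "d > 0"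
  shows "integrable lborel (\<lambda>x. cutoff_weight v d x * (cmod (f x))\<^sup>2)"
proof (rule Bochner_Integration.integrable_bound)
  show "integrable lborel (\<lambda>x. (1/d) * (cmod (f x))\<^sup>2)" using assms by (auto simp: sq_int_def)
  have "f \<in> borel_measurable borel" using assms(1) by (rule sq_int_measurable)
  then show "(\<lambda>x. cutoff_weight v d x * (cmod (f x))\<^sup>2) \<in> borel_measurable lborel" by measurable
  show "AE x in lborel. norm (cutoff_weight v d x * (cmod (f x))\<^sup>2) \<le> norm ((1/d) * (cmod (f x))\<^sup>2)"
  proof (rule AE_I2)
    fix x
    have "cutoff_weight v d x * (cmod (f x))\<^sup>2 \<le> (1/d) * (cmod (f x))\<^sup>2"
      by (intro mult_right_mono cutoff_weight_le d) simp
    then show "norm (cutoff_weight v d x * (cmod (f x))\<^sup>2) \<le> norm ((1/d) * (cmod (f x))\<^sup>2)"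
      using cutoff_weight_pos[OF d, of v x] d by (simp add: abs_mult)
  qed
qed

text \<open>The weight belongs to the K-functional of the exponentially weighted and the unweighted space:
  its norm is the infimum of \<open>|exp (v \<bullet> x) f1|\<^sup>2 + |f2|\<^sup>2 / d\<close> (norms in \<open>L\<^sup>2\<close>) over all splittings
  \<open>f = f1 + f2\<close>, and the evolution is controlled on both summands.\<close>

lemma cutoff_evolution_bound:
  fixes v :: "'a::euclidean_space"
  assumes v: "norm v < 1" and h: "h \<ge> 0" and d: "d > 0"
    and f: "is_fourier_L2 f p"
    and u: "is_fourier_L2 u (\<lambda>\<xi>. exp (- \<i> * complex_of_real (h * jb \<xi>)) * p \<xi>)"
  shows "(\<integral>x. cutoff_weight v d x * (cmod (u x))\<^sup>2 \<partial>lborel)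
    \<le> exp (2 * h * norm v) * (\<integral>x. cutoff_weight v d x * (cmod (f x))\<^sup>2 \<partial>lborel)"
proof -
  define E where "E = exp (2 * h * norm v)"
  have E1: "1 \<le> E" using h by (simp add: E_def)
  define P where "P x = exp (2 * (v \<bullet> x))" for x
  have P: "P x > 0" for x by (simp add: P_def)
  define W where "W x = complex_of_real (exp (v \<bullet> x))" for x
  have WP: "(cmod (W x))\<^sup>2 = P x" for x by (simp add: W_def P_def power2_eq_square exp_add[symmetric])
  have wP: "cutoff_weight v d x = 1 / (1 / P x + d)" for x
    by (simp add: cutoff_weight_def P_def exp_minus inverse_eq_divide)
  note Df = is_fourier_L2D[OF f] and Du = is_fourier_L2D[OF u]
  \<comment> \<open>The minimizer of
    \<open>P * \<theta>\<^sup>2 + (1 - \<theta>)\<^sup>2 / d\<close>, so this splitting attains the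
    infimum.\<close>
  define \<theta> where "\<theta> x = complex_of_real (1 / (1 + d * P x))" for x
  have [measurable]: "\<theta> \<in> borel_measurable borel" "W \<in> borel_measurable borel"
    unfolding \<theta>_def W_def P_def by measurable
  have dP: "0 < 1 + d * P x" for x using d P[of x] by (simp add: add_pos_pos)
  have dP1: "1 \<le> 1 + d * P x" for x using d P[of x] by (simp add: less_imp_le)
  have \<theta>1: "cmod (\<theta> x) \<le> 1" for x unfolding \<theta>_def norm_of_real using dP1[of x] by simp
  have \<theta>c: "1 - \<theta> x = complex_of_real (d * P x / (1 + d * P x))" for x
  proof -
    have "1 - \<theta> x = complex_of_real (1 - 1 / (1 + d * P x))" by (simp add: \<theta>_def)
    also have "1 - 1 / (1 + d * P x) = d * P x / (1 + d * P x)" using dP[of x] by (simp add: field_simps)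
    finally show ?thesis .
  qed
  have \<theta>2: "cmod (1 - \<theta> x) \<le> 1" for x
  proof -
    from \<theta>c have "cmod (1 - \<theta> x) = d * P x / (1 + d * P x)" using d P[of x] dP[of x] by (simp only: norm_of_real) simp
    also have "\<dots> \<le> 1" using dP[of x] by (simp add: divide_le_eq)
    finally show ?thesis .
  qed
  \<comment> \<open>The first summand lies in the exponentially weighted space even if
    \<open>f\<close> does not: where the weight is large, \<theta> is of order
    \<open>1 / (d * P)\<close>.\<close>
  have \<theta>W: "cmod (W x * \<theta> x) \<le> 1 + 1 / d" for x
  proof -
    have "cmod (W x) \<le> 1 + P x"
    proof (cases "v \<bullet> x \<le> 0")
      case True
      then show ?thesis using P[of x] by (simp add: W_def add_increasing2)
    next
      case False
      then have "exp (v \<bullet> x) \<le> exp (2 * (v \<bullet> x))" by simp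
      then show ?thesis by (simp add: W_def P_def add_increasing)
    qed
    then have "cmod (W x * \<theta> x) \<le> (1 + P x) / (1 + d * P x)"
      unfolding norm_mult \<theta>_def norm_of_real using dP[of x] by (simp add: divide_right_mono)
    also have "\<dots> \<le> 1 + 1 / d"
      using dP[of x] d P[of x] by (simp add: divide_le_eq field_simps)
    finally show ?thesis .
  qed
  define f1 where "f1 x = \<theta> x * f x" for x
  define f2 where "f2 x = (1 - \<theta> x) * f x" for x
  have sq1: "sq_int f1" unfolding f1_def by (rule sq_int_mult_bounded[OF Df(1) _ \<theta>1]) measurable
  have sq2: "sq_int f2" unfolding f2_def by (rule sq_int_mult_bounded[OF Df(1) _ \<theta>2]) measurable
  have "sq_int (\<lambda>x. W x * \<theta> x * f x)" by (rule sq_int_mult_bounded[OF Df(1) _ \<theta>W]) measurable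
  then have sqW: "sq_int (\<lambda>x. W x * f1 x)" by (simp add: f1_def mult.assoc)
  obtain p1 where p1: "is_fourier_L2 f1 p1" using is_fourier_L2_ex[OF sq1] .
  obtain p2 where p2: "is_fourier_L2 f2 p2" using is_fourier_L2_ex[OF sq2] .
  note Dp1 = is_fourier_L2D[OF p1] and Dp2 = is_fourier_L2D[OF p2]
  have "(\<lambda>x. f1 x + f2 x) = f" by (simp add: f1_def f2_def fun_eq_iff algebra_simps)
  with is_fourier_L2_add[OF p1 p2] have "is_fourier_L2 f (\<lambda>x. p1 x + p2 x)" by simp
  from is_fourier_L2_unique[OF f this] have pae: "AE \<xi> in lborel. p \<xi> = p1 \<xi> + p2 \<xi>" .
  define e where "e \<xi> = exp (- \<i> * complex_of_real (h * jb \<xi>))" for \<xi> :: 'a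
  have [measurable]: "e \<in> borel_measurable borel" unfolding e_def jb_def by measurable
  have e1: "cmod (e \<xi>) = 1" for \<xi> by (simp add: e_def)
  have sqe: "sq_int (\<lambda>\<xi>. e \<xi> * g \<xi>)" if "sq_int g" for g
    by (rule sq_int_mult_bounded[OF that, where C=1]) (simp_all add: e1)
  obtain u1 where u1: "is_fourier_L2 u1 (\<lambda>\<xi>. e \<xi> * p1 \<xi>)" using is_fourier_L2_surj[OF sqe[OF Dp1(2)]] .
  obtain u2 where u2: "is_fourier_L2 u2 (\<lambda>\<xi>. e \<xi> * p2 \<xi>)" using is_fourier_L2_surj[OF sqe[OF Dp2(2)]] .
  note Du1 = is_fourier_L2D[OF u1] and Du2 = is_fourier_L2D[OF u2]
  have "is_fourier_L2 (\<lambda>x. u1 x + u2 x) (\<lambda>\<xi>. e \<xi> * p \<xi>)"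
  proof (rule is_fourier_L2_cong_AE[OF is_fourier_L2_add[OF u1 u2]])
    show "(\<lambda>x. u1 x + u2 x) \<in> borel_measurable borel"
      using Du1(1) Du2(1) by (intro sq_int_measurable sq_int_add)
    show "(\<lambda>\<xi>. e \<xi> * p \<xi>) \<in> borel_measurable borel" by (rule sq_int_measurable[OF sqe[OF Df(2)]])
    show "AE \<xi> in lborel. e \<xi> * p \<xi> = e \<xi> * p1 \<xi> + e \<xi> * p2 \<xi>"
      using pae by eventually_elim (simp add: distrib_left)
  qed simp
  from is_fourier_L2_inj[OF u[folded e_def] this] have uae: "AE x in lborel. u x = u1 x + u2 x" .
  have W1: "sq_int (\<lambda>x. W x * u1 x)" "L2_norm (\<lambda>x. W x * u1 x) \<le> exp (h * norm v) * L2_norm (\<lambda>x. W x * f1 x)"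
    using weighted_evolution_bound[OF v h p1 _ u1[unfolded e_def]] sqW unfolding W_def by auto
  have W2: "L2_norm u2 = L2_norm f2"
  proof -
    have "L2_norm u2 = L2_norm (\<lambda>\<xi>. e \<xi> * p2 \<xi>)" by (rule is_fourier_L2_norm[OF u2, symmetric])
    also have "\<dots> = L2_norm p2" by (rule L2_norm_cong) (simp add: norm_mult e1)
    also have "\<dots> = L2_norm f2" by (rule is_fourier_L2_norm[OF p2])
    finally show ?thesis .
  qed
  have int: "integrable lborel (\<lambda>x. P x * (cmod (g x))\<^sup>2 + (cmod (k x))\<^sup>2 / d)"
      "(\<integral>x. P x * (cmod (g x))\<^sup>2 + (cmod (k x))\<^sup>2 / d \<partial>lborel) = (L2_norm (\<lambda>x. W x * g x))\<^sup>2 + (L2_norm k)\<^sup>2 / d"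
    if g: "sq_int (\<lambda>x. W x * g x)" and k: "sq_int k" for g k
  proof -
    have "P x * (cmod (g x))\<^sup>2 = (cmod (W x * g x))\<^sup>2" for x by (simp add: norm_mult power_mult_distrib WP)
    then have 1: "integrable lborel (\<lambda>x. P x * (cmod (g x))\<^sup>2)" "(\<integral>x. P x * (cmod (g x))\<^sup>2 \<partial>lborel) = (L2_norm (\<lambda>x. W x * g x))\<^sup>2"
      using g by (simp_all add: sq_int_def L2_norm_sq[OF g])
    have 2: "integrable lborel (\<lambda>x. (cmod (k x))\<^sup>2 / d)" "(\<integral>x. (cmod (k x))\<^sup>2 / d \<partial>lborel) = (L2_norm k)\<^sup>2 / d"
      using k by (simp_all add: sq_int_def L2_norm_sq[OF k])
    show "integrable lborel (\<lambda>x. P x * (cmod (g x))\<^sup>2 + (cmod (k x))\<^sup>2 / d)" using 1 2 by simp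
    show "(\<integral>x. P x * (cmod (g x))\<^sup>2 + (cmod (k x))\<^sup>2 / d \<partial>lborel) = (L2_norm (\<lambda>x. W x * g x))\<^sup>2 + (L2_norm k)\<^sup>2 / d"
      using 1 2 by simp
  qed
  \<comment> \<open>The minimal value is the cutoff weight itself. For the evolved summands
    \<open>weighted_parallelogram\<close> gives the inequality in the other direction, so no
    constant is lost.\<close>
  have pw: "P x * (cmod (f1 x))\<^sup>2 + (cmod (f2 x))\<^sup>2 / d = cutoff_weight v d x * (cmod (f x))\<^sup>2" for x
  proof -
    define Q where "Q = P x"
    have Q: "Q > 0" "1 + d * Q > 0" using P[of x] dP[of x] by (auto simp: Q_def)
    have "cmod (f1 x) = 1 / (1 + d * Q) * cmod (f x)"
      unfolding f1_def norm_mult \<theta>_def norm_of_real Q_def using dP[of x] by simp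
    moreover have "cmod (f2 x) = d * Q / (1 + d * Q) * cmod (f x)"
      unfolding f2_def norm_mult \<theta>c Q_def[symmetric] norm_of_real using d Q by simp
    moreover have "Q * (1 / (1 + d * Q))\<^sup>2 + (d * Q / (1 + d * Q))\<^sup>2 / d = 1 / (1 / Q + d)"
    proof -
      have "Q * (1 / D)\<^sup>2 + (d * Q / D)\<^sup>2 / d = (Q * (1 + d * Q)) / D\<^sup>2" for D
        using d by (simp add: power_divide power2_eq_square add_divide_distrib distrib_left mult_ac)
      then have "Q * (1 / (1 + d * Q))\<^sup>2 + (d * Q / (1 + d * Q))\<^sup>2 / d = (Q * (1 + d * Q)) / (1 + d * Q)\<^sup>2" .
      also have "\<dots> = Q / (1 + d * Q)" using Q by (simp add: power2_eq_square)
      also have "\<dots> = 1 / (1 / Q + d)" using Q by (simp add: field_simps)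
      finally show ?thesis .
    qed
    ultimately show ?thesis unfolding wP Q_def[symmetric]
      by (simp only: power_mult_distrib) (metis (no_types, lifting) distrib_right mult.assoc times_divide_eq_left)
  qed
  have "(\<integral>x. cutoff_weight v d x * (cmod (u x))\<^sup>2 \<partial>lborel) \<le> (\<integral>x. P x * (cmod (u1 x))\<^sup>2 + (cmod (u2 x))\<^sup>2 / d \<partial>lborel)"
  proof (rule integral_mono_AE)
    show "integrable lborel (\<lambda>x. cutoff_weight v d x * (cmod (u x))\<^sup>2)" by (rule integrable_cutoff_weight[OF Du(1) d])
    show "integrable lborel (\<lambda>x. P x * (cmod (u1 x))\<^sup>2 + (cmod (u2 x))\<^sup>2 / d)" by (rule int(1)[OF W1(1) Du2(1)])
    show "AE x in lborel. cutoff_weight v d x * (cmod (u x))\<^sup>2 \<le> P x * (cmod (u1 x))\<^sup>2 + (cmod (u2 x))\<^sup>2 / d"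
      using uae
    proof eventually_elim
      case (elim x)
      then show ?case using weighted_parallelogram[OF P[of x] d, of "u1 x" "u2 x"] by (simp add: wP)
    qed
  qed
  also have "\<dots> = (L2_norm (\<lambda>x. W x * u1 x))\<^sup>2 + (L2_norm u2)\<^sup>2 / d" by (rule int(2)[OF W1(1) Du2(1)])
  also have "\<dots> \<le> E * (L2_norm (\<lambda>x. W x * f1 x))\<^sup>2 + E * ((L2_norm f2)\<^sup>2 / d)"
  proof (rule add_mono)
    have "(L2_norm (\<lambda>x. W x * u1 x))\<^sup>2 \<le> (exp (h * norm v) * L2_norm (\<lambda>x. W x * f1 x))\<^sup>2"
      by (rule power_mono[OF W1(2)]) simp
    also have "\<dots> = E * (L2_norm (\<lambda>x. W x * f1 x))\<^sup>2"
      unfolding power_mult_distrib E_def by (simp add: power2_eq_square[of "exp _"] exp_add[symmetric])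
    finally show "(L2_norm (\<lambda>x. W x * u1 x))\<^sup>2 \<le> E * (L2_norm (\<lambda>x. W x * f1 x))\<^sup>2" .
    show "(L2_norm u2)\<^sup>2 / d \<le> E * ((L2_norm f2)\<^sup>2 / d)"
      unfolding W2 using mult_right_mono[OF E1, of "(L2_norm f2)\<^sup>2 / d"] d by simp
  qed
  also have "\<dots> = E * (\<integral>x. P x * (cmod (f1 x))\<^sup>2 + (cmod (f2 x))\<^sup>2 / d \<partial>lborel)"
    unfolding int(2)[OF sqW sq2] by (rule distrib_left[symmetric])
  also have "\<dots> = E * (\<integral>x. cutoff_weight v d x * (cmod (f x))\<^sup>2 \<partial>lborel)"
    by (simp only: pw)
  finally show ?thesis unfolding E_def .
qed

subsection \<open>Boundedness of the potential\<close>

lemma nn_integral_powr_tail: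
  fixes a q :: real
  assumes a: "a > 0" and q: "q > 1"
  shows "(\<integral>\<^sup>+x. indicator {a..} x * ennreal (x powr - q) \<partial>lborel) = ennreal (a powr (1 - q) / (q - 1))"
proof -
  define F where "F x = - (1 / (q - 1)) * x powr (1 - q)" for x
  have "(\<integral>\<^sup>+x. ennreal (x powr - q) * indicator {a..} x \<partial>lborel) = ennreal (0 - F a)"
  proof (rule nn_integral_FTC_atLeast)
    have "((\<lambda>x::real. x powr (1 - q)) \<longlongrightarrow> 0) at_top"
      by (rule tendsto_neg_powr[OF _ filterlim_ident]) (use q in simp)
    then show "(F \<longlongrightarrow> 0) at_top"
      unfolding F_def by (rule tendsto_mult_right_zero)
    fix x assume "a \<le> x"
    then have x: "x > 0" using a by simp
    have "(F has_real_derivative - (1 / (q - 1)) * ((1 - q) * x powr (1 - q - 1))) (at x)"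
      unfolding F_def by (rule DERIV_cmult[OF has_real_derivative_powr[OF x]])
    moreover have "- (1 / (q - 1)) * ((1 - q) * x powr (1 - q - 1)) = x powr - q"
      using q by (simp add: field_simps)
    ultimately show "(F has_real_derivative x powr - q) (at x)" by simp
  qed auto
  moreover have "0 - F a = a powr (1 - q) / (q - 1)" by (simp add: F_def)
  ultimately have "(\<integral>\<^sup>+x. ennreal (x powr - q) * indicator {a..} x \<partial>lborel) = ennreal (a powr (1 - q) / (q - 1))"
    by simp
  then show ?thesis by (simp add: mult.commute)
qed

lemma jb_ge_1: "1 \<le> jb \<xi>"
  unfolding jb_def by simp

lemma jb_pos [simp]: "0 < jb \<xi>"
  using jb_ge_1[of \<xi>] by linarith

lemma jb_neq_0 [simp]: "jb \<xi> \<noteq> 0"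
  using jb_pos[of \<xi>] by (metis less_irrefl)

lemma jb_measurable [measurable]: "jb \<in> borel_measurable borel"
  unfolding jb_def[abs_def] by measurable

lemma norm_le_jb: "norm \<xi> \<le> jb \<xi>"
  unfolding jb_def by (rule real_le_rsqrt) simp

lemma emeasure_jb_less:
  assumes "r \<ge> 0"
  shows "emeasure lborel {\<xi>::'a::euclidean_space. jb \<xi> < r} \<le> ennreal (unit_ball_vol (real DIM('a)) * r powr real DIM('a))"
proof -
  have "emeasure lborel {\<xi>::'a. jb \<xi> < r} \<le> emeasure lborel (ball (0::'a) r)"
    by (intro emeasure_mono) (auto intro: le_less_trans[OF norm_le_jb])
  also have "\<dots> = ennreal (unit_ball_vol (real DIM('a)) * r ^ DIM('a))"
    by (rule emeasure_ball[OF assms])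
  also have "r ^ DIM('a) = r powr real DIM('a)"
    using assms by (cases "r = 0") (simp_all add: powr_realpow)
  finally show ?thesis .
qed

lemma layer_cake:
  fixes h :: real
  assumes "h \<ge> 0"
  shows "ennreal h = (\<integral>\<^sup>+l. indicator {0<..} l * indicator {l. l < h} l \<partial>lborel)"
proof -
  have "(\<integral>\<^sup>+l. indicator {0<..} l * indicator {l. l < h} l \<partial>lborel) = (\<integral>\<^sup>+l. indicator {0<..<h} l \<partial>lborel)"
    by (intro nn_integral_cong) (auto simp: indicator_def)
  then show ?thesis using assms by simp
qed

text \<open>Layer cake: the superlevel sets of the integrand are contained in balls. Dimension at
  least 3 makes \<open>D / 2 > 1\<close>, hence the tail in the level \<open>l\<close>
  integrable.\<close>

lemma nn_integral_jb_inverse_square: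
  assumes d: "DIM('a::euclidean_space) \<ge> 3"
  obtains A where "A \<ge> 0"
    "\<And>R. R > 0 \<Longrightarrow> (\<integral>\<^sup>+\<xi>. indicator {\<xi>::'a. jb \<xi> < R} \<xi> * ennreal (1 / (jb \<xi>)\<^sup>2) \<partial>lborel) \<le> ennreal (A * R powr (real DIM('a) - 2))"
proof -
  define D where "D = real DIM('a)"
  have D: "D \<ge> 3" using d by (simp add: D_def)
  define \<omega> where "\<omega> = unit_ball_vol D"
  have \<omega>: "\<omega> \<ge> 0" by (simp add: \<omega>_def D_def)
  have bound: "(\<integral>\<^sup>+\<xi>. indicator {\<xi>::'a. jb \<xi> < R} \<xi> * ennreal (1 / (jb \<xi>)\<^sup>2) \<partial>lborel) \<le> ennreal ((\<omega> + \<omega> / (D/2 - 1)) * R powr (D - 2))" if R: "R > 0" for R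
  proof -
    \<comment> \<open>The level at which the constraints change roles: below it the restriction
      \<open>jb \<xi> < R\<close> is the stronger one, above it the superlevel set, of radius
      \<open>l powr - (1/2)\<close>.\<close>
    define b where "b = R powr - 2"
    have b: "b > 0" using R by (simp add: b_def)
    have "(\<integral>\<^sup>+\<xi>. indicator {\<xi>::'a. jb \<xi> < R} \<xi> * ennreal (1 / (jb \<xi>)\<^sup>2) \<partial>lborel)
       = (\<integral>\<^sup>+\<xi>. \<integral>\<^sup>+l. indicator {\<xi>::'a. jb \<xi> < R} \<xi> * (indicator {0<..} l * indicator {l. l < 1 / (jb \<xi>)\<^sup>2} l) \<partial>lborel \<partial>lborel)"
      by (subst nn_integral_cmult) (simp_all add: layer_cake[symmetric])
    also have "\<dots> = (\<integral>\<^sup>+l. \<integral>\<^sup>+\<xi>. indicator {\<xi>::'a. jb \<xi> < R} \<xi> * (indicator {0<..} l * indicator {l. l < 1 / (jb \<xi>)\<^sup>2} l) \<partial>lborel \<partial>lborel)"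
      by (rule lborel_pair.Fubini') measurable
    also have "\<dots> \<le> (\<integral>\<^sup>+l. ennreal (\<omega> * R powr D) * indicator {0..b} l + ennreal \<omega> * (indicator {b..} l * ennreal (l powr - (D/2))) \<partial>lborel)"
    proof (rule nn_integral_mono)
      fix l :: real
      show "(\<integral>\<^sup>+\<xi>. indicator {\<xi>::'a. jb \<xi> < R} \<xi> * (indicator {0<..} l * indicator {l. l < 1 / (jb \<xi>)\<^sup>2} l) \<partial>lborel)
        \<le> ennreal (\<omega> * R powr D) * indicator {0..b} l + ennreal \<omega> * (indicator {b..} l * ennreal (l powr - (D/2)))"
      proof (cases "0 < l")
        case False
        then show ?thesis by simp
      next
        case l: True
        show ?thesis
        proof (cases "l \<le> b")
          case True
          have "(\<integral>\<^sup>+\<xi>. indicator {\<xi>::'a. jb \<xi> < R} \<xi> * (indicator {0<..} l * indicator {l. l < 1 / (jb \<xi>)\<^sup>2} l) \<partial>lborel)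
             \<le> (\<integral>\<^sup>+\<xi>. indicator {\<xi>::'a. jb \<xi> < R} \<xi> \<partial>lborel)"
            by (intro nn_integral_mono) (auto simp: indicator_def)
          also have "\<dots> = emeasure lborel {\<xi>::'a. jb \<xi> < R}" by simp
          also have "\<dots> \<le> ennreal (\<omega> * R powr D)" unfolding \<omega>_def D_def by (rule emeasure_jb_less) (use R in simp)
          finally show ?thesis using True l by (simp add: add_increasing2)
        next
          case False
          define r where "r = l powr - (1/2)"
          have r: "r \<ge> 0" by (simp add: r_def)
          have "jb \<xi> < r" if "l < 1 / (jb \<xi>)\<^sup>2" for \<xi> :: 'a
          proof -
            have "(jb \<xi>)\<^sup>2 > 0" by simp
            then have "(jb \<xi>)\<^sup>2 < 1 / l" using that l by (simp add: pos_less_divide_eq mult.commute)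
            also have "1 / l = r\<^sup>2" using l by (simp add: r_def powr_minus powr_half_sqrt power_inverse inverse_eq_divide power_divide)
            finally show ?thesis using r by (rule power2_less_imp_less)
          qed
          then have "(\<integral>\<^sup>+\<xi>. indicator {\<xi>::'a. jb \<xi> < R} \<xi> * (indicator {0<..} l * indicator {l. l < 1 / (jb \<xi>)\<^sup>2} l) \<partial>lborel)
             \<le> (\<integral>\<^sup>+\<xi>. indicator {\<xi>::'a. jb \<xi> < r} \<xi> \<partial>lborel)"
            by (intro nn_integral_mono) (auto simp: indicator_def)
          also have "\<dots> = emeasure lborel {\<xi>::'a. jb \<xi> < r}" by simp
          also have "\<dots> \<le> ennreal (\<omega> * r powr D)" unfolding \<omega>_def D_def by (rule emeasure_jb_less[OF r])
          also have "r powr D = l powr - (D/2)" by (simp add: r_def powr_powr)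
          finally show ?thesis using False l \<omega> by (simp add: ennreal_mult')
        qed
      qed
    qed
    also have "\<dots> = ennreal (\<omega> * R powr D) * ennreal b + ennreal \<omega> * ennreal (b powr (1 - D/2) / (D/2 - 1))"
      using b D nn_integral_powr_tail[OF b, of "D/2"] by (subst nn_integral_add) (simp_all add: nn_integral_cmult)
    also have "\<dots> = ennreal (\<omega> * R powr D * b + \<omega> * (b powr (1 - D/2) / (D/2 - 1)))"
    proof -
      have "0 \<le> b powr (1 - D/2) / (D/2 - 1)" "0 \<le> \<omega> * R powr D" using D \<omega> by simp_all
      then show ?thesis using b \<omega> by (simp only: ennreal_plus ennreal_mult mult_nonneg_nonneg less_imp_le)
    qed
    also have "b powr (1 - D/2) = R powr (D - 2)" unfolding b_def powr_powr by simp
    also have "\<omega> * R powr D * b = \<omega> * R powr (D - 2)"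
    proof -
      have "R powr D * b = R powr (D - 2)" unfolding b_def by (simp add: powr_add[symmetric])
      then show ?thesis by (simp add: mult.assoc)
    qed
    finally show ?thesis by (simp add: distrib_right)
  qed
  show thesis
  proof
    show "0 \<le> \<omega> + \<omega> / (D/2 - 1)" using \<omega> D by simp
  qed (use bound in \<open>simp add: D_def\<close>)
qed

lemma L2_sq_add_le:
  assumes [measurable]: "f \<in> borel_measurable borel" "g \<in> borel_measurable borel" "E \<in> sets borel"
  shows "(\<integral>\<^sup>+x. indicator E x * ennreal ((cmod (f x + g x))\<^sup>2) \<partial>lborel)
     \<le> 2 * (\<integral>\<^sup>+x. indicator E x * ennreal ((cmod (f x))\<^sup>2) \<partial>lborel) + 2 * (\<integral>\<^sup>+x. indicator E x * ennreal ((cmod (g x))\<^sup>2) \<partial>lborel)"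
proof -
  have "ennreal ((cmod (f x + g x))\<^sup>2) \<le> 2 * ennreal ((cmod (f x))\<^sup>2) + 2 * ennreal ((cmod (g x))\<^sup>2)" for x
  proof -
    have "(cmod (f x + g x))\<^sup>2 \<le> (cmod (f x) + cmod (g x))\<^sup>2"
      by (intro power_mono norm_triangle_ineq) auto
    also have "\<dots> \<le> 2 * (cmod (f x))\<^sup>2 + 2 * (cmod (g x))\<^sup>2"
      using sum_squares_bound[of "cmod (f x)" "cmod (g x)"] by (simp add: power2_sum)
    finally have "ennreal ((cmod (f x + g x))\<^sup>2) \<le> ennreal (2 * (cmod (f x))\<^sup>2 + 2 * (cmod (g x))\<^sup>2)" by (rule ennreal_leI)
    then show ?thesis by (simp add: ennreal_mult')
  qed
  then have "(\<integral>\<^sup>+x. indicator E x * ennreal ((cmod (f x + g x))\<^sup>2) \<partial>lborel)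
     \<le> (\<integral>\<^sup>+x. 2 * (indicator E x * ennreal ((cmod (f x))\<^sup>2)) + 2 * (indicator E x * ennreal ((cmod (g x))\<^sup>2)) \<partial>lborel)"
    by (intro nn_integral_mono) (auto simp: indicator_def)
  also have "\<dots> = 2 * (\<integral>\<^sup>+x. indicator E x * ennreal ((cmod (f x))\<^sup>2) \<partial>lborel) + 2 * (\<integral>\<^sup>+x. indicator E x * ennreal ((cmod (g x))\<^sup>2) \<partial>lborel)"
    by (simp add: nn_integral_add nn_integral_cmult)
  finally show ?thesis .
qed

text \<open>Frequencies below \<open>R\<close> are bounded pointwise, those above only in the mean.\<close>

lemma L2_mass_on_set_bound:
  fixes f g :: "'a::euclidean_space \<Rightarrow> complex"
  assumes A: "\<And>R. R > 0 \<Longrightarrow> (\<integral>\<^sup>+\<xi>. indicator {\<xi>::'a. jb \<xi> < R} \<xi> * ennreal (1 / (jb \<xi>)\<^sup>2) \<partial>lborel) \<le> ennreal (A * R powr (real DIM('a) - 2))"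
    and fg: "is_fourier_L2 f g" and R: "R > 0" and E [measurable]: "E \<in> sets borel"
  shows "(\<integral>\<^sup>+x. indicator E x * ennreal ((cmod (f x))\<^sup>2) \<partial>lborel)
    \<le> 2 * emeasure lborel E * (ennreal (A * R powr (real DIM('a) - 2)) * (\<integral>\<^sup>+\<xi>. indicator {\<xi>::'a. jb \<xi> < R} \<xi> * ennreal ((jb \<xi>)\<^sup>2 * (cmod (g \<xi>))\<^sup>2) \<partial>lborel))
      + 2 * (\<integral>\<^sup>+\<xi>. indicator {\<xi>. R \<le> jb \<xi>} \<xi> * ennreal ((cmod (g \<xi>))\<^sup>2) \<partial>lborel)"
proof -
  note D = is_fourier_L2D[OF fg]
  have [measurable]: "f \<in> borel_measurable borel" "g \<in> borel_measurable borel" using D sq_int_measurable by auto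
  define l where "l \<xi> = (if jb \<xi> < R then 1 else 0) * g \<xi>" for \<xi>
  have [measurable]: "l \<in> borel_measurable borel" unfolding l_def by measurable
  have sq1: "sq_int (\<lambda>\<xi>::'a. if jb \<xi> < R then 1 else 0 :: complex)"
  proof (rule sq_int_dominated[OF sq_int_indicator_ball, where C=1])
    have "cmod (if jb \<xi> < R then 1 else 0) \<le> 1 * cmod (indicator (ball 0 R) \<xi>)" for \<xi> :: 'a
      using norm_le_jb[of \<xi>] by auto
    then show "AE \<xi>::'a in lborel. cmod (if jb \<xi> < R then 1 else 0) \<le> 1 * cmod (indicator (ball 0 R) \<xi>)" by simp
  qed measurable
  have lsq: "sq_int l" unfolding l_def by (rule sq_int_mult_bounded[OF D(2), where C=1]) auto
  have lint: "integrable lborel l" unfolding l_def by (rule integrable_mult_sq_int[OF sq1 D(2)])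
  \<comment> \<open>The conjugate of \<open>k\<close> is the inverse transform of the low-frequency
    part \<open>l\<close>; as \<open>l\<close> is integrable, \<open>k\<close> is bounded
    pointwise.\<close>
  define k where "k = fourier_L1 (\<lambda>\<xi>. cnj (l \<xi>))"
  have [measurable]: "k \<in> borel_measurable borel" unfolding k_def by measurable
  have kl: "is_fourier_L2 (\<lambda>x. cnj (k x)) l"
    unfolding k_def by (rule is_fourier_L2_inverse[OF is_fourier_L2_L1[OF integrable_cnj[OF lint] sq_int_cnj[OF lsq]]])
  note F = is_fourier_L2_diff[OF fg kl]
  have low: "ennreal ((cmod (k x))\<^sup>2) \<le> ennreal (A * R powr (real DIM('a) - 2)) * (\<integral>\<^sup>+\<xi>. indicator {\<xi>::'a. jb \<xi> < R} \<xi> * ennreal ((jb \<xi>)\<^sup>2 * (cmod (g \<xi>))\<^sup>2) \<partial>lborel)" for x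
  proof -
    have "cmod (k x) \<le> (2 * pi) powr (- real DIM('a) / 2) * (\<integral>\<xi>. cmod (cnj (l \<xi>)) \<partial>lborel)"
      unfolding k_def by (rule fourier_L1_bound)
    also have "\<dots> \<le> 1 * (\<integral>\<xi>. cmod (cnj (l \<xi>)) \<partial>lborel)"
    proof (rule mult_right_mono)
      have "(2 * pi) powr (- real DIM('a) / 2) \<le> (2 * pi) powr 0"
        by (rule powr_mono) (use pi_gt3 in auto)
      then show "(2 * pi) powr (- real DIM('a) / 2) \<le> 1" by simp
    qed simp
    finally have "cmod (k x) \<le> (\<integral>\<xi>. cmod (l \<xi>) \<partial>lborel)" by simp
    then have "ennreal ((cmod (k x))\<^sup>2) \<le> ennreal ((\<integral>\<xi>. cmod (l \<xi>) \<partial>lborel)\<^sup>2)"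
      by (intro ennreal_leI power_mono) auto
    also have "\<dots> = (\<integral>\<^sup>+\<xi>. ennreal (cmod (l \<xi>)) \<partial>lborel)\<^sup>2"
      using nn_integral_eq_integral[OF integrable_norm[OF lint]] by (simp add: ennreal_power)
    \<comment> \<open>Preparation for Cauchy-Schwarz with the weight \<open>jb \<xi>\<close>: one
      factor gives the integral of the inverse square bounded by \<open>A\<close>, the other the
      first-order Sobolev mass below the threshold.\<close>
    also have "(\<integral>\<^sup>+\<xi>. ennreal (cmod (l \<xi>)) \<partial>lborel)
        = (\<integral>\<^sup>+\<xi>. (indicator {\<xi>::'a. jb \<xi> < R} \<xi> * ennreal (1 / jb \<xi>)) * (indicator {\<xi>::'a. jb \<xi> < R} \<xi> * ennreal (jb \<xi> * cmod (g \<xi>))) \<partial>lborel)"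
    proof (rule nn_integral_cong)
      fix \<xi> :: 'a
      have "ennreal (1 / jb \<xi>) * ennreal (jb \<xi> * cmod (g \<xi>)) = ennreal (cmod (g \<xi>))"
        using jb_pos[of \<xi>] by (simp add: ennreal_mult'[symmetric] less_imp_le del: jb_pos)
      then show "ennreal (cmod (l \<xi>)) = (indicator {\<xi>::'a. jb \<xi> < R} \<xi> * ennreal (1 / jb \<xi>)) * (indicator {\<xi>::'a. jb \<xi> < R} \<xi> * ennreal (jb \<xi> * cmod (g \<xi>)))"
        by (simp add: l_def indicator_def)
    qed
    also have "(\<dots>)\<^sup>2 \<le> (\<integral>\<^sup>+\<xi>. (indicator {\<xi>::'a. jb \<xi> < R} \<xi> * ennreal (1 / jb \<xi>))\<^sup>2 \<partial>lborel) * (\<integral>\<^sup>+\<xi>. (indicator {\<xi>::'a. jb \<xi> < R} \<xi> * ennreal (jb \<xi> * cmod (g \<xi>)))\<^sup>2 \<partial>lborel)"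
      by (rule Cauchy_Schwarz_nn_integral) measurable
    also have "(\<integral>\<^sup>+\<xi>. (indicator {\<xi>::'a. jb \<xi> < R} \<xi> * ennreal (1 / jb \<xi>))\<^sup>2 \<partial>lborel) = (\<integral>\<^sup>+\<xi>. indicator {\<xi>::'a. jb \<xi> < R} \<xi> * ennreal (1 / (jb \<xi>)\<^sup>2) \<partial>lborel)"
      by (intro nn_integral_cong) (simp add: indicator_def ennreal_power power_divide less_imp_le)
    also have "(\<integral>\<^sup>+\<xi>. (indicator {\<xi>::'a. jb \<xi> < R} \<xi> * ennreal (jb \<xi> * cmod (g \<xi>)))\<^sup>2 \<partial>lborel) = (\<integral>\<^sup>+\<xi>. indicator {\<xi>::'a. jb \<xi> < R} \<xi> * ennreal ((jb \<xi>)\<^sup>2 * (cmod (g \<xi>))\<^sup>2) \<partial>lborel)"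
      by (intro nn_integral_cong) (simp add: indicator_def ennreal_power power_mult_distrib less_imp_le)
    also have "(\<integral>\<^sup>+\<xi>. indicator {\<xi>::'a. jb \<xi> < R} \<xi> * ennreal (1 / (jb \<xi>)\<^sup>2) \<partial>lborel) \<le> ennreal (A * R powr (real DIM('a) - 2))"
      by (rule A[OF R])
    finally show ?thesis by (simp add: mult_right_mono)
  qed
  have "(\<integral>\<^sup>+x. indicator E x * ennreal ((cmod (f x))\<^sup>2) \<partial>lborel)
      = (\<integral>\<^sup>+x. indicator E x * ennreal ((cmod (cnj (k x) + (f x - cnj (k x))))\<^sup>2) \<partial>lborel)" by simp
  also have "\<dots> \<le> 2 * (\<integral>\<^sup>+x. indicator E x * ennreal ((cmod (cnj (k x)))\<^sup>2) \<partial>lborel) + 2 * (\<integral>\<^sup>+x. indicator E x * ennreal ((cmod (f x - cnj (k x)))\<^sup>2) \<partial>lborel)"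
    by (rule L2_sq_add_le) measurable
  also have "\<dots> \<le> 2 * (emeasure lborel E * (ennreal (A * R powr (real DIM('a) - 2)) * (\<integral>\<^sup>+\<xi>. indicator {\<xi>::'a. jb \<xi> < R} \<xi> * ennreal ((jb \<xi>)\<^sup>2 * (cmod (g \<xi>))\<^sup>2) \<partial>lborel)))
     + 2 * (\<integral>\<^sup>+\<xi>. indicator {\<xi>. R \<le> jb \<xi>} \<xi> * ennreal ((cmod (g \<xi>))\<^sup>2) \<partial>lborel)"
  proof (intro add_mono mult_left_mono)
    define B where "B = ennreal (A * R powr (real DIM('a) - 2)) * (\<integral>\<^sup>+\<xi>. indicator {\<xi>::'a. jb \<xi> < R} \<xi> * ennreal ((jb \<xi>)\<^sup>2 * (cmod (g \<xi>))\<^sup>2) \<partial>lborel)"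
    have "(\<integral>\<^sup>+x. indicator E x * ennreal ((cmod (cnj (k x)))\<^sup>2) \<partial>lborel) \<le> (\<integral>\<^sup>+x. indicator E x * B \<partial>lborel)"
      using low by (intro nn_integral_mono mult_left_mono) (simp_all add: B_def)
    also have "\<dots> = emeasure lborel E * B" by (simp add: nn_integral_multc)
    finally show "(\<integral>\<^sup>+x. indicator E x * ennreal ((cmod (cnj (k x)))\<^sup>2) \<partial>lborel) \<le> emeasure lborel E * B" .
    have "(\<integral>\<^sup>+x. indicator E x * ennreal ((cmod (f x - cnj (k x)))\<^sup>2) \<partial>lborel) \<le> L2_sq (\<lambda>x. f x - cnj (k x))"
      unfolding L2_sq_lborel by (intro nn_integral_mono) (auto simp: indicator_def)
    also have "\<dots> = L2_sq (\<lambda>\<xi>. g \<xi> - l \<xi>)"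
      using is_fourier_L2D(1,2)[OF F] is_fourier_L2_norm[OF F] by (simp add: L2_sq_eq_norm)
    also have "\<dots> = (\<integral>\<^sup>+\<xi>. indicator {\<xi>. R \<le> jb \<xi>} \<xi> * ennreal ((cmod (g \<xi>))\<^sup>2) \<partial>lborel)"
      unfolding L2_sq_lborel by (intro nn_integral_cong) (auto simp: l_def indicator_def)
    finally show "(\<integral>\<^sup>+x. indicator E x * ennreal ((cmod (f x - cnj (k x)))\<^sup>2) \<partial>lborel) \<le> (\<integral>\<^sup>+\<xi>. indicator {\<xi>. R \<le> jb \<xi>} \<xi> * ennreal ((cmod (g \<xi>))\<^sup>2) \<partial>lborel)" .
  qed simp_all
  finally show ?thesis by (simp add: mult.assoc)
qed

lemma jb_nonneg [simp]: "0 \<le> jb \<xi>"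
  by (rule less_imp_le) simp

text \<open>Reflection and translation preserve Lebesgue measure, so bounds through the superlevel
  sets of the potential are uniform in \<open>x\<close>.\<close>

lemma emeasure_superlevel_reflect:
  fixes w :: "'a::euclidean_space \<Rightarrow> real"
  assumes [measurable]: "w \<in> borel_measurable borel"
  shows "emeasure lborel {y. \<bar>w (x - y)\<bar> > l} = emeasure lborel {y. \<bar>w y\<bar> > l}"
proof -
  have "emeasure lborel {y. \<bar>w y\<bar> > l} = (\<integral>\<^sup>+y. indicator {y. \<bar>w y\<bar> > l} y \<partial>lborel)" by simp
  also have "\<dots> = (\<integral>\<^sup>+y. indicator {y. \<bar>w y\<bar> > l} (x - y) \<partial>lborel)"
    using nn_integral_lborel_affine[of "indicator {y. \<bar>w y\<bar> > l}" "-1" x] by simp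
  also have "\<dots> = (\<integral>\<^sup>+y. indicator {y. \<bar>w (x - y)\<bar> > l} y \<partial>lborel)"
    by (intro nn_integral_cong) (simp add: indicator_def)
  also have "\<dots> = emeasure lborel {y. \<bar>w (x - y)\<bar> > l}" by simp
  finally show ?thesis ..
qed

lemma sob_sq_ge:
  assumes "0 \<le> \<sigma>" shows "L2_sq g \<le> sob_sq \<sigma> g"
  unfolding L2_sq_lborel sob_sq_def
proof (intro nn_integral_mono ennreal_leI)
  fix \<xi>
  have "1 * (cmod (g \<xi>))\<^sup>2 \<le> jb \<xi> powr (2 * \<sigma>) * (cmod (g \<xi>))\<^sup>2"
    using assms ge_one_powr_ge_zero[OF jb_ge_1, of "2 * \<sigma>"] by (intro mult_right_mono) auto
  then show "(cmod (g \<xi>))\<^sup>2 \<le> jb \<xi> powr (2 * \<sigma>) * (cmod (g \<xi>))\<^sup>2" by simp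
qed

lemma layer_cake_mass:
  fixes w :: "'a::euclidean_space \<Rightarrow> real"
  assumes [measurable]: "w \<in> borel_measurable borel" "f \<in> borel_measurable borel"
  shows "(\<integral>\<^sup>+y. ennreal (\<bar>w y\<bar> * (cmod (f y))\<^sup>2) \<partial>lborel)
    = (\<integral>\<^sup>+l. indicator {0<..} l * (\<integral>\<^sup>+y. indicator {y. \<bar>w y\<bar> > l} y * ennreal ((cmod (f y))\<^sup>2) \<partial>lborel) \<partial>lborel)"
proof -
  have "(\<integral>\<^sup>+y. ennreal (\<bar>w y\<bar> * (cmod (f y))\<^sup>2) \<partial>lborel)
     = (\<integral>\<^sup>+y. \<integral>\<^sup>+l. ennreal ((cmod (f y))\<^sup>2) * (indicator {0<..} l * indicator {l. l < \<bar>w y\<bar>} l) \<partial>lborel \<partial>lborel)"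
    by (subst nn_integral_cmult) (simp_all add: layer_cake[symmetric] ennreal_mult mult.commute)
  also have "\<dots> = (\<integral>\<^sup>+l. \<integral>\<^sup>+y. ennreal ((cmod (f y))\<^sup>2) * (indicator {0<..} l * indicator {l. l < \<bar>w y\<bar>} l) \<partial>lborel \<partial>lborel)"
    by (rule lborel_pair.Fubini') measurable
  also have "\<dots> = (\<integral>\<^sup>+l. indicator {0<..} l * (\<integral>\<^sup>+y. indicator {y. \<bar>w y\<bar> > l} y * ennreal ((cmod (f y))\<^sup>2) \<partial>lborel) \<partial>lborel)"
  proof (rule nn_integral_cong)
    fix l :: real
    have "(\<integral>\<^sup>+y. ennreal ((cmod (f y))\<^sup>2) * (indicator {0<..} l * indicator {l. l < \<bar>w y\<bar>} l) \<partial>lborel)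
      = (\<integral>\<^sup>+y. indicator {0<..} l * (indicator {y. \<bar>w y\<bar> > l} y * ennreal ((cmod (f y))\<^sup>2)) \<partial>lborel)"
      by (intro nn_integral_cong) (simp add: indicator_def)
    also have "\<dots> = indicator {0<..} l * (\<integral>\<^sup>+y. indicator {y. \<bar>w y\<bar> > l} y * ennreal ((cmod (f y))\<^sup>2) \<partial>lborel)"
      by (rule nn_integral_cmult) measurable
    finally show "(\<integral>\<^sup>+y. ennreal ((cmod (f y))\<^sup>2) * (indicator {0<..} l * indicator {l. l < \<bar>w y\<bar>} l) \<partial>lborel)
      = indicator {0<..} l * (\<integral>\<^sup>+y. indicator {y. \<bar>w y\<bar> > l} y * ennreal ((cmod (f y))\<^sup>2) \<partial>lborel)" .
  qed
  finally show ?thesis .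
qed

text \<open>A Hardy type inequality. The mass of \<open>f\<close> on the superlevel set of \<open>w\<close> at height \<open>l\<close> is estimated
  with the frequency threshold \<open>l powr (1 / (2 * s))\<close>; integrated over \<open>l\<close>, the low and the high
  frequencies both contribute a multiple of the Sobolev norm.\<close>

lemma weak_Lp_form_bound:
  fixes w :: "'a::euclidean_space \<Rightarrow> real"
  assumes d: "DIM('a) \<ge> 3" and s: "0 < s" "s < 1" and w: "weak_Lp (real DIM('a) / (2 * s)) w"
  obtains K where "K \<ge> 0"
    "\<And>f g x. is_fourier_L2 f g \<Longrightarrow> (\<integral>\<^sup>+y. ennreal (\<bar>w (x - y)\<bar> * (cmod (f y))\<^sup>2) \<partial>lborel) \<le> ennreal K * sob_sq s g"
proof -
  define D where "D = real DIM('a)"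
  define p where "p = D / (2 * s)"
  have wm [measurable]: "w \<in> borel_measurable borel" using w by (simp add: weak_Lp_def)
  obtain C0 where C0: "\<And>l. l > 0 \<Longrightarrow> emeasure lborel {x. \<bar>w x\<bar> > l} \<le> ennreal (C0 / l powr p)"
    using w unfolding weak_Lp_def p_def D_def by blast
  \<comment> \<open>Made nonnegative so that products with it can be moved in and out of
    \<open>ennreal\<close>.\<close>
  define C where "C = max C0 0"
  have C: "emeasure lborel {x. \<bar>w x\<bar> > l} \<le> ennreal (C / l powr p)" if "l > 0" for l
    using C0[OF that] by (rule order_trans) (intro ennreal_leI divide_right_mono, auto simp: C_def)
  have Cn: "C \<ge> 0" by (simp add: C_def)
  obtain A where An: "A \<ge> 0" and A: "\<And>R. R > 0 \<Longrightarrow> (\<integral>\<^sup>+\<xi>. indicator {\<xi>::'a. jb \<xi> < R} \<xi> * ennreal (1 / (jb \<xi>)\<^sup>2) \<partial>lborel) \<le> ennreal (A * R powr (real DIM('a) - 2))"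
    using nn_integral_jb_inverse_square[OF d] by blast
  define q where "q = 1 / s"
  have q: "q > 1" using s by (simp add: q_def)
  \<comment> \<open>The first summand comes from the low frequencies, through the tail integral of
    \<open>l powr - q\<close>; the second from the high frequencies, through an interval of length
    \<open>jb \<xi> powr (2 * s)\<close>.\<close>
  define K where "K = 2 * C * A / (q - 1) + 2"
  have K: "K \<ge> 0" using Cn An q by (simp add: K_def)
  have "(\<integral>\<^sup>+y. ennreal (\<bar>w (x - y)\<bar> * (cmod (f y))\<^sup>2) \<partial>lborel) \<le> ennreal K * sob_sq s g" if fg: "is_fourier_L2 f g" for f g x
  proof -
    have [measurable]: "f \<in> borel_measurable borel" "g \<in> borel_measurable borel"
      using is_fourier_L2D[OF fg] sq_int_measurable by auto
    define H where "H l \<xi> = indicator {0<..} l * (ennreal (2 * C * A * l powr - q) * (indicator {\<xi>. jb \<xi> < l powr (1/(2 * s))} \<xi> * ennreal ((jb \<xi>)\<^sup>2 * (cmod (g \<xi>))\<^sup>2))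
        + 2 * (indicator {\<xi>. l powr (1/(2 * s)) \<le> jb \<xi>} \<xi> * ennreal ((cmod (g \<xi>))\<^sup>2)))" for l and \<xi> :: 'a
    have Hm: "(\<lambda>(l, \<xi>). H l \<xi>) \<in> borel_measurable (lborel \<Otimes>\<^sub>M lborel)" unfolding H_def by measurable
    have "(\<integral>\<^sup>+y. ennreal (\<bar>w (x - y)\<bar> * (cmod (f y))\<^sup>2) \<partial>lborel)
       = (\<integral>\<^sup>+l. indicator {0<..} l * (\<integral>\<^sup>+y. indicator {y. \<bar>w (x - y)\<bar> > l} y * ennreal ((cmod (f y))\<^sup>2) \<partial>lborel) \<partial>lborel)"
      by (rule layer_cake_mass) measurable
    also have "\<dots> \<le> (\<integral>\<^sup>+l. \<integral>\<^sup>+\<xi>. H l \<xi> \<partial>lborel \<partial>lborel)"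
    proof (rule nn_integral_mono)
      fix l :: real
      show "indicator {0<..} l * (\<integral>\<^sup>+y. indicator {y. \<bar>w (x - y)\<bar> > l} y * ennreal ((cmod (f y))\<^sup>2) \<partial>lborel) \<le> (\<integral>\<^sup>+\<xi>. H l \<xi> \<partial>lborel)"
      proof (cases "0 < l")
        case False
        then show ?thesis by simp
      next
        case l: True
        \<comment> \<open>With this threshold the measure bound \<open>l powr - p\<close> times
          \<open>R powr (D - 2)\<close> is \<open>l powr - q\<close> with \<open>q = 1 / s\<close>,
          which is integrable at infinity because \<open>s < 1\<close>.\<close>
        define R where "R = l powr (1/(2 * s))"
        have R: "R > 0" using l by (simp add: R_def)
        define L where "L = (\<integral>\<^sup>+\<xi>. indicator {\<xi>::'a. jb \<xi> < R} \<xi> * ennreal ((jb \<xi>)\<^sup>2 * (cmod (g \<xi>))\<^sup>2) \<partial>lborel)"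
        define U where "U = (\<integral>\<^sup>+\<xi>. indicator {\<xi>. R \<le> jb \<xi>} \<xi> * ennreal ((cmod (g \<xi>))\<^sup>2) \<partial>lborel)"
        have "(\<integral>\<^sup>+y. indicator {y. \<bar>w (x - y)\<bar> > l} y * ennreal ((cmod (f y))\<^sup>2) \<partial>lborel)
           \<le> 2 * emeasure lborel {y. \<bar>w (x - y)\<bar> > l} * (ennreal (A * R powr (real DIM('a) - 2)) * L) + 2 * U"
          unfolding L_def U_def by (rule L2_mass_on_set_bound[OF A fg R]) measurable
        also have "\<dots> \<le> 2 * ennreal (C / l powr p) * (ennreal (A * R powr (real DIM('a) - 2)) * L) + 2 * U"
          unfolding emeasure_superlevel_reflect[OF wm] by (intro add_mono mult_mono C l order_refl) auto
        also have "2 * ennreal (C / l powr p) * (ennreal (A * R powr (real DIM('a) - 2)) * L) = ennreal (2 * C * A * l powr - q) * L"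
        proof -
          have "R powr (real DIM('a) - 2) = l powr (p - q)"
            unfolding R_def powr_powr p_def q_def D_def using s by (intro arg_cong[where f="\<lambda>e. l powr e"]) (simp add: field_simps)
          then have "2 * (C / l powr p) * (A * R powr (real DIM('a) - 2)) = 2 * C * A * (l powr (p - q) / l powr p)"
            by simp
          also have "l powr (p - q) / l powr p = l powr - q" using l by (simp add: powr_diff[symmetric])
          finally have eq: "2 * (C / l powr p) * (A * R powr (real DIM('a) - 2)) = 2 * C * A * l powr - q" .
          have "2 * ennreal a * (ennreal b * L) = ennreal (2 * a * b) * L" if "0 \<le> a" "0 \<le> b" for a b
            using that by (simp add: ennreal_mult mult.assoc)
          then have "2 * ennreal (C / l powr p) * (ennreal (A * R powr (real DIM('a) - 2)) * L)
             = ennreal (2 * (C / l powr p) * (A * R powr (real DIM('a) - 2))) * L"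
            using Cn An by simp
          then show ?thesis unfolding eq .
        qed
        also have "ennreal (2 * C * A * l powr - q) * L + 2 * U = (\<integral>\<^sup>+\<xi>. H l \<xi> \<partial>lborel)"
          unfolding H_def L_def U_def R_def using l by (simp add: nn_integral_add nn_integral_cmult)
        finally show ?thesis using l by simp
      qed
    qed
    also have "\<dots> = (\<integral>\<^sup>+\<xi>. \<integral>\<^sup>+l. H l \<xi> \<partial>lborel \<partial>lborel)"
      by (rule lborel_pair.Fubini'[OF Hm, symmetric])
    also have "\<dots> \<le> (\<integral>\<^sup>+\<xi>. ennreal K * ennreal (jb \<xi> powr (2 * s) * (cmod (g \<xi>))\<^sup>2) \<partial>lborel)"
    proof (rule nn_integral_mono)
      fix \<xi> :: 'a
      \<comment> \<open>For fixed \<xi>, the level beyond which \<xi> counts as a low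
        frequency.\<close>
      define b where "b = jb \<xi> powr (2 * s)"
      have b: "b > 0" by (simp add: b_def)
      define G where "G = (cmod (g \<xi>))\<^sup>2"
      have G: "G \<ge> 0" by (simp add: G_def)
      have lb: "b powr (1/(2 * s)) = jb \<xi>" using s by (simp add: b_def powr_powr)
      have i1: "b \<le> l" if "0 < l" "jb \<xi> < l powr (1/(2 * s))" for l
      proof (rule ccontr)
        assume "\<not> b \<le> l"
        then have "l powr (1/(2 * s)) \<le> b powr (1/(2 * s))" using that s by (intro powr_mono2) auto
        then show False using that lb by simp
      qed
      have i2: "l \<le> b" if "0 < l" "l powr (1/(2 * s)) \<le> jb \<xi>" for l
      proof (rule ccontr)
        assume "\<not> l \<le> b"
        then have "b powr (1/(2 * s)) < l powr (1/(2 * s))" using b s by (intro powr_less_mono2) auto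
        then show False using that lb by simp
      qed
      have "(\<integral>\<^sup>+l. H l \<xi> \<partial>lborel) \<le> (\<integral>\<^sup>+l. ennreal (2 * C * A * (jb \<xi>)\<^sup>2 * G) * (indicator {b..} l * ennreal (l powr - q)) + ennreal (2 * G) * indicator {0..b} l \<partial>lborel)"
      proof (rule nn_integral_mono)
        fix l :: real
        show "H l \<xi> \<le> ennreal (2 * C * A * (jb \<xi>)\<^sup>2 * G) * (indicator {b..} l * ennreal (l powr - q)) + ennreal (2 * G) * indicator {0..b} l"
        proof (cases "0 < l")
          case False
          then show ?thesis by (simp add: H_def)
        next
          case l: True
          show ?thesis
          proof (cases "jb \<xi> < l powr (1/(2 * s))")
            case True
            have "ennreal (2 * C * A * l powr - q) * ennreal ((jb \<xi>)\<^sup>2 * G) = ennreal (2 * C * A * (jb \<xi>)\<^sup>2 * G) * ennreal (l powr - q)"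
              using Cn An G by (simp add: ennreal_mult[symmetric] mult_ac)
            then have "H l \<xi> = ennreal (2 * C * A * (jb \<xi>)\<^sup>2 * G) * ennreal (l powr - q)"
              using True l by (simp add: H_def G_def[symmetric])
            then show ?thesis using i1[OF l True] by (simp add: add_increasing2)
          next
            case False
            then have "H l \<xi> = ennreal (2 * G)" using l G by (simp add: H_def G_def[symmetric] ennreal_mult)
            then show ?thesis using i2[OF l] False l by (simp add: add_increasing)
          qed
        qed
      qed
      also have "\<dots> = ennreal (2 * C * A * (jb \<xi>)\<^sup>2 * G) * ennreal (b powr (1 - q) / (q - 1)) + ennreal (2 * G) * ennreal b"
        using b nn_integral_powr_tail[OF b q] by (subst nn_integral_add) (simp_all add: nn_integral_cmult)
      also have "\<dots> = ennreal (2 * C * A * (jb \<xi>)\<^sup>2 * G * (b powr (1 - q) / (q - 1)) + 2 * G * b)"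
      proof -
        have "0 \<le> b powr (1 - q) / (q - 1)" "0 \<le> 2 * C * A * (jb \<xi>)\<^sup>2 * G" "0 \<le> 2 * G" using q Cn An G by simp_all
        then show ?thesis using b by (simp only: ennreal_plus ennreal_mult mult_nonneg_nonneg less_imp_le)
      qed
      also have "2 * C * A * (jb \<xi>)\<^sup>2 * G * (b powr (1 - q) / (q - 1)) + 2 * G * b = K * (b * G)"
      proof -
        have "(jb \<xi>)\<^sup>2 * b powr (1 - q) = b"
        proof -
          have "(jb \<xi>)\<^sup>2 = jb \<xi> powr 2" by simp
          moreover have "b powr (1 - q) = jb \<xi> powr (2 * s - 2)"
            unfolding b_def powr_powr q_def using s by (intro arg_cong[where f="\<lambda>e. jb \<xi> powr e"]) (simp add: field_simps)
          ultimately have "(jb \<xi>)\<^sup>2 * b powr (1 - q) = jb \<xi> powr 2 * jb \<xi> powr (2 * s - 2)" by (simp only:)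
          also have "\<dots> = b" unfolding b_def powr_add[symmetric] by simp
          finally show ?thesis .
        qed
        moreover have "2 * C * A * J * G * (B / (q - 1)) = 2 * C * A / (q - 1) * (J * B * G)" for J B
          by simp
        ultimately have "2 * C * A * (jb \<xi>)\<^sup>2 * G * (b powr (1 - q) / (q - 1)) = 2 * C * A / (q - 1) * (b * G)"
          by (simp only:)
        then show ?thesis unfolding K_def by (simp add: distrib_right)
      qed
      also have "ennreal (K * (b * G)) = ennreal K * ennreal (b * G)" using K b G by (simp add: ennreal_mult)
      finally show "(\<integral>\<^sup>+l. H l \<xi> \<partial>lborel) \<le> ennreal K * ennreal (jb \<xi> powr (2 * s) * (cmod (g \<xi>))\<^sup>2)"
        unfolding b_def G_def .
    qed
    also have "\<dots> = ennreal K * sob_sq s g"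
      unfolding sob_sq_def by (rule nn_integral_cmult) measurable
    finally show ?thesis .
  qed
  with K that show thesis by blast
qed

lemma L_inf_form_bound:
  fixes w :: "'a::euclidean_space \<Rightarrow> real"
  assumes w: "L_inf w" and s: "0 \<le> s"
  obtains K where "K \<ge> 0"
    "\<And>f g x. is_fourier_L2 f g \<Longrightarrow> (\<integral>\<^sup>+y. ennreal (\<bar>w (x - y)\<bar> * (cmod (f y))\<^sup>2) \<partial>lborel) \<le> ennreal K * sob_sq s g"
proof -
  have wm [measurable]: "w \<in> borel_measurable borel" using w by (simp add: L_inf_def)
  obtain C where C: "AE x in lborel. \<bar>w x\<bar> \<le> C" using w by (auto simp: L_inf_def)
  define K where "K = max C 0"
  have "(\<integral>\<^sup>+y. ennreal (\<bar>w (x - y)\<bar> * (cmod (f y))\<^sup>2) \<partial>lborel) \<le> ennreal K * sob_sq s g" if fg: "is_fourier_L2 f g" for f g x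
  proof -
    have [measurable]: "f \<in> borel_measurable borel" using is_fourier_L2D[OF fg] sq_int_measurable by auto
    have "AE x in lborel. \<not> \<bar>w x\<bar> > K" using C by eventually_elim (simp add: K_def)
    then have "emeasure lborel {y. \<bar>w y\<bar> > K} = 0" by (subst (asm) AE_iff_measurable[OF _ refl]) auto
    then have "emeasure lborel {y. \<bar>w (x - y)\<bar> > K} = 0" by (simp add: emeasure_superlevel_reflect)
    then have "AE y in lborel. \<not> \<bar>w (x - y)\<bar> > K" by (subst AE_iff_measurable[OF _ refl]) auto
    then have "(\<integral>\<^sup>+y. ennreal (\<bar>w (x - y)\<bar> * (cmod (f y))\<^sup>2) \<partial>lborel) \<le> (\<integral>\<^sup>+y. ennreal K * ennreal ((cmod (f y))\<^sup>2) \<partial>lborel)"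
    proof (intro nn_integral_mono_AE, eventually_elim)
      case (elim y)
      then have "\<bar>w (x - y)\<bar> * (cmod (f y))\<^sup>2 \<le> K * (cmod (f y))\<^sup>2" by (intro mult_right_mono) auto
      then show ?case using ennreal_leI by (simp add: ennreal_mult[symmetric] K_def)
    qed
    also have "\<dots> = ennreal K * L2_sq f" unfolding L2_sq_lborel by (rule nn_integral_cmult) measurable
    also have "L2_sq f = L2_sq g"
      using is_fourier_L2D(1,2)[OF fg] is_fourier_L2_norm[OF fg] by (simp add: L2_sq_eq_norm)
    also have "ennreal K * L2_sq g \<le> ennreal K * sob_sq s g" by (intro mult_left_mono sob_sq_ge s) simp
    finally show ?thesis .
  qed
  then show thesis using that[of K] by (simp add: K_def)
qed

text \<open>For \<open>s < 1\<close> and dimension at least 3 the exponent is below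
  \<open>d / 2\<close>, so the measure parts vanish, and the form bounds for the weak and the
  bounded part hold uniformly in \<open>x\<close>.\<close>

lemma pot_conv_bound:
  fixes w :: "'a::euclidean_space \<Rightarrow> real"
  assumes d: "DIM('a) \<ge> 3" and s: "0 \<le> s" "s < 1" and w: "W_class s mp mm w"
  obtains K where "K \<ge> 0"
    "\<And>f g x. is_fourier_L2 f g \<Longrightarrow> in_sob s g \<Longrightarrow> \<bar>pot_conv mp mm w (\<lambda>y. (cmod (f y))\<^sup>2) x\<bar> \<le> K * enn2real (sob_sq s g)"
proof -
  have sd: "s < real DIM('a) / 2" using d s by simp
  have null: "mp = null_measure borel" "mm = null_measure borel"
    and wc: "if s = 0 then L_inf w else sum_space (weak_Lp (real DIM('a) / (2 * s))) L_inf w"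
    using w sd unfolding W_class_def by auto
  obtain K where K: "K \<ge> 0" and bound: "\<And>f g x. is_fourier_L2 f g \<Longrightarrow>
      (\<integral>\<^sup>+y. ennreal (\<bar>w (x - y)\<bar> * (cmod (f y))\<^sup>2) \<partial>lborel) \<le> ennreal K * sob_sq s g"
  proof (cases "s = 0")
    case True
    then show thesis using wc L_inf_form_bound[of w s] that by auto
  next
    case False
    then obtain w1 w2 where w1: "weak_Lp (real DIM('a) / (2 * s)) w1" and w2: "L_inf w2" and w12: "w = (\<lambda>x. w1 x + w2 x)"
      using wc unfolding sum_space_def by auto
    have [measurable]: "w1 \<in> borel_measurable borel" "w2 \<in> borel_measurable borel"
      using w1 w2 by (auto simp: weak_Lp_def L_inf_def)
    obtain K1 where K1: "K1 \<ge> 0" "\<And>f g x. is_fourier_L2 f g \<Longrightarrow>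
      (\<integral>\<^sup>+y. ennreal (\<bar>w1 (x - y)\<bar> * (cmod (f y))\<^sup>2) \<partial>lborel) \<le> ennreal K1 * sob_sq s g"
      using weak_Lp_form_bound[OF d _ s(2) w1] False s by (metis less_eq_real_def)
    obtain K2 where K2: "K2 \<ge> 0" "\<And>f g x. is_fourier_L2 f g \<Longrightarrow>
      (\<integral>\<^sup>+y. ennreal (\<bar>w2 (x - y)\<bar> * (cmod (f y))\<^sup>2) \<partial>lborel) \<le> ennreal K2 * sob_sq s g"
      using L_inf_form_bound[OF w2 s(1)] by blast
    have "(\<integral>\<^sup>+y. ennreal (\<bar>w (x - y)\<bar> * (cmod (f y))\<^sup>2) \<partial>lborel) \<le> ennreal (K1 + K2) * sob_sq s g" if fg: "is_fourier_L2 f g" for f g x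
    proof -
      have [measurable]: "f \<in> borel_measurable borel" using is_fourier_L2D[OF fg] sq_int_measurable by auto
      have "(\<integral>\<^sup>+y. ennreal (\<bar>w (x - y)\<bar> * (cmod (f y))\<^sup>2) \<partial>lborel)
         \<le> (\<integral>\<^sup>+y. ennreal (\<bar>w1 (x - y)\<bar> * (cmod (f y))\<^sup>2) + ennreal (\<bar>w2 (x - y)\<bar> * (cmod (f y))\<^sup>2) \<partial>lborel)"
      proof (rule nn_integral_mono)
        fix y
        have "\<bar>w (x - y)\<bar> * (cmod (f y))\<^sup>2 \<le> (\<bar>w1 (x - y)\<bar> + \<bar>w2 (x - y)\<bar>) * (cmod (f y))\<^sup>2"
          unfolding w12 by (intro mult_right_mono abs_triangle_ineq) simp
        from ennreal_leI[OF this]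
        show "ennreal (\<bar>w (x - y)\<bar> * (cmod (f y))\<^sup>2) \<le> ennreal (\<bar>w1 (x - y)\<bar> * (cmod (f y))\<^sup>2) + ennreal (\<bar>w2 (x - y)\<bar> * (cmod (f y))\<^sup>2)"
          by (simp add: distrib_right)
      qed
      also have "\<dots> = (\<integral>\<^sup>+y. ennreal (\<bar>w1 (x - y)\<bar> * (cmod (f y))\<^sup>2) \<partial>lborel) + (\<integral>\<^sup>+y. ennreal (\<bar>w2 (x - y)\<bar> * (cmod (f y))\<^sup>2) \<partial>lborel)"
        by (rule nn_integral_add) measurable
      also have "\<dots> \<le> ennreal K1 * sob_sq s g + ennreal K2 * sob_sq s g" by (intro add_mono K1 K2 fg)
      also have "\<dots> = ennreal (K1 + K2) * sob_sq s g" using K1 K2 by (simp add: distrib_right)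
      finally show ?thesis .
    qed
    then show thesis using that[of "K1 + K2"] K1(1) K2(1) by auto
  qed
  have "\<bar>pot_conv mp mm w (\<lambda>y. (cmod (f y))\<^sup>2) x\<bar> \<le> K * enn2real (sob_sq s g)" if fg: "is_fourier_L2 f g" and g: "in_sob s g" for f g x
  proof -
    have z: "(\<integral>y. h y \<partial>null_measure borel) = (0::real)" for h :: "'a \<Rightarrow> real"
      by (rule integral_eq_zero_AE, rule AE_I[where N=UNIV]) auto
    have eq: "pot_conv mp mm w (\<lambda>y. (cmod (f y))\<^sup>2) x = (\<integral>y. w (x - y) * (cmod (f y))\<^sup>2 \<partial>lborel)"
      by (simp add: pot_conv_def null z)
    have fin: "sob_sq s g < \<infinity>" using g by (simp add: in_sob_def)
    show ?thesis
    \<comment> \<open>If the integrand is not integrable, its Bochner integral is 0 by convention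
      and the bound is trivial.\<close>
    proof (cases "integrable lborel (\<lambda>y. w (x - y) * (cmod (f y))\<^sup>2)")
      case False
      then show ?thesis unfolding eq using K by (simp add: not_integrable_integral_eq)
    next
      case True
      have "ennreal \<bar>\<integral>y. w (x - y) * (cmod (f y))\<^sup>2 \<partial>lborel\<bar> \<le> (\<integral>\<^sup>+y. ennreal (norm (w (x - y) * (cmod (f y))\<^sup>2)) \<partial>lborel)"
        using integral_norm_bound_ennreal[OF True] by simp
      also have "\<dots> = (\<integral>\<^sup>+y. ennreal (\<bar>w (x - y)\<bar> * (cmod (f y))\<^sup>2) \<partial>lborel)" by (simp add: abs_mult)
      also have "\<dots> \<le> ennreal K * sob_sq s g" by (rule bound[OF fg])
      also have "\<dots> = ennreal (K * enn2real (sob_sq s g))" using fin K by (simp add: ennreal_mult)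
      finally show ?thesis unfolding eq using K by (subst (asm) ennreal_le_iff) auto
    qed
  qed
  with K that show thesis by blast
qed

subsection \<open>Growth of the weighted mass along the flow\<close>

text \<open>With a slack of slope \<open>e\<close>, the inequality holds on a compact set containing
  \<open>a\<close>. The last point of this set cannot lie before \<open>b\<close>, because the Dini
  condition pushes it further to the right.\<close>

lemma dini_nonincreasing:
  fixes f :: "real \<Rightarrow> real"
  assumes ab: "a \<le> b" and cont: "continuous_on {a..b} f"
    and dini: "\<And>x e. a \<le> x \<Longrightarrow> x < b \<Longrightarrow> e > 0 \<Longrightarrow> \<forall>\<^sub>F k in at_right 0. f (x + k) \<le> f x + e * k"
  shows "f b \<le> f a"
proof (rule field_le_epsilon)
  fix e' :: real assume e': "e' > 0"
  \<comment> \<open>The \<open>+ 1\<close> avoids a division by zero when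
    \<open>a = b\<close>.\<close>
  define e where "e = e' / (b - a + 1)"
  have e: "e > 0" "e * (b - a) \<le> e'"
    using e' ab by (simp_all add: e_def field_simps)
  define g where "g x = f x - f a - e * (x - a)" for x
  have contg: "continuous_on {a..b} g" unfolding g_def by (intro continuous_intros cont)
  define S where "S = {x \<in> {a..b}. g x \<le> 0}"
  have "closed S" unfolding S_def
    by (rule continuous_on_closed_Collect_le[OF contg continuous_on_const]) simp
  moreover have "bounded S" by (rule bounded_subset[OF bounded_closed_interval[of a b]]) (auto simp: S_def)
  ultimately have "compact S" by (simp add: compact_eq_bounded_closed)
  moreover have "a \<in> S" using ab by (simp add: S_def g_def)
  ultimately obtain c where c: "c \<in> S" "\<And>x. x \<in> S \<Longrightarrow> x \<le> c"
    using compact_attains_sup[of S] by blast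
  have "c = b"
  proof (rule ccontr)
    assume "c \<noteq> b"
    then have cb: "a \<le> c" "c < b" using c(1) by (auto simp: S_def)
    have "\<forall>\<^sub>F k in at_right 0. k < b - c" using cb by (intro eventually_at_right_less[THEN eventually_mono] order_tendstoD tendsto_ident_at) auto
    moreover have "\<forall>\<^sub>F k in at_right 0. (0::real) < k" by (rule eventually_at_right_less)
    ultimately have "\<forall>\<^sub>F k in at_right 0. 0 < k \<and> k < b - c \<and> f (c + k) \<le> f c + e * k"
      using dini[OF cb e(1)] by eventually_elim simp
    then obtain k where k: "0 < k" "k < b - c" "f (c + k) \<le> f c + e * k"
      using eventually_happens'[of "at_right (0::real)"] by auto
    have "g (c + k) \<le> g c" using k by (simp add: g_def algebra_simps)
    also have "\<dots> \<le> 0" using c(1) by (simp add: S_def)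
    finally have "c + k \<in> S" using k cb by (simp add: S_def)
    then show False using c(2) k by fastforce
  qed
  then have "g b \<le> 0" using c(1) by (simp add: S_def)
  then show "f b \<le> f a + e'" using e by (simp add: g_def)
qed

lemma L2_norm_ball_le:
  fixes f :: "'a::euclidean_space \<Rightarrow> complex"
  assumes "sq_int f"
  shows "L2_norm (\<lambda>x. indicator (ball 0 K) x * f x) \<le> L2_norm f"
proof -
  have "(indicator (ball 0 K) :: 'a \<Rightarrow> complex) \<in> borel_measurable borel" by (intro borel_measurable_indicator) auto
  from L2_norm_mult_bounded[OF assms this, of 1] show ?thesis by (simp add: indicator_def)
qed

lemma L2_norm_le_of_balls:
  fixes f :: "'a::euclidean_space \<Rightarrow> complex"
  assumes f: "sq_int f" and le: "\<And>K. L2_norm (\<lambda>x. indicator (ball 0 K) x * f x) \<le> C"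
  shows "L2_norm f \<le> C"
proof (rule tendsto_upperbound)
  show "((\<lambda>K. L2_norm (\<lambda>x. indicator (ball 0 K) x * f x)) \<longlongrightarrow> L2_norm f) at_top"
    by (intro L2_norm_tendsto truncate_sq_int f L2_norm_truncate_tendsto)
qed (use le in auto)

section \<open>The free phase and flows driven by a real potential\<close>

definition phase :: "real \<Rightarrow> 'a::euclidean_space \<Rightarrow> complex" where
  "phase h \<xi> = exp (- \<i> * complex_of_real (h * jb \<xi>))"

lemma phase_measurable [measurable]: "phase h \<in> borel_measurable borel"
  unfolding phase_def[abs_def] by measurable

lemma cmod_phase [simp]: "cmod (phase h \<xi>) = 1"
  by (simp add: phase_def)

lemma phase_0 [simp]: "phase 0 \<xi> = 1"
  by (simp add: phase_def)

lemma phase_add: "phase (h + k) \<xi> = phase k \<xi> * phase h \<xi>"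
  by (simp add: phase_def exp_add[symmetric] algebra_simps)

lemma sq_int_phase: "sq_int f \<Longrightarrow> sq_int (\<lambda>\<xi>. phase h \<xi> * f \<xi>)"
  by (rule sq_int_mult_bounded[where C=1]) auto

lemma L2_norm_phase: "L2_norm (\<lambda>\<xi>. phase h \<xi> * f \<xi>) = L2_norm f"
  by (rule L2_norm_cong) (simp add: norm_mult)

lemma phase_tendsto:
  assumes f: "sq_int f"
  shows "((\<lambda>h. L2_norm (\<lambda>\<xi>. phase h \<xi> * f \<xi> - phase h0 \<xi> * f \<xi>)) \<longlongrightarrow> 0) (at h0 within S)"
proof (subst tendsto_at_iff_sequentially, intro allI impI)
  fix X :: "nat \<Rightarrow> real" assume X: "\<forall>i. X i \<in> S - {h0}" "X \<longlonglongrightarrow> h0"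
  have "(\<lambda>n. L2_norm (\<lambda>\<xi>. phase (X n) \<xi> * f \<xi> - phase h0 \<xi> * f \<xi>)) \<longlonglongrightarrow> 0"
  proof (rule L2_mult_convergence[OF f, where C=1])
    show "(\<lambda>n. phase (X n) \<xi>) \<longlonglongrightarrow> phase h0 \<xi>" for \<xi> :: 'a
      unfolding phase_def by (intro tendsto_intros X)
  qed simp_all
  then show "((\<lambda>h. L2_norm (\<lambda>\<xi>. phase h \<xi> * f \<xi> - phase h0 \<xi> * f \<xi>)) \<circ> X) \<longlonglongrightarrow> 0" by (simp add: o_def)
qed

text \<open>Isolates what the growth estimate uses about a solution: the nonlinear structure is
  forgotten, and only a real potential \<open>V\<close> remains, with \<open>N\<close> the transform
  of \<open>V\<close> times \<psi>. The clause \<open>generator\<close> is the equation relative to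
  the free evolution, read on frequency balls, since the derivative converges only in
  H^(s-1).\<close>

locale regular_flow =
  fixes T :: ereal and \<psi> \<Psi> N :: "real \<Rightarrow> 'a::euclidean_space \<Rightarrow> complex" and V :: "real \<Rightarrow> 'a \<Rightarrow> real"
  assumes fourier: "\<And>t. 0 \<le> t \<Longrightarrow> ereal t < T \<Longrightarrow> is_fourier_L2 (\<psi> t) (\<Psi> t)"
    and fourier_N: "\<And>t. 0 \<le> t \<Longrightarrow> ereal t < T \<Longrightarrow> is_fourier_L2 (\<lambda>x. complex_of_real (V t x) * \<psi> t x) (N t)"
    and cont: "\<And>t. 0 \<le> t \<Longrightarrow> ereal t < T \<Longrightarrow>
      ((\<lambda>\<tau>. L2_norm (\<lambda>\<xi>. \<Psi> \<tau> \<xi> - \<Psi> t \<xi>)) \<longlongrightarrow> 0) (at t within {t. 0 \<le> t \<and> ereal t < T})"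
    and locally_bounded: "\<And>t. 0 \<le> t \<Longrightarrow> ereal t < T \<Longrightarrow>
      \<exists>B. \<forall>\<^sub>F \<tau> in at t within {t. 0 \<le> t \<and> ereal t < T}. L2_norm (N \<tau>) \<le> B"
    and generator: "\<And>t K. 0 \<le> t \<Longrightarrow> ereal t < T \<Longrightarrow>
      ((\<lambda>k. L2_norm (\<lambda>\<xi>. indicator (ball 0 K) \<xi> *
        ((\<Psi> (t + k) \<xi> - phase k \<xi> * \<Psi> t \<xi>) / complex_of_real k + \<i> * N t \<xi>))) \<longlongrightarrow> 0) (at_right 0)"
begin

lemma eventually_time:
  assumes "0 \<le> t" "ereal t < T" shows "\<forall>\<^sub>F k in at_right 0. 0 < k \<and> ereal (t + k) < T"
proof -
  have "((\<lambda>k. ereal (t + k)) \<longlongrightarrow> ereal (t + 0)) (at_right 0)" by (intro tendsto_intros)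
  then have "\<forall>\<^sub>F k in at_right 0. ereal (t + k) < T" by (rule order_tendstoD) (use assms in simp)
  moreover have "\<forall>\<^sub>F k in at_right 0. (0::real) < k" by (rule eventually_at_right_less)
  ultimately show ?thesis by eventually_elim simp
qed

lemma sq_int_flow:
  assumes "0 \<le> t" "ereal t < T"
  shows "sq_int (\<psi> t)" "sq_int (\<Psi> t)" "sq_int (N t)" "sq_int (\<lambda>x. complex_of_real (V t x) * \<psi> t x)"
  using is_fourier_L2D[OF fourier[OF assms]] is_fourier_L2D[OF fourier_N[OF assms]] by auto

lemma truncated_step:
  assumes t: "0 \<le> t" "ereal t < T" and e: "e > 0"
  shows "\<forall>\<^sub>F k in at_right 0. L2_norm (\<lambda>\<xi>. indicator (ball 0 K) \<xi> *
      (\<Psi> (t + k) \<xi> - phase k \<xi> * \<Psi> t \<xi> + \<i> * complex_of_real k * N t \<xi>)) \<le> e * k"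
proof -
  have "\<forall>\<^sub>F k in at_right 0. L2_norm (\<lambda>\<xi>. indicator (ball 0 K) \<xi> *
        ((\<Psi> (t + k) \<xi> - phase k \<xi> * \<Psi> t \<xi>) / complex_of_real k + \<i> * N t \<xi>)) < e"
    by (rule order_tendstoD[OF generator[OF t]]) (rule e)
  with eventually_time[OF t] show ?thesis
  proof eventually_elim
    case (elim k)
    then have k: "0 < k" "0 \<le> t + k" "ereal (t + k) < T" using t by auto
    define f where "f \<xi> = indicator (ball 0 K) \<xi> *
        ((\<Psi> (t + k) \<xi> - phase k \<xi> * \<Psi> t \<xi>) / complex_of_real k + \<i> * N t \<xi>)" for \<xi>
    have "sq_int f"
    proof -
      have "sq_int (\<lambda>\<xi>. (1 / complex_of_real k) * (\<Psi> (t + k) \<xi> - phase k \<xi> * \<Psi> t \<xi>) + \<i> * N t \<xi>)"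
        by (intro sq_int_add sq_int_scale sq_int_diff sq_int_phase sq_int_flow t k)
      from truncate_sq_int[OF this, of K] show ?thesis by (simp add: f_def[abs_def])
    qed
    then have "L2_norm (\<lambda>\<xi>. complex_of_real k * f \<xi>) = k * L2_norm f" using k by (simp add: L2_norm_scale)
    also have "\<dots> \<le> k * e" using elim k by (intro mult_left_mono) (simp_all add: f_def[abs_def])
    also have "(\<lambda>\<xi>. complex_of_real k * f \<xi>) = (\<lambda>\<xi>. indicator (ball 0 K) \<xi> *
      (\<Psi> (t + k) \<xi> - phase k \<xi> * \<Psi> t \<xi> + \<i> * complex_of_real k * N t \<xi>))"
      using k by (simp add: f_def fun_eq_iff field_simps)
    finally show ?case by (simp add: mult.commute)
  qed
qed

text \<open>Duhamel's formula as an inequality: on each frequency ball the distance from the free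
  evolution is continuous in time and has upper Dini derivative at most \<open>B\<close>. As
  \<open>B\<close> does not depend on the ball, the bound passes to all frequencies.\<close>

lemma remainder_bound:
  assumes t: "0 \<le> t" "ereal t < T"
  obtains B where "B \<ge> 0" "\<forall>\<^sub>F h in at_right 0. L2_norm (\<lambda>\<xi>. \<Psi> (t + h) \<xi> - phase h \<xi> * \<Psi> t \<xi>) \<le> B * h"
proof -
  let ?I = "{t. 0 \<le> t \<and> ereal t < T}"
  obtain B0 where "\<forall>\<^sub>F \<tau> in at t within ?I. L2_norm (N \<tau>) \<le> B0" using locally_bounded[OF t] by blast
  then obtain d where d: "d > 0" "\<And>\<tau>. \<tau> \<in> ?I \<Longrightarrow> \<tau> \<noteq> t \<Longrightarrow> dist \<tau> t < d \<Longrightarrow> L2_norm (N \<tau>) \<le> B0"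
    unfolding eventually_at by blast
  \<comment> \<open>The filter \<open>at t within\<close> excludes \<open>t\<close> itself, hence
    the separate value \<open>L2_norm (N t)\<close>.\<close>
  define B where "B = max B0 (L2_norm (N t))"
  have B0: "B \<ge> 0" using L2_norm_nonneg[of "N t"] by (simp add: B_def del: L2_norm_nonneg)
  have B: "L2_norm (N \<tau>) \<le> B" if "\<tau> \<in> ?I" "dist \<tau> t < d" for \<tau>
    using d(2)[OF that(1) _ that(2)] by (cases "\<tau> = t") (auto simp: B_def)
  have main: "L2_norm (\<lambda>\<xi>. \<Psi> (t + h) \<xi> - phase h \<xi> * \<Psi> t \<xi>) \<le> B * h"
    if h: "0 < h" "h < d" "ereal (t + h) < T" for h
  proof (rule L2_norm_le_of_balls)
    have I: "0 \<le> t + y" "ereal (t + y) < T" if "0 \<le> y" "y \<le> h" for y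
      using that t h le_less_trans[of "ereal (t + y)" "ereal (t + h)" T] by auto
    show "sq_int (\<lambda>\<xi>. \<Psi> (t + h) \<xi> - phase h \<xi> * \<Psi> t \<xi>)"
      using I[of h] h t by (intro sq_int_diff sq_int_phase sq_int_flow) auto
    fix K
    define D where "D y = L2_norm (\<lambda>\<xi>. indicator (ball 0 K) \<xi> * (\<Psi> (t + y) \<xi> - phase y \<xi> * \<Psi> t \<xi>))" for y
    have sqR: "sq_int (\<lambda>\<xi>. \<Psi> (t + y) \<xi> - phase y \<xi> * \<Psi> t \<xi>)" if "0 \<le> y" "y \<le> h" for y
      by (intro sq_int_diff sq_int_phase sq_int_flow t I that)
    have "D h - B * h \<le> D 0 - B * 0"
    proof (rule dini_nonincreasing[where f="\<lambda>y. D y - B * y"])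
      show "0 \<le> h" using h by simp
      show "continuous_on {0..h} (\<lambda>y. D y - B * y)"
      proof (intro continuous_intros)
        show "continuous_on {0..h} D"
          unfolding continuous_on_def
        proof (rule ballI)
          fix y assume y: "y \<in> {0..h}"
          have "((\<lambda>y'. L2_norm (\<lambda>\<xi>. \<Psi> (t + y') \<xi> - \<Psi> (t + y) \<xi>)) \<longlongrightarrow> 0) (at y within {0..h})"
          proof (rule filterlim_compose[OF cont])
            show "0 \<le> t + y" "ereal (t + y) < T" using I[of y] y by auto
            show "filterlim (\<lambda>y'. t + y') (at (t + y) within ?I) (at y within {0..h})"
              unfolding filterlim_at
              using I by (auto intro!: tendsto_intros simp: eventually_at_filter)
          qed
          from tendsto_add[OF this phase_tendsto[OF sq_int_flow(2)[OF t], of y "{0..h}"]]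
          have lim: "((\<lambda>y'. L2_norm (\<lambda>\<xi>. \<Psi> (t + y') \<xi> - \<Psi> (t + y) \<xi>) + L2_norm (\<lambda>\<xi>. phase y' \<xi> * \<Psi> t \<xi> - phase y \<xi> * \<Psi> t \<xi>)) \<longlongrightarrow> 0) (at y within {0..h})"
            by simp
          show "(D \<longlongrightarrow> D y) (at y within {0..h})"
          proof (rule LIM_zero_cancel, rule Lim_null_comparison[OF _ lim])
            have "norm (D y' - D y) \<le> L2_norm (\<lambda>\<xi>. \<Psi> (t + y') \<xi> - \<Psi> (t + y) \<xi>) + L2_norm (\<lambda>\<xi>. phase y' \<xi> * \<Psi> t \<xi> - phase y \<xi> * \<Psi> t \<xi>)"
              if y': "y' \<in> {0..h}" for y'
            proof -
              have s: "sq_int (\<Psi> (t + y'))" "sq_int (\<Psi> (t + y))" using I[of y] I[of y'] y y' by (auto intro: sq_int_flow)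
              have p: "sq_int (\<lambda>\<xi>. phase z \<xi> * \<Psi> t \<xi>)" for z by (intro sq_int_phase sq_int_flow t)
              have "norm (D y' - D y) \<le> L2_norm (\<lambda>\<xi>. indicator (ball 0 K) \<xi> * (\<Psi> (t + y') \<xi> - phase y' \<xi> * \<Psi> t \<xi>) - indicator (ball 0 K) \<xi> * (\<Psi> (t + y) \<xi> - phase y \<xi> * \<Psi> t \<xi>))"
                unfolding D_def real_norm_def by (intro L2_norm_diff_le truncate_sq_int sq_int_diff s p)
              also have "\<dots> = L2_norm (\<lambda>\<xi>. indicator (ball 0 K) \<xi> * ((\<Psi> (t + y') \<xi> - \<Psi> (t + y) \<xi>) - (phase y' \<xi> * \<Psi> t \<xi> - phase y \<xi> * \<Psi> t \<xi>)))"
                by (rule L2_norm_cong) (simp add: algebra_simps)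
              also have "\<dots> \<le> L2_norm (\<lambda>\<xi>. (\<Psi> (t + y') \<xi> - \<Psi> (t + y) \<xi>) - (phase y' \<xi> * \<Psi> t \<xi> - phase y \<xi> * \<Psi> t \<xi>))"
                by (intro L2_norm_ball_le sq_int_diff s p)
              also have "\<dots> \<le> L2_norm (\<lambda>\<xi>. \<Psi> (t + y') \<xi> - \<Psi> (t + y) \<xi>) + L2_norm (\<lambda>\<xi>. phase y' \<xi> * \<Psi> t \<xi> - phase y \<xi> * \<Psi> t \<xi>)"
                by (intro L2_norm_triangle_diff sq_int_diff s p)
              finally show ?thesis .
            qed
            then show "\<forall>\<^sub>F y' in at y within {0..h}. norm (D y' - D y) \<le> L2_norm (\<lambda>\<xi>. \<Psi> (t + y') \<xi> - \<Psi> (t + y) \<xi>) + L2_norm (\<lambda>\<xi>. phase y' \<xi> * \<Psi> t \<xi> - phase y \<xi> * \<Psi> t \<xi>)"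
              by (simp add: eventually_at_filter)
          qed
        qed
      qed
      fix y e :: real assume y: "0 \<le> y" "y < h" and e: "e > 0"
      have ty: "0 \<le> t + y" "ereal (t + y) < T" using I[of y] y by auto
      have "\<forall>\<^sub>F k in at_right 0. k < h - y" using y by (intro order_tendstoD(2)[OF tendsto_ident_at]) auto
      with truncated_step[OF ty e, of K] eventually_time[OF ty]
      show "\<forall>\<^sub>F k in at_right 0. D (y + k) - B * (y + k) \<le> D y - B * y + e * k"
      proof eventually_elim
        case (elim k)
        then have k: "0 < k" "k < h - y" by auto
        have s: "sq_int (\<Psi> (t + y + k))" "sq_int (\<Psi> (t + y))" "sq_int (N (t + y))" "sq_int (\<Psi> t)"
          using I[of "y + k"] k y ty t by (auto intro: sq_int_flow simp: add.assoc)
        \<comment> \<open>By the group law the new difference is \<open>a - b + c\<close>: the error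
          \<open>a\<close> of one truncated step, the source \<open>b\<close> of size
          \<open>k\<close> times the nonlinearity, and the old difference transported by a unitary
          phase in \<open>c\<close>.\<close>
        define a where "a \<xi> = indicator (ball 0 K) \<xi> * (\<Psi> (t + y + k) \<xi> - phase k \<xi> * \<Psi> (t + y) \<xi> + \<i> * complex_of_real k * N (t + y) \<xi>)" for \<xi>
        define b where "b \<xi> = indicator (ball 0 K) \<xi> * (\<i> * complex_of_real k * N (t + y) \<xi>)" for \<xi>
        define c where "c \<xi> = phase k \<xi> * (indicator (ball 0 K) \<xi> * (\<Psi> (t + y) \<xi> - phase y \<xi> * \<Psi> t \<xi>))" for \<xi>
        have sqa: "sq_int a" unfolding a_def by (intro truncate_sq_int sq_int_add sq_int_diff sq_int_scale sq_int_phase s)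
        have sqb: "sq_int b" unfolding b_def by (intro truncate_sq_int sq_int_scale s)
        have sqc: "sq_int c" unfolding c_def by (intro sq_int_phase truncate_sq_int sq_int_diff s)
        have "D (y + k) = L2_norm (\<lambda>\<xi>. (a \<xi> - b \<xi>) + c \<xi>)"
          unfolding D_def a_def b_def c_def
          by (rule L2_norm_cong) (simp add: phase_add algebra_simps)
        also have "\<dots> \<le> L2_norm (\<lambda>\<xi>. a \<xi> - b \<xi>) + L2_norm c"
          by (intro L2_norm_triangle sq_int_diff sqa sqb sqc)
        also have "L2_norm (\<lambda>\<xi>. a \<xi> - b \<xi>) \<le> L2_norm a + L2_norm b" by (intro L2_norm_triangle_diff sqa sqb)
        also have "L2_norm a \<le> e * k" using elim by (simp add: a_def[abs_def])
        also have "L2_norm b \<le> L2_norm (\<lambda>\<xi>. (\<i> * complex_of_real k) * N (t + y) \<xi>)"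
          unfolding b_def by (intro L2_norm_ball_le sq_int_scale s)
        also have "\<dots> = k * L2_norm (N (t + y))" using k by (simp add: L2_norm_scale[OF s(3)] norm_mult)
        also have "\<dots> \<le> k * B" using k y ty h by (intro mult_left_mono B) (auto simp: dist_real_def)
        also have "L2_norm c = D y" unfolding c_def D_def L2_norm_phase ..
        finally show ?case by (simp add: algebra_simps)
      qed
    qed
    moreover have "D 0 = 0" by (simp add: D_def L2_norm_eq)
    ultimately show "L2_norm (\<lambda>\<xi>. indicator (ball 0 K) \<xi> * (\<Psi> (t + h) \<xi> - phase h \<xi> * \<Psi> t \<xi>)) \<le> B * h"
      by (simp add: D_def)
  qed
  have "\<forall>\<^sub>F h in at_right 0. h < d" using d(1) by (intro order_tendstoD(2)[OF tendsto_ident_at]) auto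
  with eventually_time[OF t] have "\<forall>\<^sub>F h in at_right 0. L2_norm (\<lambda>\<xi>. \<Psi> (t + h) \<xi> - phase h \<xi> * \<Psi> t \<xi>) \<le> B * h"
    by eventually_elim (auto intro: main)
  with B0 that show thesis by blast
qed

end

lemma L2_norm_cutoff_weight:
  assumes f: "sq_int f" and d: "d > 0"
  shows "sq_int (\<lambda>x. complex_of_real (sqrt (cutoff_weight v d x)) * f x)"
    and "(L2_norm (\<lambda>x. complex_of_real (sqrt (cutoff_weight v d x)) * f x))\<^sup>2 = (\<integral>x. cutoff_weight v d x * (cmod (f x))\<^sup>2 \<partial>lborel)"
    and "L2_norm (\<lambda>x. complex_of_real (sqrt (cutoff_weight v d x)) * f x) \<le> sqrt (1 / d) * L2_norm f"
proof -
  have le: "cmod (complex_of_real (sqrt (cutoff_weight v d x))) \<le> sqrt (1 / d)" for x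
    using cutoff_weight_le[OF d, of v x] cutoff_weight_pos[OF d, of v x] by (simp only: norm_of_real) simp
  have m: "(\<lambda>x. complex_of_real (sqrt (cutoff_weight v d x))) \<in> borel_measurable borel" by measurable
  show 1: "sq_int (\<lambda>x. complex_of_real (sqrt (cutoff_weight v d x)) * f x)"
    by (rule sq_int_mult_bounded[OF f m le])
  show "L2_norm (\<lambda>x. complex_of_real (sqrt (cutoff_weight v d x)) * f x) \<le> sqrt (1 / d) * L2_norm f"
    by (rule L2_norm_mult_bounded[OF f m le])
  show "(L2_norm (\<lambda>x. complex_of_real (sqrt (cutoff_weight v d x)) * f x))\<^sup>2 = (\<integral>x. cutoff_weight v d x * (cmod (f x))\<^sup>2 \<partial>lborel)"
    unfolding L2_norm_sq[OF 1] using cutoff_weight_pos[OF d, of v]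
    by (simp add: norm_mult power_mult_distrib less_imp_le)
qed

context regular_flow
begin

text \<open>Write \<open>\<psi> (t + h)\<close> as \<open>u + r\<close> with \<open>u\<close> the
  free evolution of \<open>\<psi> t\<close>. The mass of \<open>u\<close> obeys the exact growth
  bound and that of \<open>r\<close> is O(h^2). The cross term pairs, to leading order, the weighted
  solution with -i h V \<psi>, which is purely imaginary for real \<open>V\<close>, so its real part
  is bounded above by o(h).\<close>

lemma weighted_step:
  assumes v: "norm v < 1" and d: "d > 0" and t: "0 \<le> t" "ereal t < T" and e: "e > 0"
  shows "\<forall>\<^sub>F h in at_right 0. (\<integral>x. cutoff_weight v d x * (cmod (\<psi> (t + h) x))\<^sup>2 \<partial>lborel)
    \<le> exp (2 * h * norm v) * (\<integral>x. cutoff_weight v d x * (cmod (\<psi> t x))\<^sup>2 \<partial>lborel) + e * h"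
proof -
  define W where "W x = complex_of_real (cutoff_weight v d x)" for x
  \<comment> \<open>The square root of the weight turns the weighted mass into an L^2 norm, which
    can be expanded as the norm of a sum.\<close>
  define S where "S x = complex_of_real (sqrt (cutoff_weight v d x))" for x
  have [measurable]: "W \<in> borel_measurable borel" "S \<in> borel_measurable borel" unfolding W_def S_def by measurable
  have SS: "cnj (S x) * S x = W x" for x
    using cutoff_weight_pos[OF d, of v x] by (simp add: S_def W_def of_real_mult[symmetric] del: of_real_mult)
  have W1: "cmod (W x) \<le> 1 / d" for x
    using cutoff_weight_le[OF d, of v x] cutoff_weight_pos[OF d, of v x] by (simp add: W_def)
  note sq = sq_int_flow[OF t]
  have sqW: "sq_int (\<lambda>x. W x * f x)" if "sq_int f" for f by (rule sq_int_mult_bounded[OF that _ W1]) measurable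
  have W2: "L2_norm (\<lambda>x. W x * f x) \<le> (1 / d) * L2_norm f" if "sq_int f" for f
    by (rule L2_norm_mult_bounded[OF that _ W1]) measurable
  obtain B where B: "B \<ge> 0" and Bev: "\<forall>\<^sub>F h in at_right 0. L2_norm (\<lambda>\<xi>. \<Psi> (t + h) \<xi> - phase h \<xi> * \<Psi> t \<xi>) \<le> B * h"
    using remainder_bound[OF t] .
  obtain P where P: "is_fourier_L2 (\<lambda>x. W x * \<psi> t x) P" using is_fourier_L2_ex[OF sqW[OF sq(1)]] .
  note sqP = is_fourier_L2D(2)[OF P]
  define Nn where "Nn = L2_norm (N t)"
  have Nn: "Nn \<ge> 0" by (simp add: Nn_def)
  \<comment> \<open>The radius \<open>K\<close> is fixed before \<open>h\<close>: it depends on the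
    high-frequency tail of the weighted solution at time \<open>t\<close> only through
    \<open>e\<close>, \<open>B\<close> and \<open>Nn\<close>.\<close>
  have "\<forall>\<^sub>F K in at_top. L2_norm (\<lambda>\<xi>. indicator (ball 0 K) \<xi> * P \<xi> - P \<xi>) < e / (8 * (B + Nn + 1))"
    by (rule order_tendstoD[OF L2_norm_truncate_tendsto[OF sqP]]) (use e B Nn in simp)
  from eventually_happens'[OF trivial_limit_at_top_linorder this]
  obtain K where K: "L2_norm (\<lambda>\<xi>. indicator (ball 0 K) \<xi> * P \<xi> - P \<xi>) < e / (8 * (B + Nn + 1))"
    by blast
  \<comment> \<open>The thresholds make each of three errors in the cross term at most e h / 8.
    Doubled, and together with e h / 4 for the quadratic term, they add up to e h.\<close>
  define \<eta> where "\<eta> = e / (8 * (L2_norm P + 1))"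
  have \<eta>: "\<eta> > 0" using e by (simp add: \<eta>_def add_nonneg_pos)
  define \<eta>2 where "\<eta>2 = e * d / (8 * (B + 1))"
  have \<eta>2: "\<eta>2 > 0" using e d B by (simp add: \<eta>2_def)
  have "\<forall>\<^sub>F h in at_right 0. L2_norm (\<lambda>\<xi>. phase h \<xi> * \<Psi> t \<xi> - phase 0 \<xi> * \<Psi> t \<xi>) < \<eta>2"
    by (rule order_tendstoD[OF phase_tendsto[OF sq(2)]]) (rule \<eta>2)
  moreover have "\<forall>\<^sub>F h in at_right 0. h < e * d / (4 * (B\<^sup>2 + 1))"
    by (rule order_tendstoD(2)[OF tendsto_ident_at]) (use e d in \<open>simp add: add_nonneg_pos\<close>)
  ultimately show ?thesis
    using Bev truncated_step[OF t \<eta>, of K] eventually_time[OF t]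
  proof eventually_elim
    case (elim h)
    then have h: "0 < h" "0 \<le> t + h" "ereal (t + h) < T" using t by auto
    note sqh = sq_int_flow[OF h(2,3)]
    define R where "R \<xi> = \<Psi> (t + h) \<xi> - phase h \<xi> * \<Psi> t \<xi>" for \<xi>
    have sqR: "sq_int R" unfolding R_def by (intro sq_int_diff sq_int_phase sq sqh)
    have Rn: "L2_norm R \<le> B * h" using elim by (simp add: R_def[abs_def])
    obtain u where u: "is_fourier_L2 u (\<lambda>\<xi>. phase h \<xi> * \<Psi> t \<xi>)" using is_fourier_L2_surj[OF sq_int_phase[OF sq(2)]] .
    note squ = is_fourier_L2D(1)[OF u]
    define r where "r x = \<psi> (t + h) x - u x" for x
    have rR: "is_fourier_L2 r R" unfolding r_def R_def by (rule is_fourier_L2_diff[OF fourier[OF h(2,3)] u])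
    have sqr: "sq_int r" by (rule is_fourier_L2D(1)[OF rR])
    have rn: "L2_norm r \<le> B * h" using Rn is_fourier_L2_norm[OF rR] by simp
    note Su = L2_norm_cutoff_weight[OF squ d, of v, folded S_def]
      and Sr = L2_norm_cutoff_weight[OF sqr d, of v, folded S_def]
      and Sh = L2_norm_cutoff_weight[OF sqh(1) d, of v, folded S_def]
    have "(\<integral>x. cutoff_weight v d x * (cmod (\<psi> (t + h) x))\<^sup>2 \<partial>lborel) = (L2_norm (\<lambda>x. S x * u x + S x * r x))\<^sup>2"
      unfolding Sh(2)[symmetric] r_def by (simp add: algebra_simps)
    also have "\<dots> = (L2_norm (\<lambda>x. S x * u x))\<^sup>2 + (L2_norm (\<lambda>x. S x * r x))\<^sup>2 + 2 * Re (L2_inner (\<lambda>x. S x * u x) (\<lambda>x. S x * r x))"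
      by (rule L2_norm_add_sq[OF Su(1) Sr(1)])
    also have "(L2_norm (\<lambda>x. S x * u x))\<^sup>2 \<le> exp (2 * h * norm v) * (\<integral>x. cutoff_weight v d x * (cmod (\<psi> t x))\<^sup>2 \<partial>lborel)"
      unfolding Su(2) using h by (intro cutoff_evolution_bound[OF v _ d fourier[OF t] u[unfolded phase_def]]) simp
    also have "(L2_norm (\<lambda>x. S x * r x))\<^sup>2 \<le> (e / 4) * h"
    proof -
      have "(L2_norm (\<lambda>x. S x * r x))\<^sup>2 \<le> (sqrt (1 / d) * (B * h))\<^sup>2"
        using order_trans[OF Sr(3) mult_left_mono[OF rn]] d by (intro power_mono) auto
      also have "\<dots> = (B\<^sup>2 * h / d) * h" unfolding power_mult_distrib using d by (simp add: power2_eq_square[of h])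
      also have "\<dots> \<le> (e / 4) * h"
      proof (rule mult_right_mono)
        have "B\<^sup>2 * h \<le> (B\<^sup>2 + 1) * h" using h by (intro mult_right_mono) auto
        also have "\<dots> \<le> (B\<^sup>2 + 1) * (e * d / (4 * (B\<^sup>2 + 1)))" using elim by (intro mult_left_mono) auto
        also have "\<dots> = e * d / 4"
        proof -
          have "c * (e * d / (4 * c)) = e * d / 4" if "c \<noteq> 0" for c :: real using that by simp
          moreover have "B\<^sup>2 + 1 \<noteq> 0" using zero_le_power2[of B] by linarith
          ultimately show ?thesis .
        qed
        finally show "B\<^sup>2 * h / d \<le> e / 4" using d by (simp add: field_simps)
      qed (use h in simp)
      finally show ?thesis .
    qed
    also have "Re (L2_inner (\<lambda>x. S x * u x) (\<lambda>x. S x * r x)) \<le> (3 * e / 8) * h"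
    proof -
      have "L2_inner (\<lambda>x. S x * u x) (\<lambda>x. S x * r x) = L2_inner (\<lambda>x. W x * u x) r"
      proof -
        have "cnj (S x * u x) * (S x * r x) = cnj (W x * u x) * r x" for x
          unfolding SS[of x, symmetric] by (simp add: mult_ac)
        then show ?thesis unfolding L2_inner_def by (simp only:)
      qed
      also have "(\<lambda>x. W x * u x) = (\<lambda>x. W x * \<psi> t x - W x * (\<psi> t x - u x))" by (simp add: algebra_simps)
      also have "L2_inner \<dots> r = L2_inner (\<lambda>x. W x * \<psi> t x) r - L2_inner (\<lambda>x. W x * (\<psi> t x - u x)) r"
        by (intro L2_inner_diff_left sqW sq_int_diff sq squ sqr)
      finally have split: "Re (L2_inner (\<lambda>x. S x * u x) (\<lambda>x. S x * r x))
         \<le> Re (L2_inner (\<lambda>x. W x * \<psi> t x) r) + cmod (L2_inner (\<lambda>x. W x * (\<psi> t x - u x)) r)"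
        using abs_Re_le_cmod[of "L2_inner (\<lambda>x. W x * (\<psi> t x - u x)) r"] by simp
      have "cmod (L2_inner (\<lambda>x. W x * (\<psi> t x - u x)) r) \<le> L2_norm (\<lambda>x. W x * (\<psi> t x - u x)) * L2_norm r"
        by (intro L2_inner_le sqW sq_int_diff sq squ sqr)
      also have "\<dots> \<le> (1 / d * \<eta>2) * (B * h)"
      proof (intro mult_mono rn)
        have "L2_norm (\<lambda>x. W x * (\<psi> t x - u x)) \<le> 1 / d * L2_norm (\<lambda>x. \<psi> t x - u x)"
          by (intro W2 sq_int_diff sq squ)
        also have "L2_norm (\<lambda>x. \<psi> t x - u x) = L2_norm (\<lambda>\<xi>. \<Psi> t \<xi> - phase h \<xi> * \<Psi> t \<xi>)"
          by (rule is_fourier_L2_norm[OF is_fourier_L2_diff[OF fourier[OF t] u], symmetric])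
        also have "\<dots> = L2_norm (\<lambda>\<xi>. phase h \<xi> * \<Psi> t \<xi> - \<Psi> t \<xi>)" by (rule L2_norm_minus_commute)
        also have "1 / d * \<dots> \<le> 1 / d * \<eta>2" using elim d by (intro mult_left_mono) auto
        finally show "L2_norm (\<lambda>x. W x * (\<psi> t x - u x)) \<le> 1 / d * \<eta>2" .
      qed (use \<eta>2 d in auto)
      also have "\<dots> = (e / 8) * (B / (B + 1)) * h" using d by (simp add: \<eta>2_def)
      also have "\<dots> \<le> (e / 8) * 1 * h" using B e h by (intro mult_mono) auto
      finally have T1: "cmod (L2_inner (\<lambda>x. W x * (\<psi> t x - u x)) r) \<le> (e / 8) * h" by simp
      \<comment> \<open>The remainder with its leading term removed: of size O(h) overall, and small
        compared with \<open>h\<close> on the ball of radius \<open>K\<close>.\<close>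
      define Q where "Q \<xi> = R \<xi> + \<i> * complex_of_real h * N t \<xi>" for \<xi>
      have sqQ: "sq_int Q" unfolding Q_def by (intro sq_int_add sq_int_scale sqR sq)
      have Qn: "L2_norm Q \<le> (B + Nn) * h"
      proof -
        have "L2_norm Q \<le> L2_norm R + L2_norm (\<lambda>\<xi>. \<i> * complex_of_real h * N t \<xi>)"
          unfolding Q_def by (intro L2_norm_triangle sq_int_scale sqR sq)
        also have "L2_norm (\<lambda>\<xi>. \<i> * complex_of_real h * N t \<xi>) = h * Nn"
          using h by (simp add: L2_norm_scale[OF sq(3)] norm_mult Nn_def)
        finally show ?thesis using Rn by (simp add: algebra_simps)
      qed
      have Q1: "L2_norm (\<lambda>\<xi>. indicator (ball 0 K) \<xi> * Q \<xi>) \<le> \<eta> * h"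
        using elim by (simp add: Q_def R_def)
      have sqQ1: "sq_int (\<lambda>\<xi>. indicator (ball 0 K) \<xi> * Q \<xi>)" by (rule truncate_sq_int[OF sqQ])
      have sqP1: "sq_int (\<lambda>\<xi>. indicator (ball 0 K) \<xi> * P \<xi>)" by (rule truncate_sq_int[OF sqP])
      \<comment> \<open>In position space this pairing is i h times the integral of the real
        function W V |\<psi>|^2, so it has no real part. This is where the reality of the potential
        enters.\<close>
      have "L2_inner P (\<lambda>\<xi>. \<i> * complex_of_real h * N t \<xi>) = \<i> * complex_of_real h * L2_inner P (N t)"
        by (rule L2_inner_scale_right)
      also have "L2_inner P (N t) = L2_inner (\<lambda>x. W x * \<psi> t x) (\<lambda>x. complex_of_real (V t x) * \<psi> t x)"
        by (rule is_fourier_L2_inner[OF P fourier_N[OF t]])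
      also have "\<dots> = complex_of_real (\<integral>x. cutoff_weight v d x * V t x * (cmod (\<psi> t x))\<^sup>2 \<partial>lborel)"
        unfolding L2_inner_def integral_complex_of_real[symmetric]
        by (intro Bochner_Integration.integral_cong refl)
           (simp add: W_def complex_norm_square mult_ac del: of_real_power)
      finally have imag: "Re (L2_inner P (\<lambda>\<xi>. \<i> * complex_of_real h * N t \<xi>)) = 0" by simp
      have "L2_inner (\<lambda>x. W x * \<psi> t x) r = L2_inner P R" by (rule is_fourier_L2_inner[OF P rR, symmetric])
      also have "\<dots> = L2_inner P Q - L2_inner P (\<lambda>\<xi>. \<i> * complex_of_real h * N t \<xi>)"
        unfolding Q_def by (subst L2_inner_add_right) (simp_all add: sqP sqR sq_int_scale sq)
      finally have "Re (L2_inner (\<lambda>x. W x * \<psi> t x) r) = Re (L2_inner P Q)" using imag by simp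
      \<comment> \<open>At low frequencies \<open>Q\<close> is small; at high frequencies the tail
        of \<open>P\<close> is small instead.\<close>
      also have "L2_inner P Q = L2_inner P (\<lambda>\<xi>. indicator (ball 0 K) \<xi> * Q \<xi>) - L2_inner (\<lambda>\<xi>. indicator (ball 0 K) \<xi> * P \<xi> - P \<xi>) Q"
      proof -
        have "L2_inner (\<lambda>\<xi>. indicator (ball 0 K) \<xi> * P \<xi>) Q = L2_inner P (\<lambda>\<xi>. indicator (ball 0 K) \<xi> * Q \<xi>)"
          unfolding L2_inner_def by (intro Bochner_Integration.integral_cong refl) (simp add: indicator_def)
        then show ?thesis using L2_inner_diff_left[OF sqQ sqP1 sqP] by simp
      qed
      also have "Re \<dots> \<le> cmod (L2_inner P (\<lambda>\<xi>. indicator (ball 0 K) \<xi> * Q \<xi>)) + cmod (L2_inner (\<lambda>\<xi>. indicator (ball 0 K) \<xi> * P \<xi> - P \<xi>) Q)"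
        using complex_Re_le_cmod order_trans norm_triangle_ineq4 by blast
      also have "\<dots> \<le> L2_norm P * (\<eta> * h) + e / (8 * (B + Nn + 1)) * ((B + Nn) * h)"
      proof (rule add_mono)
        show "cmod (L2_inner P (\<lambda>\<xi>. indicator (ball 0 K) \<xi> * Q \<xi>)) \<le> L2_norm P * (\<eta> * h)"
          by (rule order_trans[OF L2_inner_le[OF sqP sqQ1]]) (intro mult_left_mono Q1 L2_norm_nonneg)
        show "cmod (L2_inner (\<lambda>\<xi>. indicator (ball 0 K) \<xi> * P \<xi> - P \<xi>) Q) \<le> e / (8 * (B + Nn + 1)) * ((B + Nn) * h)"
          using K e B Nn by (intro order_trans[OF L2_inner_le[OF sq_int_diff[OF sqP1 sqP] sqQ]] mult_mono Qn) auto
      qed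
      also have "\<dots> = (e / 8) * (L2_norm P / (L2_norm P + 1)) * h + (e / 8) * ((B + Nn) / (B + Nn + 1)) * h"
        by (simp add: \<eta>_def mult_ac)
      also have "\<dots> \<le> (e / 8) * 1 * h + (e / 8) * 1 * h"
      proof -
        have frac: "a / (a + 1) \<le> 1" if "0 \<le> a" for a :: real using that by simp
        show ?thesis using B Nn e h by (intro add_mono mult_right_mono mult_left_mono frac) auto
      qed
      finally show ?thesis using split T1 by simp
    qed
    finally show ?case by (simp add: algebra_simps)
  qed
qed

text \<open>Multiplying the mass by \<open>exp (- (2 * \<tau> * norm v))\<close> turns the estimate
  of one step into the Dini condition for a nonincreasing function. Continuity of the mass in time
  is inherited from L^2, since the cutoff weight is bounded.\<close>

lemma weighted_growth:
  assumes v: "norm v < 1" and d: "d > 0" and t: "0 \<le> t" "ereal t < T"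
  shows "(\<integral>x. cutoff_weight v d x * (cmod (\<psi> t x))\<^sup>2 \<partial>lborel)
    \<le> exp (2 * t * norm v) * (\<integral>x. cutoff_weight v d x * (cmod (\<psi> 0 x))\<^sup>2 \<partial>lborel)"
proof -
  define E where "E \<tau> = (\<integral>x. cutoff_weight v d x * (cmod (\<psi> \<tau> x))\<^sup>2 \<partial>lborel)" for \<tau>
  let ?I = "{t. 0 \<le> t \<and> ereal t < T}"
  have I: "0 \<le> \<tau>" "ereal \<tau> < T" if "\<tau> \<in> {0..t}" for \<tau>
    using that t le_less_trans[of "ereal \<tau>" "ereal t" T] by auto
  define L where "L \<tau> = L2_norm (\<lambda>x. complex_of_real (sqrt (cutoff_weight v d x)) * \<psi> \<tau> x)" for \<tau>
  have EL: "E \<tau> = (L \<tau>)\<^sup>2" if "\<tau> \<in> {0..t}" for \<tau>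
    unfolding E_def L_def using L2_norm_cutoff_weight(2)[OF sq_int_flow(1)[OF I[OF that]] d] by simp
  have "continuous_on {0..t} L"
    unfolding continuous_on_def
  proof (rule ballI)
    fix y assume y: "y \<in> {0..t}"
    have "((\<lambda>\<tau>. L2_norm (\<lambda>\<xi>. \<Psi> \<tau> \<xi> - \<Psi> y \<xi>)) \<longlongrightarrow> 0) (at y within {0..t})"
      by (rule tendsto_within_subset[OF cont[OF I[OF y]]]) (use I in auto)
    then have lim: "((\<lambda>\<tau>. sqrt (1 / d) * L2_norm (\<lambda>\<xi>. \<Psi> \<tau> \<xi> - \<Psi> y \<xi>)) \<longlongrightarrow> 0) (at y within {0..t})"
      by (rule tendsto_mult_right_zero)
    show "(L \<longlongrightarrow> L y) (at y within {0..t})"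
    proof (rule LIM_zero_cancel, rule Lim_null_comparison[OF _ lim])
      have "norm (L \<tau> - L y) \<le> sqrt (1 / d) * L2_norm (\<lambda>\<xi>. \<Psi> \<tau> \<xi> - \<Psi> y \<xi>)" if \<tau>: "\<tau> \<in> {0..t}" for \<tau>
      proof -
        note s = sq_int_flow(1)[OF I[OF \<tau>]] sq_int_flow(1)[OF I[OF y]]
        have "norm (L \<tau> - L y) \<le> L2_norm (\<lambda>x. complex_of_real (sqrt (cutoff_weight v d x)) * \<psi> \<tau> x - complex_of_real (sqrt (cutoff_weight v d x)) * \<psi> y x)"
          unfolding L_def real_norm_def by (intro L2_norm_diff_le L2_norm_cutoff_weight(1) s d)
        also have "\<dots> = L2_norm (\<lambda>x. complex_of_real (sqrt (cutoff_weight v d x)) * (\<psi> \<tau> x - \<psi> y x))"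
          by (simp add: right_diff_distrib)
        also have "\<dots> \<le> sqrt (1 / d) * L2_norm (\<lambda>x. \<psi> \<tau> x - \<psi> y x)"
          by (intro L2_norm_cutoff_weight(3) sq_int_diff s d)
        also have "L2_norm (\<lambda>x. \<psi> \<tau> x - \<psi> y x) = L2_norm (\<lambda>\<xi>. \<Psi> \<tau> \<xi> - \<Psi> y \<xi>)"
          by (rule is_fourier_L2_norm[OF is_fourier_L2_diff[OF fourier[OF I[OF \<tau>]] fourier[OF I[OF y]]], symmetric])
        finally show ?thesis .
      qed
      then show "\<forall>\<^sub>F \<tau> in at y within {0..t}. norm (L \<tau> - L y) \<le> sqrt (1 / d) * L2_norm (\<lambda>\<xi>. \<Psi> \<tau> \<xi> - \<Psi> y \<xi>)"
        by (simp add: eventually_at_filter)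
    qed
  qed
  then have contE: "continuous_on {0..t} E"
    by (subst continuous_on_cong[OF refl EL]) (auto intro!: continuous_intros)
  have "exp (- (2 * t * norm v)) * E t \<le> exp (- (2 * 0 * norm v)) * E 0"
  proof (rule dini_nonincreasing[where f="\<lambda>\<tau>. exp (- (2 * \<tau> * norm v)) * E \<tau>"])
    show "continuous_on {0..t} (\<lambda>\<tau>. exp (- (2 * \<tau> * norm v)) * E \<tau>)" by (intro continuous_intros contE)
    fix y e :: real assume y: "0 \<le> y" "y < t" and e: "e > 0"
    have yI: "0 \<le> y" "ereal y < T" using I[of y] y by auto
    from weighted_step[OF v d yI e] eventually_at_right_less[of "0::real"]
    show "\<forall>\<^sub>F k in at_right 0. exp (- (2 * (y + k) * norm v)) * E (y + k) \<le> exp (- (2 * y * norm v)) * E y + e * k"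
    proof eventually_elim
      case (elim k)
      have "exp (- (2 * (y + k) * norm v)) * E (y + k) \<le> exp (- (2 * (y + k) * norm v)) * (exp (2 * k * norm v) * E y + e * k)"
        using elim by (intro mult_left_mono) (simp_all add: E_def)
      also have "\<dots> = exp (- (2 * y * norm v)) * E y + exp (- (2 * (y + k) * norm v)) * (e * k)"
        by (simp add: distrib_left mult.assoc[symmetric] exp_add[symmetric]) (simp add: algebra_simps)
      also have "\<dots> \<le> exp (- (2 * y * norm v)) * E y + 1 * (e * k)"
        using y e elim by (intro add_mono mult_right_mono order_refl) auto
      finally show ?case by simp
    qed
  qed (use t in simp)
  then have "exp (2 * t * norm v) * (exp (- (2 * t * norm v)) * E t) \<le> exp (2 * t * norm v) * E 0"
    by (intro mult_left_mono) auto
  then show ?thesis unfolding E_def by (simp add: mult.assoc[symmetric] exp_add[symmetric])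
qed

end

subsection \<open>Solutions of the Hartree equation\<close>

lemma sob_sq_triangle:
  assumes [measurable]: "f \<in> borel_measurable borel" "g \<in> borel_measurable borel"
  shows "sob_sq \<sigma> f \<le> 2 * sob_sq \<sigma> (\<lambda>\<xi>. f \<xi> - g \<xi>) + 2 * sob_sq \<sigma> g"
proof -
  have "sob_sq \<sigma> f \<le> (\<integral>\<^sup>+\<xi>. 2 * ennreal (jb \<xi> powr (2 * \<sigma>) * (cmod (f \<xi> - g \<xi>))\<^sup>2) + 2 * ennreal (jb \<xi> powr (2 * \<sigma>) * (cmod (g \<xi>))\<^sup>2) \<partial>lborel)"
    unfolding sob_sq_def
  proof (rule nn_integral_mono)
    fix \<xi>
    have "(cmod (f \<xi>))\<^sup>2 \<le> (cmod (f \<xi> - g \<xi>) + cmod (g \<xi>))\<^sup>2"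
      using norm_triangle_ineq[of "f \<xi> - g \<xi>" "g \<xi>"] by (intro power_mono) auto
    also have "\<dots> \<le> 2 * (cmod (f \<xi> - g \<xi>))\<^sup>2 + 2 * (cmod (g \<xi>))\<^sup>2"
      using sum_squares_bound[of "cmod (f \<xi> - g \<xi>)" "cmod (g \<xi>)"] by (simp add: power2_sum)
    finally have "jb \<xi> powr (2 * \<sigma>) * (cmod (f \<xi>))\<^sup>2 \<le> jb \<xi> powr (2 * \<sigma>) * (2 * (cmod (f \<xi> - g \<xi>))\<^sup>2 + 2 * (cmod (g \<xi>))\<^sup>2)"
      by (rule mult_left_mono) simp
    also have "\<dots> = 2 * (jb \<xi> powr (2 * \<sigma>) * (cmod (f \<xi> - g \<xi>))\<^sup>2) + 2 * (jb \<xi> powr (2 * \<sigma>) * (cmod (g \<xi>))\<^sup>2)"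
      by (simp add: algebra_simps)
    finally have "ennreal (jb \<xi> powr (2 * \<sigma>) * (cmod (f \<xi>))\<^sup>2) \<le> ennreal (2 * (jb \<xi> powr (2 * \<sigma>) * (cmod (f \<xi> - g \<xi>))\<^sup>2) + 2 * (jb \<xi> powr (2 * \<sigma>) * (cmod (g \<xi>))\<^sup>2))"
      by (rule ennreal_leI)
    also have "\<dots> = 2 * ennreal (jb \<xi> powr (2 * \<sigma>) * (cmod (f \<xi> - g \<xi>))\<^sup>2) + 2 * ennreal (jb \<xi> powr (2 * \<sigma>) * (cmod (g \<xi>))\<^sup>2)"
      by (subst ennreal_plus) (simp_all add: ennreal_mult)
    finally show "ennreal (jb \<xi> powr (2 * \<sigma>) * (cmod (f \<xi>))\<^sup>2) \<le> \<dots>" .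
  qed
  also have "\<dots> = 2 * sob_sq \<sigma> (\<lambda>\<xi>. f \<xi> - g \<xi>) + 2 * sob_sq \<sigma> g"
    unfolding sob_sq_def by (simp add: nn_integral_add nn_integral_cmult)
  finally show ?thesis .
qed

lemma sob_sq_locally_bounded:
  assumes meas: "\<And>\<tau>. \<tau> \<in> I \<Longrightarrow> f \<tau> \<in> borel_measurable borel" and t: "t \<in> I" and fin: "sob_sq \<sigma> (f t) < \<infinity>"
    and lim: "((\<lambda>\<tau>. sob_sq \<sigma> (\<lambda>\<xi>. f \<tau> \<xi> - f t \<xi>)) \<longlongrightarrow> 0) (at t within I)"
  obtains c where "c \<ge> 0" "\<forall>\<^sub>F \<tau> in at t within I. sob_sq \<sigma> (f \<tau>) \<le> ennreal c"
proof -
  have "\<forall>\<^sub>F \<tau> in at t within I. sob_sq \<sigma> (\<lambda>\<xi>. f \<tau> \<xi> - f t \<xi>) < 1" by (rule order_tendstoD(2)[OF lim]) simp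
  moreover have "\<forall>\<^sub>F \<tau> in at t within I. \<tau> \<in> I" by (simp add: eventually_at_filter)
  ultimately have "\<forall>\<^sub>F \<tau> in at t within I. sob_sq \<sigma> (f \<tau>) \<le> ennreal (2 + 2 * enn2real (sob_sq \<sigma> (f t)))"
  proof eventually_elim
    case (elim \<tau>)
    have "sob_sq \<sigma> (f \<tau>) \<le> 2 * sob_sq \<sigma> (\<lambda>\<xi>. f \<tau> \<xi> - f t \<xi>) + 2 * sob_sq \<sigma> (f t)"
      by (intro sob_sq_triangle meas elim t)
    also have "\<dots> \<le> 2 * 1 + 2 * ennreal (enn2real (sob_sq \<sigma> (f t)))"
      using elim fin by (intro add_mono mult_left_mono) auto
    also have "\<dots> = ennreal (2 + 2 * enn2real (sob_sq \<sigma> (f t)))"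
      by (subst ennreal_plus) (simp_all add: ennreal_mult)
    finally show ?case .
  qed
  then show thesis by (intro that[of "2 + 2 * enn2real (sob_sq \<sigma> (f t))"]) auto
qed

text \<open>As \<open>s - 1 \<ge> -1\<close>, the Sobolev weight is at least
  \<open>1 / (1 + K\<^sup>2)\<close> on the ball, so there convergence in H^(s-1) implies
  convergence in L^2. This is why \<open>generator\<close> is stated on balls.\<close>

lemma L2_sq_ball_le_sob:
  assumes s: "0 \<le> s" and [measurable]: "f \<in> borel_measurable borel"
  shows "L2_sq (\<lambda>\<xi>. indicator (ball 0 K) \<xi> * f \<xi>) \<le> ennreal (1 + K\<^sup>2) * sob_sq (s - 1) f"
proof -
  have "(cmod (indicator (ball 0 K) \<xi> * f \<xi>))\<^sup>2 \<le> (1 + K\<^sup>2) * (jb \<xi> powr (2 * (s - 1)) * (cmod (f \<xi>))\<^sup>2)" for \<xi>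
  proof (cases "norm \<xi> < K")
    case False
    then show ?thesis by simp
  next
    case True
    have "(jb \<xi>)\<^sup>2 \<le> 1 + K\<^sup>2"
      unfolding jb_def using True by (simp add: power_mono less_imp_le)
    moreover have "jb \<xi> powr (-2) \<le> jb \<xi> powr (2 * (s - 1))"
      using s by (intro powr_mono jb_ge_1) simp
    ultimately have "(jb \<xi>)\<^sup>2 * jb \<xi> powr (-2) \<le> (1 + K\<^sup>2) * jb \<xi> powr (2 * (s - 1))"
      by (intro mult_mono) auto
    moreover have "(jb \<xi>)\<^sup>2 * jb \<xi> powr (-2) = 1" by (simp add: powr_minus)
    ultimately have "1 * (cmod (f \<xi>))\<^sup>2 \<le> ((1 + K\<^sup>2) * jb \<xi> powr (2 * (s - 1))) * (cmod (f \<xi>))\<^sup>2"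
      by (intro mult_right_mono) auto
    then show ?thesis using True by (simp add: mult.assoc)
  qed
  then have "L2_sq (\<lambda>\<xi>. indicator (ball 0 K) \<xi> * f \<xi>) \<le> (\<integral>\<^sup>+\<xi>. ennreal (1 + K\<^sup>2) * ennreal (jb \<xi> powr (2 * (s - 1)) * (cmod (f \<xi>))\<^sup>2) \<partial>lborel)"
    unfolding L2_sq_lborel by (intro nn_integral_mono, subst ennreal_mult[symmetric]) (blast intro: ennreal_leI | simp)+
  also have "\<dots> = ennreal (1 + K\<^sup>2) * sob_sq (s - 1) f"
    unfolding sob_sq_def by (rule nn_integral_cmult) measurable
  finally show ?thesis .
qed

lemma phase_expansion:
  assumes k: "k > 0"
  shows "cmod ((1 - phase k \<xi>) / complex_of_real k - \<i> * complex_of_real (jb \<xi>)) \<le> k * (jb \<xi>)\<^sup>2 / 2"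
proof -
  define x where "x = - (k * jb \<xi>)"
  have "cmod (iexp x - (\<Sum>j\<le>1. (\<i> * complex_of_real x) ^ j / fact j)) \<le> \<bar>x\<bar> ^ Suc 1 / fact (Suc 1)"
    by (rule iexp_approx1)
  then have "cmod (phase k \<xi> - (1 - \<i> * complex_of_real (k * jb \<xi>))) \<le> (k * jb \<xi>)\<^sup>2 / 2"
    by (simp add: x_def phase_def power2_eq_square)
  then have "cmod ((1 - phase k \<xi>) - \<i> * complex_of_real (k * jb \<xi>)) \<le> (k * jb \<xi>)\<^sup>2 / 2"
    by (subst norm_minus_commute) (simp add: algebra_simps)
  then have "cmod ((1 - phase k \<xi>) - \<i> * complex_of_real (k * jb \<xi>)) / k \<le> (k * jb \<xi>)\<^sup>2 / 2 / k"
    using k by (intro divide_right_mono) auto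
  moreover have "(1 - phase k \<xi>) / complex_of_real k - \<i> * complex_of_real (jb \<xi>)
      = ((1 - phase k \<xi>) - \<i> * complex_of_real (k * jb \<xi>)) / complex_of_real k"
    using k by (simp add: diff_divide_distrib)
  ultimately show ?thesis using k by (simp add: norm_divide power2_eq_square mult_ac)
qed

text \<open>Subtracting the free phase cancels the term \<open>jb \<xi> * \<Psi> t \<xi>\<close> of
  the equation up to a Taylor error, which is O(k) on each ball, and leaves the
  nonlinearity.\<close>

lemma generator_limit:
  fixes \<Psi> :: "real \<Rightarrow> 'a::euclidean_space \<Rightarrow> complex"
  assumes s: "0 \<le> s" and sq: "\<And>\<tau>. \<tau> \<in> I \<Longrightarrow> sq_int (\<Psi> \<tau>)" and t: "t \<in> I"
    and I: "\<forall>\<^sub>F k in at_right 0. t + k \<in> I"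
    and \<Phi>: "in_sob (s - 1) \<Phi>" and N: "sq_int N"
    and lim: "((\<lambda>\<tau>. sob_sq (s - 1) (\<lambda>\<xi>. (\<Psi> \<tau> \<xi> - \<Psi> t \<xi>) / complex_of_real (\<tau> - t) - \<Phi> \<xi>)) \<longlongrightarrow> 0) (at t within I)"
    and eq: "AE \<xi> in lborel. \<i> * \<Phi> \<xi> = complex_of_real (jb \<xi>) * \<Psi> t \<xi> + N \<xi>"
  shows "((\<lambda>k. L2_norm (\<lambda>\<xi>. indicator (ball 0 K) \<xi> *
        ((\<Psi> (t + k) \<xi> - phase k \<xi> * \<Psi> t \<xi>) / complex_of_real k + \<i> * N \<xi>))) \<longlongrightarrow> 0) (at_right 0)"
proof -
  have [measurable]: "\<Phi> \<in> borel_measurable borel" using \<Phi> by (simp add: in_sob_def)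
  have meas: "\<Psi> \<tau> \<in> borel_measurable borel" if "\<tau> \<in> I" for \<tau> using sq[OF that] by (rule sq_int_measurable)
  have [measurable]: "\<Psi> t \<in> borel_measurable borel" by (rule meas[OF t])
  have [measurable]: "(\<lambda>\<xi>::'a. indicator (ball 0 K) \<xi> :: complex) \<in> borel_measurable borel"
    by (intro borel_measurable_indicator) auto
  have pos: "\<forall>\<^sub>F k in at_right 0. (0::real) < k" by (rule eventually_at_right_less)
  define f where "f k \<xi> = (\<Psi> (t + k) \<xi> - \<Psi> t \<xi>) / complex_of_real k - \<Phi> \<xi>" for k \<xi>
  have "filterlim (\<lambda>k. t + k) (at t within I) (at_right 0)"
    unfolding filterlim_at
  proof
    have "((\<lambda>k. t + k) \<longlongrightarrow> t + 0) (at_right 0)" by (intro tendsto_intros)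
    then show "((\<lambda>k. t + k) \<longlongrightarrow> t) (at_right 0)" by simp
    show "\<forall>\<^sub>F k in at_right 0. t + k \<in> I \<and> t + k \<noteq> t" using I pos by eventually_elim simp
  qed
  from filterlim_compose[OF lim this]
  have flim: "((\<lambda>k. sob_sq (s - 1) (f k)) \<longlongrightarrow> 0) (at_right 0)" by (simp add: f_def[abs_def])
  have fm: "f k \<in> borel_measurable borel" if "t + k \<in> I" for k
    unfolding f_def using meas[OF that] by measurable
  have L: "((\<lambda>k. L2_sq (\<lambda>\<xi>. indicator (ball 0 K) \<xi> * f k \<xi>)) \<longlongrightarrow> 0) (at_right 0)"
  proof (rule tendsto_sandwich[OF _ _ tendsto_const])
    show "\<forall>\<^sub>F k in at_right 0. L2_sq (\<lambda>\<xi>. indicator (ball 0 K) \<xi> * f k \<xi>) \<le> ennreal (1 + K\<^sup>2) * sob_sq (s - 1) (f k)"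
      using I by eventually_elim (intro L2_sq_ball_le_sob s fm)
    show "((\<lambda>k. ennreal (1 + K\<^sup>2) * sob_sq (s - 1) (f k)) \<longlongrightarrow> 0) (at_right 0)"
      using ennreal_tendsto_cmult[OF _ flim, of "ennreal (1 + K\<^sup>2)"] by simp
  qed simp
  have "\<forall>\<^sub>F k in at_right 0. L2_sq (\<lambda>\<xi>. indicator (ball 0 K) \<xi> * f k \<xi>) < 1"
    by (rule order_tendstoD(2)[OF L]) simp
  with I have sqf: "\<forall>\<^sub>F k in at_right 0. sq_int (\<lambda>\<xi>. indicator (ball 0 K) \<xi> * f k \<xi>)"
  proof eventually_elim
    case (elim k)
    have [measurable]: "f k \<in> borel_measurable borel" by (rule fm[OF elim(1)])
    show ?case unfolding sq_int_iff using elim(2) less_trans[OF elim(2), of \<infinity>] by simp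
  qed
  then have L': "((\<lambda>k. L2_norm (\<lambda>\<xi>. indicator (ball 0 K) \<xi> * f k \<xi>)) \<longlongrightarrow> 0) (at_right 0)"
    using L L2_sq_tendsto_0_iff[OF sqf] by blast
  have "((\<lambda>k. L2_norm (\<lambda>\<xi>. indicator (ball 0 K) \<xi> * f k \<xi>) + k * ((1 + K\<^sup>2) / 2 * L2_norm (\<Psi> t))) \<longlongrightarrow> 0 + 0 * ((1 + K\<^sup>2) / 2 * L2_norm (\<Psi> t))) (at_right 0)"
    by (intro tendsto_intros L')
  then have lim0: "((\<lambda>k. L2_norm (\<lambda>\<xi>. indicator (ball 0 K) \<xi> * f k \<xi>) + k * ((1 + K\<^sup>2) / 2 * L2_norm (\<Psi> t))) \<longlongrightarrow> 0) (at_right 0)"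
    by simp
  show ?thesis
  proof (rule Lim_null_comparison[OF _ lim0])
    show "\<forall>\<^sub>F k in at_right 0. norm (L2_norm (\<lambda>\<xi>. indicator (ball 0 K) \<xi> * ((\<Psi> (t + k) \<xi> - phase k \<xi> * \<Psi> t \<xi>) / complex_of_real k + \<i> * N \<xi>)))
       \<le> L2_norm (\<lambda>\<xi>. indicator (ball 0 K) \<xi> * f k \<xi>) + k * ((1 + K\<^sup>2) / 2 * L2_norm (\<Psi> t))"
      using sqf pos
    proof eventually_elim
      case (elim k)
      \<comment> \<open>The Taylor error of the phase on the ball, controlled by
        \<open>phase_expansion\<close>.\<close>
      define b where "b \<xi> = indicator (ball 0 K) \<xi> * ((1 - phase k \<xi>) / complex_of_real k - \<i> * complex_of_real (jb \<xi>))" for \<xi> :: 'a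
      have bm: "b \<in> borel_measurable borel" unfolding b_def by measurable
      have b: "cmod (b \<xi>) \<le> k * ((1 + K\<^sup>2) / 2)" for \<xi>
      proof (cases "norm \<xi> < K")
        case False
        then show ?thesis using elim by (simp add: b_def)
      next
        case True
        then have "(jb \<xi>)\<^sup>2 \<le> 1 + K\<^sup>2" unfolding jb_def by (simp add: power_mono less_imp_le)
        then have "k * (jb \<xi>)\<^sup>2 / 2 \<le> k * (1 + K\<^sup>2) / 2" using elim by simp
        then show ?thesis using phase_expansion[OF elim(2), of \<xi>] True by (simp add: b_def)
      qed
      have ae: "AE \<xi> in lborel. cmod (indicator (ball 0 K) \<xi> * ((\<Psi> (t + k) \<xi> - phase k \<xi> * \<Psi> t \<xi>) / complex_of_real k + \<i> * N \<xi>))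
         = cmod (indicator (ball 0 K) \<xi> * f k \<xi> + b \<xi> * \<Psi> t \<xi>)"
        using eq
      proof eventually_elim
        case (elim \<xi>)
        have "\<i> * (\<i> * \<Phi> \<xi>) = \<i> * (complex_of_real (jb \<xi>) * \<Psi> t \<xi> + N \<xi>)" using elim by simp
        then have "\<i> * N \<xi> = - \<Phi> \<xi> - \<i> * complex_of_real (jb \<xi>) * \<Psi> t \<xi>"
          by (simp add: algebra_simps)
        then have "(\<Psi> (t + k) \<xi> - phase k \<xi> * \<Psi> t \<xi>) / complex_of_real k + \<i> * N \<xi>
          = f k \<xi> + ((1 - phase k \<xi>) / complex_of_real k - \<i> * complex_of_real (jb \<xi>)) * \<Psi> t \<xi>"
          by (simp add: f_def diff_divide_distrib left_diff_distrib)
        then show ?case by (simp add: b_def distrib_left mult.assoc)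
      qed
      have sqb: "sq_int (\<lambda>\<xi>. b \<xi> * \<Psi> t \<xi>)" by (rule sq_int_mult_bounded[OF sq[OF t] bm b])
      have "L2_norm (\<lambda>\<xi>. indicator (ball 0 K) \<xi> * ((\<Psi> (t + k) \<xi> - phase k \<xi> * \<Psi> t \<xi>) / complex_of_real k + \<i> * N \<xi>))
         = L2_norm (\<lambda>\<xi>. indicator (ball 0 K) \<xi> * f k \<xi> + b \<xi> * \<Psi> t \<xi>)" by (rule L2_norm_cong_AE[OF ae])
      also have "\<dots> \<le> L2_norm (\<lambda>\<xi>. indicator (ball 0 K) \<xi> * f k \<xi>) + L2_norm (\<lambda>\<xi>. b \<xi> * \<Psi> t \<xi>)"
        by (rule L2_norm_triangle[OF elim(1) sqb])
      also have "L2_norm (\<lambda>\<xi>. b \<xi> * \<Psi> t \<xi>) \<le> k * ((1 + K\<^sup>2) / 2) * L2_norm (\<Psi> t)"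
        by (rule L2_norm_mult_bounded[OF sq[OF t] bm b])
      finally show ?case by (simp add: mult.assoc)
    qed
  qed
qed

text \<open>For \<open>s < 1\<close> the convolution is a bounded function controlled by the squared
  Sobolev norm, so the nonlinearity is dominated by a multiple of \<psi>. Continuity in time makes
  the Sobolev norm locally bounded.\<close>

lemma nonlinearity_locally_bounded_rough:
  fixes w :: "'a::euclidean_space \<Rightarrow> real"
  assumes d: "DIM('a) \<ge> 3" and s: "0 \<le> s" "s < 1" and w: "W_class s mp mm w"
    and F: "\<And>\<tau>. \<tau> \<in> I \<Longrightarrow> is_fourier_L2 (\<psi> \<tau>) (\<Psi> \<tau>)" and S: "\<And>\<tau>. \<tau> \<in> I \<Longrightarrow> in_sob s (\<Psi> \<tau>)"
    and FN: "\<And>\<tau>. \<tau> \<in> I \<Longrightarrow> is_fourier_L2 (hartree_nl mp mm w (\<psi> \<tau>)) (N \<tau>)"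
    and t: "t \<in> I" and lim: "((\<lambda>\<tau>. sob_sq s (\<lambda>\<xi>. \<Psi> \<tau> \<xi> - \<Psi> t \<xi>)) \<longlongrightarrow> 0) (at t within I)"
  shows "\<exists>B. \<forall>\<^sub>F \<tau> in at t within I. L2_norm (N \<tau>) \<le> B"
proof -
  obtain K where K: "K \<ge> 0" "\<And>f g x. is_fourier_L2 f g \<Longrightarrow> in_sob s g \<Longrightarrow> \<bar>pot_conv mp mm w (\<lambda>y. (cmod (f y))\<^sup>2) x\<bar> \<le> K * enn2real (sob_sq s g)"
    using pot_conv_bound[OF d s w] by blast
  obtain c where c: "c \<ge> 0" "\<forall>\<^sub>F \<tau> in at t within I. sob_sq s (\<Psi> \<tau>) \<le> ennreal c"
    by (rule sob_sq_locally_bounded[OF _ t _ lim]) (use S t in \<open>auto simp: in_sob_def\<close>)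
  have "\<forall>\<^sub>F \<tau> in at t within I. \<tau> \<in> I" by (simp add: eventually_at_filter)
  with c(2) have "\<forall>\<^sub>F \<tau> in at t within I. L2_norm (N \<tau>) \<le> (K * c) * sqrt c"
  proof eventually_elim
    case (elim \<tau>)
    note f = F[OF elim(2)] and n = FN[OF elim(2)]
    have e: "enn2real (sob_sq s (\<Psi> \<tau>)) \<le> c" using elim(1) c(1) by (simp add: enn2real_leI)
    have "L2_norm (N \<tau>) = L2_norm (hartree_nl mp mm w (\<psi> \<tau>))" by (rule is_fourier_L2_norm[OF n])
    also have "\<dots> \<le> (K * c) * L2_norm (\<psi> \<tau>)"
    proof (rule L2_norm_dominated)
      show "sq_int (\<psi> \<tau>)" by (rule is_fourier_L2D[OF f])
      show "hartree_nl mp mm w (\<psi> \<tau>) \<in> borel_measurable borel" by (rule sq_int_measurable[OF is_fourier_L2D(1)[OF n]])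
      show "0 \<le> K * c" using K c by simp
      have "\<bar>pot_conv mp mm w (\<lambda>y. (cmod (\<psi> \<tau> y))\<^sup>2) x\<bar> \<le> K * c" for x
        using K(2)[OF f S[OF elim(2)], of x] mult_left_mono[OF e K(1)] by linarith
      then show "AE x in lborel. cmod (hartree_nl mp mm w (\<psi> \<tau>) x) \<le> K * c * cmod (\<psi> \<tau> x)"
        by (intro AE_I2) (simp add: hartree_nl_def norm_mult mult_right_mono)
    qed
    also have "L2_norm (\<psi> \<tau>) \<le> sqrt c"
    proof -
      have "ennreal ((L2_norm (\<Psi> \<tau>))\<^sup>2) \<le> ennreal c"
        using order_trans[OF sob_sq_ge[OF s(1)] elim(1)] L2_sq_eq_norm[OF is_fourier_L2D(2)[OF f]] by simp
      then have "(L2_norm (\<Psi> \<tau>))\<^sup>2 \<le> c" using c(1) by (subst (asm) ennreal_le_iff) auto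
      then show ?thesis using is_fourier_L2_norm[OF f] real_le_rsqrt by simp
    qed
    finally show ?case using K(1) c(1) by (simp add: mult_left_mono)
  qed
  then show ?thesis by blast
qed

text \<open>For \<open>s \<ge> 1\<close> the equation itself bounds the nonlinearity, whatever the potential.\<close>

lemma nonlinearity_locally_bounded_smooth:
  fixes \<Psi> \<Phi> N :: "real \<Rightarrow> 'a::euclidean_space \<Rightarrow> complex"
  assumes s: "1 \<le> s" and \<Psi>: "\<And>\<tau>. \<tau> \<in> I \<Longrightarrow> in_sob s (\<Psi> \<tau>)" and \<Phi>: "\<And>\<tau>. \<tau> \<in> I \<Longrightarrow> in_sob (s - 1) (\<Phi> \<tau>)"
    and N: "\<And>\<tau>. \<tau> \<in> I \<Longrightarrow> sq_int (N \<tau>)"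
    and eq: "\<And>\<tau>. \<tau> \<in> I \<Longrightarrow> AE \<xi> in lborel. \<i> * \<Phi> \<tau> \<xi> = complex_of_real (jb \<xi>) * \<Psi> \<tau> \<xi> + N \<tau> \<xi>"
    and t: "t \<in> I" and lim: "((\<lambda>\<tau>. sob_sq s (\<lambda>\<xi>. \<Psi> \<tau> \<xi> - \<Psi> t \<xi>)) \<longlongrightarrow> 0) (at t within I)"
    and lim': "((\<lambda>\<tau>. sob_sq (s - 1) (\<lambda>\<xi>. \<Phi> \<tau> \<xi> - \<Phi> t \<xi>)) \<longlongrightarrow> 0) (at t within I)"
  shows "\<exists>B. \<forall>\<^sub>F \<tau> in at t within I. L2_norm (N \<tau>) \<le> B"
proof -
  obtain c where c: "c \<ge> 0" "\<forall>\<^sub>F \<tau> in at t within I. sob_sq s (\<Psi> \<tau>) \<le> ennreal c"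
    by (rule sob_sq_locally_bounded[OF _ t _ lim]) (use \<Psi> t in \<open>auto simp: in_sob_def\<close>)
  obtain c' where c': "c' \<ge> 0" "\<forall>\<^sub>F \<tau> in at t within I. sob_sq (s - 1) (\<Phi> \<tau>) \<le> ennreal c'"
    by (rule sob_sq_locally_bounded[OF _ t _ lim']) (use \<Phi> t in \<open>auto simp: in_sob_def\<close>)
  have "\<forall>\<^sub>F \<tau> in at t within I. \<tau> \<in> I" by (simp add: eventually_at_filter)
  with c(2) c'(2) have "\<forall>\<^sub>F \<tau> in at t within I. L2_norm (N \<tau>) \<le> sqrt c' + sqrt c"
  proof eventually_elim
    case (elim \<tau>)
    have [measurable]: "\<Psi> \<tau> \<in> borel_measurable borel" "\<Phi> \<tau> \<in> borel_measurable borel"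
      using \<Psi> \<Phi> elim by (auto simp: in_sob_def)
    have norm_le: "sq_int f \<and> L2_norm f \<le> sqrt b" if "f \<in> borel_measurable borel" "L2_sq f \<le> ennreal b" "b \<ge> 0" for f :: "'a \<Rightarrow> complex" and b
    proof -
      have sq: "sq_int f" using that le_less_trans[OF that(2), of \<infinity>] by (simp add: sq_int_iff)
      have "(L2_norm f)\<^sup>2 \<le> b" using that L2_sq_eq_norm[OF sq] by (subst (asm) L2_sq_eq_norm[OF sq], subst (asm) ennreal_le_iff) auto
      then show ?thesis using sq real_le_rsqrt by blast
    qed
    have p: "sq_int (\<Phi> \<tau>) \<and> L2_norm (\<Phi> \<tau>) \<le> sqrt c'"
      by (rule norm_le[OF _ order_trans[OF sob_sq_ge elim(2)] c'(1)]) (use s in auto)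
    define g where "g \<xi> = complex_of_real (jb \<xi>) * \<Psi> \<tau> \<xi>" for \<xi>
    have "L2_sq g \<le> sob_sq s (\<Psi> \<tau>)"
      unfolding L2_sq_lborel sob_sq_def
    proof (intro nn_integral_mono ennreal_leI)
      fix \<xi> :: 'a
      have "(jb \<xi>)\<^sup>2 = jb \<xi> powr 2" by simp
      also have "\<dots> \<le> jb \<xi> powr (2 * s)" using s by (intro powr_mono jb_ge_1) simp
      finally show "(cmod (g \<xi>))\<^sup>2 \<le> jb \<xi> powr (2 * s) * (cmod (\<Psi> \<tau> \<xi>))\<^sup>2"
        by (simp add: g_def norm_mult power_mult_distrib mult_right_mono)
    qed
    from order_trans[OF this elim(1)]
    have g: "sq_int g \<and> L2_norm g \<le> sqrt c" by (intro norm_le c) (simp_all add: g_def[abs_def])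
    \<comment> \<open>The equation solved for \<open>N\<close>: the time derivative is in L^2
      because \<open>s - 1 \<ge> 0\<close>, and the kinetic term \<open>g\<close> because
      \<open>s \<ge> 1\<close>.\<close>
    have "L2_norm (N \<tau>) = L2_norm (\<lambda>\<xi>. \<i> * \<Phi> \<tau> \<xi> - g \<xi>)"
      by (rule L2_norm_cong_AE) (use eq[OF elim(3)] in eventually_elim, simp add: g_def)
    also have "\<dots> \<le> L2_norm (\<lambda>\<xi>. \<i> * \<Phi> \<tau> \<xi>) + L2_norm g"
      using p g by (intro L2_norm_triangle_diff sq_int_scale) auto
    also have "L2_norm (\<lambda>\<xi>. \<i> * \<Phi> \<tau> \<xi>) = L2_norm (\<Phi> \<tau>)" using p by (simp add: L2_norm_scale)
    finally show ?case using p g by simp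
  qed
  then show ?thesis by blast
qed

lemma hartree_regular_flow:
  fixes w :: "'a::euclidean_space \<Rightarrow> real"
  assumes d: "DIM('a) \<ge> 3" and s: "0 \<le> s" and w: "W_class s mp mm w"
    and sol: "hartree_maximal_solution s mp mm w \<psi>0 T \<psi>"
  obtains \<Psi> N where "regular_flow T \<psi> \<Psi> N (\<lambda>t. pot_conv mp mm w (\<lambda>y. (cmod (\<psi> t y))\<^sup>2))"
    "AE x in lborel. \<psi> 0 x = \<psi>0 x"
proof -
  define I where "I = {t::real. 0 \<le> t \<and> ereal t < T}"
  obtain \<Psi> \<Phi> N where
      F: "\<And>t. t \<in> I \<Longrightarrow> is_fourier_L2 (\<psi> t) (\<Psi> t)"
      and \<Psi>: "\<And>t. t \<in> I \<Longrightarrow> in_sob s (\<Psi> t)" and \<Phi>: "\<And>t. t \<in> I \<Longrightarrow> in_sob (s - 1) (\<Phi> t)"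
      and l1: "\<And>t. t \<in> I \<Longrightarrow> ((\<lambda>\<tau>. sob_sq s (\<lambda>\<xi>. \<Psi> \<tau> \<xi> - \<Psi> t \<xi>)) \<longlongrightarrow> 0) (at t within I)"
      and l2: "\<And>t. t \<in> I \<Longrightarrow> ((\<lambda>\<tau>. sob_sq (s - 1) (\<lambda>\<xi>. (\<Psi> \<tau> \<xi> - \<Psi> t \<xi>) / complex_of_real (\<tau> - t) - \<Phi> t \<xi>)) \<longlongrightarrow> 0) (at t within I)"
      and l3: "\<And>t. t \<in> I \<Longrightarrow> ((\<lambda>\<tau>. sob_sq (s - 1) (\<lambda>\<xi>. \<Phi> \<tau> \<xi> - \<Phi> t \<xi>)) \<longlongrightarrow> 0) (at t within I)"
      and FN: "\<And>t. t \<in> I \<Longrightarrow> is_fourier_L2 (hartree_nl mp mm w (\<psi> t)) (N t)"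
      and eq: "\<And>t. t \<in> I \<Longrightarrow> AE \<xi> in lborel. \<i> * \<Phi> t \<xi> = complex_of_real (jb \<xi>) * \<Psi> t \<xi> + N t \<xi>"
      and init: "AE x in lborel. \<psi> 0 x = \<psi>0 x"
    using sol unfolding hartree_maximal_solution_def Let_def I_def[symmetric] by blast
  have sq: "sq_int (\<Psi> t)" "sq_int (N t)" if "t \<in> I" for t
    using is_fourier_L2D[OF F[OF that]] is_fourier_L2D[OF FN[OF that]] by auto
  have "regular_flow T \<psi> \<Psi> N (\<lambda>t. pot_conv mp mm w (\<lambda>y. (cmod (\<psi> t y))\<^sup>2))"
  proof (unfold_locales, unfold I_def[symmetric])
    fix t :: real assume "0 \<le> t" "ereal t < T"
    then have t: "t \<in> I" by (simp add: I_def)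
    show "is_fourier_L2 (\<psi> t) (\<Psi> t)" by (rule F[OF t])
    show "is_fourier_L2 (\<lambda>x. complex_of_real (pot_conv mp mm w (\<lambda>y. (cmod (\<psi> t y))\<^sup>2) x) * \<psi> t x) (N t)"
      using FN[OF t] by (simp add: hartree_nl_def[abs_def])
    show "((\<lambda>\<tau>. L2_norm (\<lambda>\<xi>. \<Psi> \<tau> \<xi> - \<Psi> t \<xi>)) \<longlongrightarrow> 0) (at t within I)"
    proof (rule L2_sq_tendsto_0_iff[THEN iffD1])
      show "\<forall>\<^sub>F \<tau> in at t within I. sq_int (\<lambda>\<xi>. \<Psi> \<tau> \<xi> - \<Psi> t \<xi>)"
        using sq_int_diff[OF sq(1) sq(1)[OF t]] by (simp add: eventually_at_filter)
      show "((\<lambda>\<tau>. L2_sq (\<lambda>\<xi>. \<Psi> \<tau> \<xi> - \<Psi> t \<xi>)) \<longlongrightarrow> 0) (at t within I)"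
        by (rule tendsto_sandwich[OF _ _ tendsto_const l1[OF t]]) (simp_all add: sob_sq_ge[OF s])
    qed
    show "\<exists>B. \<forall>\<^sub>F \<tau> in at t within I. L2_norm (N \<tau>) \<le> B"
    \<comment> \<open>Below 1 the bound comes from the potential, from 1 on it comes from the
      equation. Measures are allowed only for \<open>s > d / 2\<close>, hence fall under the second
      case.\<close>
    proof (cases "s < 1")
      case True
      show ?thesis by (rule nonlinearity_locally_bounded_rough[OF d s True w F \<Psi> FN t l1[OF t]])
    next
      case False
      then have "1 \<le> s" by simp
      from nonlinearity_locally_bounded_smooth[OF this \<Psi> \<Phi> sq(2) eq t l1[OF t] l3[OF t]] show ?thesis .
    qed
    fix K
    have "\<forall>\<^sub>F k in at_right 0. t + k \<in> I"
    proof -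
      have "((\<lambda>k. ereal (t + k)) \<longlongrightarrow> ereal (t + 0)) (at_right 0)" by (intro tendsto_intros)
      then have "\<forall>\<^sub>F k in at_right 0. ereal (t + k) < T" by (rule order_tendstoD) (use t in \<open>simp add: I_def\<close>)
      moreover have "\<forall>\<^sub>F k in at_right 0. (0::real) < k" by (rule eventually_at_right_less)
      ultimately show ?thesis by eventually_elim (use t in \<open>simp add: I_def\<close>)
    qed
    from generator_limit[OF s sq(1) t this \<Phi>[OF t] sq(2)[OF t] l2[OF t] eq[OF t]]
    show "((\<lambda>k. L2_norm (\<lambda>\<xi>. indicator (ball 0 K) \<xi> *
        ((\<Psi> (t + k) \<xi> - phase k \<xi> * \<Psi> t \<xi>) / complex_of_real k + \<i> * N t \<xi>))) \<longlongrightarrow> 0) (at_right 0)" .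
  qed
  with init that show thesis by blast
qed

subsection \<open>Separation by half-spaces\<close>

text \<open>At distance zero (in particular if one of the sets is empty) one can take \<open>e = 0\<close>: the weight is
  then constant, and the weighted bound says that the mass does not grow.\<close>

lemma convex_separation_setdist:
  fixes X Y :: "'a::euclidean_space set"
  assumes "convex X" "convex Y"
  obtains e a where "norm e \<le> 1" "\<And>x. x \<in> X \<Longrightarrow> e \<bullet> x \<le> a" "\<And>y. y \<in> Y \<Longrightarrow> a + setdist X Y \<le> e \<bullet> y"
proof (cases "setdist X Y = 0")
  case True
  then show thesis by (intro that[of 0 0]) auto
next
  case False
  define D where "D = setdist X Y"
  have D: "D > 0" unfolding D_def using False setdist_pos_le by (metis order_less_le)
  have ne: "X \<noteq> {}" "Y \<noteq> {}" using False by (auto simp: setdist_empty1 setdist_empty2)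
  \<comment> \<open>Separating \<open>X\<close> from \<open>Y\<close> with a gap amounts to
    separating the set of differences from the origin.\<close>
  define S where "S = (\<Union>y\<in>Y. \<Union>x\<in>X. {y - x})"
  have "convex S" unfolding S_def by (rule convex_differences[OF assms(2,1)])
  then have cS: "convex (closure S)" by (rule convex_closure)
  have neS: "closure S \<noteq> {}" using ne by (auto simp: S_def)
  have "S \<subseteq> {z. D \<le> norm z}"
  proof
    fix z assume "z \<in> S"
    then obtain x y where "x \<in> X" "y \<in> Y" "z = y - x" by (auto simp: S_def)
    then show "z \<in> {z. D \<le> norm z}" using setdist_le_dist[of x X y Y] by (simp add: D_def dist_norm norm_minus_commute)
  qed
  moreover have "closed {z::'a. D \<le> norm z}" by (intro closed_Collect_le continuous_intros)
  ultimately have SD: "closure S \<subseteq> {z. D \<le> norm z}" by (rule closure_minimal)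
  \<comment> \<open>The point nearest to the origin gives the normal direction: its norm is at least
    \<open>D\<close>, and the variational inequality for the projection yields the
    half-space.\<close>
  define z where "z = closest_point (closure S) 0"
  have zS: "z \<in> closure S" unfolding z_def by (rule closest_point_in_set[OF closed_closure neS])
  have zD: "D \<le> norm z" using zS SD by auto
  then have z0: "norm z > 0" using D by linarith
  have zv: "(norm z)\<^sup>2 \<le> z \<bullet> v" if "v \<in> S" for v
  proof -
    have "v \<in> closure S" using that closure_subset by blast
    from closest_point_dot[OF cS closed_closure this, of 0]
    show ?thesis unfolding z_def[symmetric] by (simp add: inner_diff_right power2_norm_eq_inner)
  qed
  define e where "e = (1 / norm z) *\<^sub>R z"
  have sep: "e \<bullet> x + D \<le> e \<bullet> y" if "x \<in> X" "y \<in> Y" for x y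
  proof -
    have "(norm z)\<^sup>2 \<le> z \<bullet> (y - x)" by (rule zv) (use that in \<open>auto simp: S_def\<close>)
    then have "norm z \<le> e \<bullet> (y - x)" using z0 by (simp add: e_def power2_eq_square field_simps)
    then show ?thesis using zD by (simp add: inner_diff_right)
  qed
  \<comment> \<open>The supremum over \<open>X\<close> serves as threshold for both half-spaces; any
    point of \<open>Y\<close> bounds it from above.\<close>
  define a where "a = (SUP x\<in>X. e \<bullet> x)"
  obtain y0 where y0: "y0 \<in> Y" using ne by blast
  have "bdd_above ((\<lambda>x. e \<bullet> x) ` X)" using sep[OF _ y0] by (intro bdd_aboveI2[where M="e \<bullet> y0 - D"]) force
  then have ax: "e \<bullet> x \<le> a" if "x \<in> X" for x unfolding a_def using that by (rule cSUP_upper2[OF _ _ order_refl])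
  have ay: "a + D \<le> e \<bullet> y" if "y \<in> Y" for y
  proof -
    have "a \<le> e \<bullet> y - D" unfolding a_def using sep[OF _ that] ne by (intro cSUP_least) force+
    then show ?thesis by simp
  qed
  show thesis
    by (rule that[of e a]) (use ax ay z0 in \<open>auto simp: e_def D_def\<close>)
qed

text \<open>On \<open>Y\<close> the cutoff weight is at least
  \<open>1 / (exp (- 2 * b) + d)\<close>. The comparison is pointwise, hence valid for a set not
  known to be Borel, and the majorant is Borel, so its integral over the completion is the one over
  \<open>lborel\<close>.\<close>

lemma L2_sq_localized_le:
  assumes d: "d > 0" and f: "sq_int f" and Y: "\<And>y. y \<in> Y \<Longrightarrow> b \<le> v \<bullet> y"
  shows "L2_sq (\<lambda>x. indicator Y x * f x) \<le> ennreal ((exp (- 2 * b) + d) * (\<integral>x. cutoff_weight v d x * (cmod (f x))\<^sup>2 \<partial>lborel))"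
proof -
  define c where "c = exp (- 2 * b) + d"
  have c: "c > 0" using d by (simp add: c_def add_pos_pos)
  have "(cmod (indicator Y x * f x))\<^sup>2 \<le> c * (cutoff_weight v d x * (cmod (f x))\<^sup>2)" for x
  proof (cases "x \<in> Y")
    case True
    have "exp (- 2 * (v \<bullet> x)) + d \<le> c" using Y[OF True] by (simp add: c_def)
    then have "1 \<le> c * cutoff_weight v d x"
      unfolding cutoff_weight_def using d by (simp add: add_pos_pos)
    then have "1 * (cmod (f x))\<^sup>2 \<le> (c * cutoff_weight v d x) * (cmod (f x))\<^sup>2" by (intro mult_right_mono) auto
    then show ?thesis using True by (simp add: mult.assoc)
  next
    case False
    then show ?thesis using c cutoff_weight_pos[OF d, of v x] by simp
  qed
  then have "L2_sq (\<lambda>x. indicator Y x * f x) \<le> (\<integral>\<^sup>+x. ennreal (c * (cutoff_weight v d x * (cmod (f x))\<^sup>2)) \<partial>lebesgue)"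
    unfolding L2_sq_def by (intro nn_integral_mono ennreal_leI)
  also have "\<dots> = (\<integral>\<^sup>+x. ennreal (c * (cutoff_weight v d x * (cmod (f x))\<^sup>2)) \<partial>lborel)" by (rule nn_integral_completion)
  also have "\<dots> = ennreal (\<integral>x. c * (cutoff_weight v d x * (cmod (f x))\<^sup>2) \<partial>lborel)"
  proof (rule nn_integral_eq_integral)
    show "integrable lborel (\<lambda>x. c * (cutoff_weight v d x * (cmod (f x))\<^sup>2))"
      by (intro integrable_mult_right integrable_cutoff_weight f d)
    show "AE x in lborel. 0 \<le> c * (cutoff_weight v d x * (cmod (f x))\<^sup>2)"
      using c cutoff_weight_pos[OF d, of v] by (intro AE_I2 mult_nonneg_nonneg) (auto simp: less_imp_le)
  qed
  also have "(\<integral>x. c * (cutoff_weight v d x * (cmod (f x))\<^sup>2) \<partial>lborel) = c * (\<integral>x. cutoff_weight v d x * (cmod (f x))\<^sup>2 \<partial>lborel)"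
    by (rule integral_mult_right_zero)
  finally show ?thesis by (simp add: c_def)
qed

text \<open>The cutoff weight never exceeds \<open>exp (2 * (v \<bullet> x))\<close>, which is at
  most \<open>exp (2 * b)\<close> on the support; the bound is uniform in \<open>d\<close>.\<close>

lemma cutoff_mass_le:
  assumes d: "d > 0" and f: "sq_int f" and X: "\<And>x. x \<in> X \<Longrightarrow> v \<bullet> x \<le> b" and supp: "AE x in lebesgue. f x = 0 \<or> x \<in> X"
  shows "(\<integral>x. cutoff_weight v d x * (cmod (f x))\<^sup>2 \<partial>lborel) \<le> exp (2 * b) * (L2_norm f)\<^sup>2"
proof -
  have fm [measurable]: "f \<in> borel_measurable borel" using f by (rule sq_int_measurable)
  have "AE x in lebesgue. cutoff_weight v d x * (cmod (f x))\<^sup>2 \<le> exp (2 * b) * (cmod (f x))\<^sup>2"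
    using supp
  proof eventually_elim
    case (elim x)
    show ?case
    proof (cases "f x = 0")
      case False
      then have "v \<bullet> x \<le> b" using elim X by blast
      have "cutoff_weight v d x \<le> 1 / exp (- 2 * (v \<bullet> x))"
        unfolding cutoff_weight_def using d by (intro divide_left_mono mult_pos_pos add_pos_pos) auto
      also have "\<dots> = exp (2 * (v \<bullet> x))" by (simp add: exp_minus inverse_eq_divide)
      also have "\<dots> \<le> exp (2 * b)" using \<open>v \<bullet> x \<le> b\<close> by simp
      finally show ?thesis by (rule mult_right_mono) simp
    qed simp
  qed
  then have ae: "AE x in lborel. cutoff_weight v d x * (cmod (f x))\<^sup>2 \<le> exp (2 * b) * (cmod (f x))\<^sup>2"
    by (subst (asm) AE_completion_iff) simp_all
  have "(\<integral>x. cutoff_weight v d x * (cmod (f x))\<^sup>2 \<partial>lborel) \<le> (\<integral>x. exp (2 * b) * (cmod (f x))\<^sup>2 \<partial>lborel)"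
    by (rule integral_mono_AE[OF integrable_cutoff_weight[OF f d] _ ae]) (use f in \<open>auto simp: sq_int_def\<close>)
  then show ?thesis by (simp add: L2_norm_sq[OF f])
qed

theorem theorem2p3:
  fixes X Y :: "'a::euclidean_space set"
    and s :: real and mp mm :: "'a measure" and w :: "'a \<Rightarrow> real"
    and \<psi>0 :: "'a \<Rightarrow> complex" and T :: ereal and \<psi> :: "real \<Rightarrow> 'a \<Rightarrow> complex"
  assumes "DIM('a) \<ge> 3"
    and "convex X" and "convex Y"
    and "s \<ge> 0"
    and "W_class s mp mm w"
    and "in_Hs s \<psi>0"
    and "AE x in lebesgue. indicator X x * \<psi>0 x = \<psi>0 x"
    and "hartree_maximal_solution s mp mm w \<psi>0 T \<psi>"
  shows "\<forall>t. 0 \<le> t \<and> ereal t < T \<longrightarrow>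
           L2_norm (\<lambda>x. indicator Y x * \<psi> t x) \<le> exp (t - setdist X Y) * L2_norm \<psi>0"
proof (intro allI impI)
  fix t :: real assume t: "0 \<le> t \<and> ereal t < T"
  obtain \<Psi> N where "regular_flow T \<psi> \<Psi> N (\<lambda>t. pot_conv mp mm w (\<lambda>y. (cmod (\<psi> t y))\<^sup>2))"
    and init: "AE x in lborel. \<psi> 0 x = \<psi>0 x"
    using hartree_regular_flow[OF assms(1,4,5,8)] .
  then interpret regular_flow T \<psi> \<Psi> N "\<lambda>t. pot_conv mp mm w (\<lambda>y. (cmod (\<psi> t y))\<^sup>2)" by simp
  define D where "D = setdist X Y"
  obtain e a where e: "norm e \<le> 1" and X: "\<And>x. x \<in> X \<Longrightarrow> e \<bullet> x \<le> a" and Y: "\<And>y. y \<in> Y \<Longrightarrow> a + D \<le> e \<bullet> y"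
    using convex_separation_setdist[OF assms(2,3)] unfolding D_def by blast
  have T0: "0 \<le> (0::real)" "ereal 0 < T" using t le_less_trans[of "ereal 0" "ereal t" T] by auto
  have sq0: "sq_int (\<psi> 0)" and sqt: "sq_int (\<psi> t)" using sq_int_flow(1)[OF T0] sq_int_flow(1) t by auto
  have n0: "L2_norm (\<psi> 0) = L2_norm \<psi>0" by (rule L2_norm_cong_AE) (use init in eventually_elim, simp)
  have supp: "AE x in lebesgue. \<psi> 0 x = 0 \<or> x \<in> X"
    using AE_completion[OF init] assms(7)
  proof eventually_elim
    case (elim x)
    then show ?case by (cases "x \<in> X") auto
  qed
  define M where "M = L2_sq (\<lambda>x. indicator Y x * \<psi> t x)"
  \<comment> \<open>For \<open>d = 0\<close> the factors with \<open>\<kappa> * a\<close>, which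
    record the position of the half-spaces, cancel, so that only the distance \<open>D\<close>
    remains.\<close>
  have step: "M \<le> ennreal ((exp (- 2 * (\<kappa> * (a + D))) + d) * (exp (2 * t * \<kappa>) * (exp (2 * (\<kappa> * a)) * (L2_norm \<psi>0)\<^sup>2)))"
    if \<kappa>: "0 \<le> \<kappa>" "\<kappa> < 1" and d: "d > 0" for \<kappa> d
  proof -
    define v where "v = \<kappa> *\<^sub>R e"
    have nv: "norm v \<le> \<kappa>" using \<kappa> e by (simp add: v_def mult_left_le)
    have v1: "norm v < 1" using nv \<kappa> by linarith
    have Xv: "v \<bullet> x \<le> \<kappa> * a" if "x \<in> X" for x using X[OF that] \<kappa> by (simp add: v_def mult_left_mono)
    have Yv: "\<kappa> * (a + D) \<le> v \<bullet> y" if "y \<in> Y" for y using Y[OF that] \<kappa> by (simp add: v_def mult_left_mono)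
    have "M \<le> ennreal ((exp (- 2 * (\<kappa> * (a + D))) + d) * (\<integral>x. cutoff_weight v d x * (cmod (\<psi> t x))\<^sup>2 \<partial>lborel))"
      unfolding M_def by (rule L2_sq_localized_le[OF d sqt Yv])
    also have "\<dots> \<le> ennreal ((exp (- 2 * (\<kappa> * (a + D))) + d) * (exp (2 * t * \<kappa>) * (exp (2 * (\<kappa> * a)) * (L2_norm \<psi>0)\<^sup>2)))"
    proof (intro ennreal_leI mult_left_mono)
      have "(\<integral>x. cutoff_weight v d x * (cmod (\<psi> t x))\<^sup>2 \<partial>lborel) \<le> exp (2 * t * norm v) * (\<integral>x. cutoff_weight v d x * (cmod (\<psi> 0 x))\<^sup>2 \<partial>lborel)"
        using t by (intro weighted_growth v1 d) auto
      also have "\<dots> \<le> exp (2 * t * \<kappa>) * (exp (2 * (\<kappa> * a)) * (L2_norm \<psi>0)\<^sup>2)"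
      proof (rule mult_mono)
        show "exp (2 * t * norm v) \<le> exp (2 * t * \<kappa>)" using t nv by (simp add: mult_left_mono)
        show "(\<integral>x. cutoff_weight v d x * (cmod (\<psi> 0 x))\<^sup>2 \<partial>lborel) \<le> exp (2 * (\<kappa> * a)) * (L2_norm \<psi>0)\<^sup>2"
          using cutoff_mass_le[OF d sq0 Xv supp] by (simp add: n0)
        show "0 \<le> (\<integral>x. cutoff_weight v d x * (cmod (\<psi> 0 x))\<^sup>2 \<partial>lborel)"
          using cutoff_weight_pos[OF d, of v] by (intro integral_nonneg_AE) (auto simp: less_imp_le)
      qed simp
      finally show "(\<integral>x. cutoff_weight v d x * (cmod (\<psi> t x))\<^sup>2 \<partial>lborel) \<le> exp (2 * t * \<kappa>) * (exp (2 * (\<kappa> * a)) * (L2_norm \<psi>0)\<^sup>2)" .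
    qed (use d in simp)
    finally show ?thesis .
  qed
  \<comment> \<open>Finiteness has to be known before passing to real numbers, since
    \<open>enn2real\<close> sends infinity to 0. The choice \<kappa> = 0, d = 1 is merely
    admissible.\<close>
  have "M < \<infinity>"
    using step[of 0 1] by (rule le_less_trans) simp_all
  then have M: "M = ennreal (enn2real M)" by simp
  have step': "enn2real M \<le> (exp (- 2 * (\<kappa> * (a + D))) + d) * (exp (2 * t * \<kappa>) * (exp (2 * (\<kappa> * a)) * (L2_norm \<psi>0)\<^sup>2))"
    if "0 \<le> \<kappa>" "\<kappa> < 1" "d > 0" for \<kappa> d
    using step[OF that] that by (subst (asm) M, subst (asm) ennreal_le_iff) auto
  \<comment> \<open>The cutoff is removed at fixed \<kappa>: the left-hand side does not involve the
    weight, so \<open>d\<close> may tend to 0.\<close>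
  have "enn2real M \<le> (exp (- 2 * (\<kappa> * (a + D))) + 0) * (exp (2 * t * \<kappa>) * (exp (2 * (\<kappa> * a)) * (L2_norm \<psi>0)\<^sup>2))"
    if \<kappa>: "0 \<le> \<kappa>" "\<kappa> < 1" for \<kappa>
  proof (rule tendsto_lowerbound)
    show "((\<lambda>d. (exp (- 2 * (\<kappa> * (a + D))) + d) * (exp (2 * t * \<kappa>) * (exp (2 * (\<kappa> * a)) * (L2_norm \<psi>0)\<^sup>2)))
        \<longlongrightarrow> (exp (- 2 * (\<kappa> * (a + D))) + 0) * (exp (2 * t * \<kappa>) * (exp (2 * (\<kappa> * a)) * (L2_norm \<psi>0)\<^sup>2))) (at_right 0)"
      by (intro tendsto_intros)
    show "\<forall>\<^sub>F d in at_right 0. enn2real M \<le> (exp (- 2 * (\<kappa> * (a + D))) + d) * (exp (2 * t * \<kappa>) * (exp (2 * (\<kappa> * a)) * (L2_norm \<psi>0)\<^sup>2))"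
      using eventually_at_right_less[of "0::real"] by eventually_elim (rule step'[OF \<kappa>])
  qed simp
  moreover have "(exp (- 2 * (\<kappa> * (a + D))) + 0) * (exp (2 * t * \<kappa>) * (exp (2 * (\<kappa> * a)) * L)) = exp (2 * (\<kappa> * (t - D))) * L" for \<kappa> L
  proof -
    have "- 2 * (\<kappa> * (a + D)) + (2 * t * \<kappa> + 2 * (\<kappa> * a)) = 2 * (\<kappa> * (t - D))" by (simp add: algebra_simps)
    then show ?thesis by (simp only: add_0_right mult.assoc[symmetric] exp_add[symmetric] add.assoc)
  qed
  ultimately have \<kappa>_bound: "enn2real M \<le> exp (2 * (\<kappa> * (t - D))) * (L2_norm \<psi>0)\<^sup>2" if "0 \<le> \<kappa>" "\<kappa> < 1" for \<kappa>
    using that by (simp only:)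
  \<comment> \<open>The rate 1 is reached only as a limit, because the multiplier estimates require
    \<open>norm v < 1\<close>.\<close>
  have "enn2real M \<le> exp (2 * (1 * (t - D))) * (L2_norm \<psi>0)\<^sup>2"
  proof (rule tendsto_lowerbound)
    show "((\<lambda>\<kappa>. exp (2 * (\<kappa> * (t - D))) * (L2_norm \<psi>0)\<^sup>2) \<longlongrightarrow> exp (2 * (1 * (t - D))) * (L2_norm \<psi>0)\<^sup>2) (at_left 1)"
      by (intro tendsto_intros)
    have "\<forall>\<^sub>F \<kappa> in at_left 1. \<kappa> \<in> {0<..<1::real}" by (rule eventually_at_left_real) simp
    then show "\<forall>\<^sub>F \<kappa> in at_left 1. enn2real M \<le> exp (2 * (\<kappa> * (t - D))) * (L2_norm \<psi>0)\<^sup>2"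
      by eventually_elim (rule \<kappa>_bound, auto)
  qed simp
  also have "\<dots> = (exp (t - D) * L2_norm \<psi>0)\<^sup>2"
    by (simp add: power_mult_distrib power2_eq_square[of "exp _"] exp_add[symmetric])
  finally have "sqrt (enn2real M) \<le> sqrt ((exp (t - D) * L2_norm \<psi>0)\<^sup>2)" by (rule real_sqrt_le_mono)
  then show "L2_norm (\<lambda>x. indicator Y x * \<psi> t x) \<le> exp (t - setdist X Y) * L2_norm \<psi>0"
    unfolding L2_norm_def[of "\<lambda>x. indicator Y x * \<psi> t x"] M_def[symmetric] D_def by simp
qed

end
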